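(* Let $\mathcal E$ be the modified Manakov–Santini system $$F_1=(u_t+u u_y+v u_x)_x-(u_y)_y=0,\qquad F_2=(v_t+v v_x-u v_y)_x-(v_y-2u v_x)_y=0,$$ and $\mathfrak g$ its Lie algebra of infinitesimal point symmetries. The field of rational $\mathfrak g$-differential invariants on $\mathcal E$ is generated by the differential invariant $$I_2=\frac{u_x^2u_{xy}+u_xu_{xx}v_x+u_{xx}u_{yy}-u_{xy}^2}{u_x^4}$$ together with the invariant derivations \begin{align*} \nabla_1&=\frac{u_x}{u_{xx}}D_x,\qquad \nabla_2=\frac1{u_x}\Bigl(\frac{u_{xy}}{u_{xx}}D_x-D_y\Bigr),\\ \nabla_3&=\frac1{u_x^3}\Bigl(u_{xx}D_t+\bigl((vu_x)_x+u_{yy}\bigr)D_x+(uu_x-2u_y)_x\,D_y\Bigr). \end{align*}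
   Context: Let $M=\mathbb R^3(t,x,y)$, $\pi\colon E=M\times\mathbb R^2(u,v)\to M$ the trivial bundle, $J^k\pi$ its jet bundles. Put $\mathcal E_0=E$, $\mathcal E_1=J^1\pi$, $\mathcal E_2=\{F_1=F_2=0\}\subset J^2\pi$, let $\mathcal E_k\subset J^k\pi$ for $k>2$ be the prolongations of $\mathcal E_2$, and let $\mathcal E\subset J^\infty\pi$ be their projective limit. $D_t,D_x,D_y$ are the total derivatives (restricted to $\mathcal E$); subscripts on parenthesized expressions denote total derivatives. The Lie algebra $\mathfrak g$ consists of the vector fields $X_1(a)+X_2(b)+X_3(c)+X_4(d)+X_5(e)$ on $E$, with $a,b,c,d,e$ arbitrary smooth functions of $t$ (dot $=d/dt$), where \begin{align*} X_1(a)&= a\,\partial_x+\dot a\,\partial_v,\\ X_2(b)&= b\,\partial_y+\dot b\,\partial_u,\\ X_3(c)&= y c\,\partial_x-2c\,\partial_u+(u c+y\dot c)\,\partial_v,\\ X_4(d)&= d\,\partial_t+\tfrac12\dot d\, y\,\partial_y+\tfrac12(y\ddot d-u\dot d)\,\partial_u-\dot d\, v\,\partial_v,\\ X_5(e)&= (y^2\dot e+2xe)\,\partial_x+ye\,\partial_y+(ue-3y\dot e)\,\partial_u+(y^2\ddot e+2yu\dot e+2ve+2x\dot e)\,\partial_v . \end{align*} A rational (scalar) differential invariant of order $k$ is a function $I$ on $\mathcal E_k$, rational along the fibers of $\mathcal E_k\to E$, with $L_{X^{(k)}}I=0$ for all $X\in\mathfrak g$, where $X^{(k)}$ is the prolongation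 of $X$ to $k$-jets. Rational differential invariants of all orders form a field. An invariant derivation is a derivation of the algebra of differential invariants (a combination of total derivatives) commuting with the prolonged action of $\mathfrak g$; $\nabla_1,\nabla_2,\nabla_3$ are such. "Generated" means that every rational differential invariant is a rational function of $I_2$ and finitely many of its iterated derivatives $\nabla_{i_1}\cdots\nabla_{i_r}I_2$. *)

theory Defs
  imports "HOL-Analysis.Analysis"
begin

datatype indep = Ti | Xi | Yi
datatype dep = Ud | Vd

text \<open>The multi-index \<open>(i, j, l)\<close> stands for \<open>i\<close> derivatives in \<open>t\<close>, \<open>j\<close> in \<open>x\<close> and \<open>l\<close> in \<open>y\<close>.\<close>

type_synonym mindex = "nat \<times> nat \<times> nat"

fun order :: "mindex \<Rightarrow> nat" where
  "order (i, j, l) = i + j + l"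

fun inc :: "indep \<Rightarrow> mindex \<Rightarrow> mindex" where
  "inc Ti (i, j, l) = (Suc i, j, l)"
| "inc Xi (i, j, l) = (i, Suc j, l)"
| "inc Yi (i, j, l) = (i, j, Suc l)"

text \<open>A point of the infinite jet space is given by the values of all its coordinates. Points and
  functions of the \<open>k\<close>-jet space are not given a type of their own: subsets of it are represented by
  their preimages in the infinite jet space, and functions on it by their pullbacks, i.e. by
  functions of the coordinates of order at most \<open>k\<close>.\<close>

datatype coord = Base indep | Jet dep mindex

type_synonym jet = "coord \<Rightarrow> real"

abbreviation u_0 :: "jet \<Rightarrow> real" where "u_0 z \<equiv> z (Jet Ud (0, 0, 0))"
abbreviation u_t :: "jet \<Rightarrow> real" where "u_t z \<equiv> z (Jet Ud (1, 0, 0))"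
abbreviation u_x :: "jet \<Rightarrow> real" where "u_x z \<equiv> z (Jet Ud (0, 1, 0))"
abbreviation u_y :: "jet \<Rightarrow> real" where "u_y z \<equiv> z (Jet Ud (0, 0, 1))"
abbreviation u_xx :: "jet \<Rightarrow> real" where "u_xx z \<equiv> z (Jet Ud (0, 2, 0))"
abbreviation u_xy :: "jet \<Rightarrow> real" where "u_xy z \<equiv> z (Jet Ud (0, 1, 1))"
abbreviation u_yy :: "jet \<Rightarrow> real" where "u_yy z \<equiv> z (Jet Ud (0, 0, 2))"
abbreviation v_0 :: "jet \<Rightarrow> real" where "v_0 z \<equiv> z (Jet Vd (0, 0, 0))"
abbreviation v_t :: "jet \<Rightarrow> real" where "v_t z \<equiv> z (Jet Vd (1, 0, 0))"
abbreviation v_x :: "jet \<Rightarrow> real" where "v_x z \<equiv> z (Jet Vd (0, 1, 0))"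
abbreviation v_y :: "jet \<Rightarrow> real" where "v_y z \<equiv> z (Jet Vd (0, 0, 1))"

text \<open>Points \<open>(t, x, y, u, v)\<close> of the total space \<open>E\<close> of the bundle, and the projection to it.\<close>

type_synonym point = "real \<times> real \<times> real \<times> real \<times> real"

definition pt :: "jet \<Rightarrow> point" where
  "pt z = (z (Base Ti), z (Base Xi), z (Base Yi), u_0 z, v_0 z)"

text \<open>A vector field \<open>\<xi>\<close> on the infinite jet space is given by its components. Its action on \<open>f\<close> is the
  directional derivative; for a differentiable function \<open>f\<close> of finitely many coordinates this is
  the sum of \<open>\<xi> z c \<cdot> \<partial>f/\<partial>c\<close> over these coordinates \<open>c\<close>.\<close>

definition Lie :: "(jet \<Rightarrow> coord \<Rightarrow> real) \<Rightarrow> (jet \<Rightarrow> real) \<Rightarrow> jet \<Rightarrow> real" where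
  "Lie \<xi> f z = deriv (\<lambda>s. f (\<lambda>c. z c + s * \<xi> z c)) 0"

fun total_field :: "indep \<Rightarrow> jet \<Rightarrow> coord \<Rightarrow> real" where
  "total_field i z (Base j) = (if i = j then 1 else 0)"
| "total_field i z (Jet \<alpha> \<sigma>) = z (Jet \<alpha> (inc i \<sigma>))"

definition D :: "indep \<Rightarrow> (jet \<Rightarrow> real) \<Rightarrow> jet \<Rightarrow> real" where
  "D i = Lie (total_field i)"

fun D_multi :: "mindex \<Rightarrow> (jet \<Rightarrow> real) \<Rightarrow> jet \<Rightarrow> real" where
  "D_multi (i, j, l) f = (D Ti ^^ i) ((D Xi ^^ j) ((D Yi ^^ l) f))"

fun base_comp :: "indep \<Rightarrow> point \<Rightarrow> real" where
  "base_comp Ti (t, x, y, u, v) = t"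
| "base_comp Xi (t, x, y, u, v) = x"
| "base_comp Yi (t, x, y, u, v) = y"

fun fibre_comp :: "dep \<Rightarrow> point \<Rightarrow> real" where
  "fibre_comp Ud (t, x, y, u, v) = u"
| "fibre_comp Vd (t, x, y, u, v) = v"

text \<open>A vector field on \<open>E\<close> is a function \<open>X :: point \<Rightarrow> point\<close>, tangent vectors being written in
  the basis \<open>\<partial>\<^sub>t, \<partial>\<^sub>x, \<partial>\<^sub>y, \<partial>\<^sub>u, \<partial>\<^sub>v\<close>. Its prolongation is given by the usual formula: with base components
  \<open>\<xi>\<^sup>i\<close>, fibre components \<open>\<phi>\<^sup>\<alpha>\<close> and characteristic \<open>\<phi>\<^sup>\<alpha> - \<Sum>\<^sub>i \<xi>\<^sup>i w\<^sup>\<alpha>\<^sub>i\<close>, the component along the coordinate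
  \<open>w\<^sup>\<alpha>\<^sub>\<sigma>\<close> is \<open>D\<^sub>\<sigma> (\<phi>\<^sup>\<alpha> - \<Sum>\<^sub>i \<xi>\<^sup>i w\<^sup>\<alpha>\<^sub>i) + \<Sum>\<^sub>i \<xi>\<^sup>i w\<^sup>\<alpha>\<^sub>\<sigma>\<^sub>i\<close>. This only involves coordinates of order at most
  that of \<open>\<sigma>\<close>, so on functions of \<open>k\<close>-jets it acts as the prolongation to \<open>k\<close>-jets.\<close>

definition characteristic :: "(point \<Rightarrow> point) \<Rightarrow> dep \<Rightarrow> jet \<Rightarrow> real" where
  "characteristic X \<alpha> z =
     fibre_comp \<alpha> (X (pt z)) - (\<Sum>i\<in>{Ti, Xi, Yi}. base_comp i (X (pt z)) * z (Jet \<alpha> (inc i (0, 0, 0))))"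

fun prolong :: "(point \<Rightarrow> point) \<Rightarrow> jet \<Rightarrow> coord \<Rightarrow> real" where
  "prolong X z (Base i) = base_comp i (X (pt z))"
| "prolong X z (Jet \<alpha> \<sigma>) =
     D_multi \<sigma> (characteristic X \<alpha>) z
     + (\<Sum>i\<in>{Ti, Xi, Yi}. base_comp i (X (pt z)) * z (Jet \<alpha> (inc i \<sigma>)))"

definition F1 :: "jet \<Rightarrow> real" where
  "F1 z = D Xi (\<lambda>z. u_t z + u_0 z * u_y z + v_0 z * u_x z) z - D Yi (\<lambda>z. u_y z) z"

definition F2 :: "jet \<Rightarrow> real" where
  "F2 z = D Xi (\<lambda>z. v_t z + v_0 z * v_x z - u_0 z * v_y z) z
        - D Yi (\<lambda>z. v_y z - 2 * u_0 z * v_x z) z"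

text \<open>For \<open>k = 0, 1\<close> there is no condition, so that these are all of \<open>J\<^sup>0\<close> and \<open>J\<^sup>1\<close>.\<close>

definition equation :: "nat \<Rightarrow> jet set" where
  "equation k = {z. \<forall>\<sigma>. order \<sigma> + 2 \<le> k \<longrightarrow> D_multi \<sigma> F1 z = 0 \<and> D_multi \<sigma> F2 z = 0}"

definition equation_inf :: "jet set" where
  "equation_inf = (\<Inter>k. equation k)"

text \<open>All iterated directional derivatives exist and are (Frechet) differentiable; in finite
  dimension this is the class of infinitely differentiable functions.\<close>

definition smooth :: "('a::euclidean_space \<Rightarrow> real) \<Rightarrow> bool" where
  "smooth f \<longleftrightarrow>
     (\<forall>ws p. foldr (\<lambda>w h q. frechet_derivative h (at q) w) ws f differentiable (at p))"

definition X1 :: "(real \<Rightarrow> real) \<Rightarrow> point \<Rightarrow> point" where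
  "X1 a = (\<lambda>(t, x, y, u, v). (0, a t, 0, 0, deriv a t))"

definition X2 :: "(real \<Rightarrow> real) \<Rightarrow> point \<Rightarrow> point" where
  "X2 b = (\<lambda>(t, x, y, u, v). (0, 0, b t, deriv b t, 0))"

definition X3 :: "(real \<Rightarrow> real) \<Rightarrow> point \<Rightarrow> point" where
  "X3 c = (\<lambda>(t, x, y, u, v). (0, y * c t, 0, - 2 * c t, u * c t + y * deriv c t))"

definition X4 :: "(real \<Rightarrow> real) \<Rightarrow> point \<Rightarrow> point" where
  "X4 d = (\<lambda>(t, x, y, u, v).
     (d t,
      0,
      1/2 * deriv d t * y,
      1/2 * (y * deriv (deriv d) t - u * deriv d t),
      - deriv d t * v))"

definition X5 :: "(real \<Rightarrow> real) \<Rightarrow> point \<Rightarrow> point" where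
  "X5 e = (\<lambda>(t, x, y, u, v).
     (0,
      y^2 * deriv e t + 2 * x * e t,
      y * e t,
      u * e t - 3 * y * deriv e t,
      y^2 * deriv (deriv e) t + 2 * y * u * deriv e t + 2 * v * e t + 2 * x * deriv e t))"

definition sym_alg :: "(point \<Rightarrow> point) set" where
  "sym_alg = {\<lambda>p. X1 a p + X2 b p + X3 c p + X4 d p + X5 e p | a b c d e.
     smooth a \<and> smooth b \<and> smooth c \<and> smooth d \<and> smooth e}"

text \<open>Polynomials with real coefficients in finitely many functions from \<open>S\<close>.\<close>

inductive_set real_algebra :: "(jet \<Rightarrow> real) set \<Rightarrow> (jet \<Rightarrow> real) set" for S where
  const: "(\<lambda>z. r) \<in> real_algebra S"
| gen: "f \<in> S \<Longrightarrow> f \<in> real_algebra S"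
| add: "f \<in> real_algebra S \<Longrightarrow> g \<in> real_algebra S \<Longrightarrow> (\<lambda>z. f z + g z) \<in> real_algebra S"
| mult: "f \<in> real_algebra S \<Longrightarrow> g \<in> real_algebra S \<Longrightarrow> (\<lambda>z. f z * g z) \<in> real_algebra S"

text \<open>Functions on the \<open>k\<close>-jet space that are polynomial along the fibres over \<open>E\<close>, with coefficients
  smooth on \<open>E\<close>.\<close>

definition fibre_poly :: "nat \<Rightarrow> (jet \<Rightarrow> real) set" where
  "fibre_poly k = real_algebra
     ({\<lambda>z. h (pt z) | h. smooth h} \<union> {\<lambda>z. z (Jet \<alpha> \<sigma>) | \<alpha> \<sigma>. order \<sigma> \<le> k})"

text \<open>No fibre of \<open>equation k\<close> over \<open>E\<close> lies in the zero set of \<open>Q\<close>. The fibres are graphs over affine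
  spaces, the equations being solvable for the coordinates with both \<open>t\<close>- and \<open>x\<close>-derivatives, so
  the non-zero set of such a fibrewise polynomial is dense in each of them.\<close>

definition nonzero_on_fibres :: "nat \<Rightarrow> (jet \<Rightarrow> real) \<Rightarrow> bool" where
  "nonzero_on_fibres k Q \<longleftrightarrow> (\<forall>p. \<exists>z\<in>equation k. pt z = p \<and> Q z \<noteq> 0)"

definition generically :: "(jet \<Rightarrow> bool) \<Rightarrow> bool" where
  "generically P \<longleftrightarrow>
     (\<exists>k. \<exists>R\<in>fibre_poly k. nonzero_on_fibres k R \<and> (\<forall>z\<in>equation_inf. R z \<noteq> 0 \<longrightarrow> P z))"

text \<open>A rational function on \<open>equation k\<close> is represented by a quotient \<open>P / Q\<close> on the surrounding
  \<open>k\<close>-jet space. Its values where \<open>Q\<close> vanishes are irrelevant, and two such quotients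
  represent the same rational function when they agree generically.\<close>

definition rational_fun :: "nat \<Rightarrow> (jet \<Rightarrow> real) \<Rightarrow> bool" where
  "rational_fun k f \<longleftrightarrow>
     (\<exists>P\<in>fibre_poly k. \<exists>Q\<in>fibre_poly k. nonzero_on_fibres k Q \<and> f = (\<lambda>z. P z / Q z))"

text \<open>The prolonged fields of the algebra are tangent to \<open>equation k\<close>, so the condition below
  depends only on the restriction of \<open>I\<close> to \<open>equation k\<close>.\<close>

definition diff_invariant :: "nat \<Rightarrow> (jet \<Rightarrow> real) \<Rightarrow> bool" where
  "diff_invariant k I \<longleftrightarrow>
     (\<exists>P\<in>fibre_poly k. \<exists>Q\<in>fibre_poly k. nonzero_on_fibres k Q \<and> I = (\<lambda>z. P z / Q z) \<and>
        (\<forall>X\<in>sym_alg. \<forall>z\<in>equation k. Q z \<noteq> 0 \<longrightarrow> Lie (prolong X) I z = 0))"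

definition invariant_derivation :: "((jet \<Rightarrow> real) \<Rightarrow> jet \<Rightarrow> real) \<Rightarrow> bool" where
  "invariant_derivation N \<longleftrightarrow>
     (\<exists>k c. (\<forall>i. rational_fun k (c i)) \<and> (\<forall>f z. N f z = (\<Sum>i\<in>{Ti, Xi, Yi}. c i z * D i f z))) \<and>
     (\<forall>X\<in>sym_alg. \<forall>k f. rational_fun k f \<longrightarrow>
        generically (\<lambda>z. Lie (prolong X) (N f) z = N (Lie (prolong X) f) z))"

definition iterated_derivatives ::
  "((jet \<Rightarrow> real) \<Rightarrow> jet \<Rightarrow> real) set \<Rightarrow> (jet \<Rightarrow> real) \<Rightarrow> (jet \<Rightarrow> real) set" where
  "iterated_derivatives \<N> I = {foldr (\<lambda>N f. N f) Ns I | Ns. set Ns \<subseteq> \<N>}"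

definition generate_invariants ::
  "((jet \<Rightarrow> real) \<Rightarrow> jet \<Rightarrow> real) set \<Rightarrow> (jet \<Rightarrow> real) \<Rightarrow> bool" where
  "generate_invariants \<N> I \<longleftrightarrow>
     (\<forall>k J. diff_invariant k J \<longrightarrow>
        (\<exists>A\<in>real_algebra (iterated_derivatives \<N> I).
         \<exists>B\<in>real_algebra (iterated_derivatives \<N> I).
           generically (\<lambda>z. B z \<noteq> 0 \<and> J z = A z / B z)))"

definition I2 :: "jet \<Rightarrow> real" where
  "I2 z = ((u_x z)^2 * u_xy z + u_x z * u_xx z * v_x z + u_xx z * u_yy z - (u_xy z)^2) / (u_x z)^4"

definition nabla1 :: "(jet \<Rightarrow> real) \<Rightarrow> jet \<Rightarrow> real" where
  "nabla1 f z = u_x z / u_xx z * D Xi f z"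

definition nabla2 :: "(jet \<Rightarrow> real) \<Rightarrow> jet \<Rightarrow> real" where
  "nabla2 f z = 1 / u_x z * (u_xy z / u_xx z * D Xi f z - D Yi f z)"

definition nabla3 :: "(jet \<Rightarrow> real) \<Rightarrow> jet \<Rightarrow> real" where
  "nabla3 f z = 1 / (u_x z)^3 *
     (u_xx z * D Ti f z
      + (D Xi (\<lambda>z. v_0 z * u_x z) z + u_yy z) * D Xi f z
      + D Xi (\<lambda>z. u_0 z * u_x z - 2 * u_y z) z * D Yi f z)"

end

theory Submission
  imports Defs "HOL-Computational_Algebra.Polynomial"
begin

text \<open>The functions \<open>D\<^sub>t\<^sup>n w\<close> with \<open>w\<close> among \<open>u\<^sub>x, u\<^sub>x\<^sub>x, u\<^sub>x\<^sub>y, u, v\<close> serve as pivots: every jet coordinate on the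
  equation is rational in the pivots and the iterated derivatives of \<open>I\<^sub>2\<close>. For this, the structure
  functions of \<open>[\<nabla>\<^sub>k, \<nabla>\<^sub>3]\<close> are recovered by Cramer's rule from three functionally independent iterated
  derivatives, which gives the coordinates of low order, and the field of functions so obtained is
  closed under the total derivatives.

  An invariant is thus rational in finitely many pivots over the iterated derivatives. For every pivot
  there is a symmetry, with coefficient functions proportional to \<open>t\<^sup>n\<close>, which annihilates the preceding
  pivots but not this one at the points over \<open>t = x = y = 0\<close>. Applying these symmetries eliminates the
  pivots one at a time, starting with the last.

  The argument takes place over one base point. Translations and Galilean boosts move any point of
  \<open>E\<close> to \<open>0\<close>, and along this flow an invariant is constant, so an invariant is determined by its
  restriction to the fibre over \<open>0\<close>, where it is a rational function of the jet coordinates.\<close>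

section \<open>Smooth functions\<close>

text \<open>There are five pivots per order in t because the algebra has five arbitrary functions of
  t: at each order one further Taylor coefficient of each acts, and it moves the pivots in
  triangular fashion. The elimination expresses that the pivots are independent over the invariants;
  no dimensions are counted.

  One generator suffices because the structure functions of the commutators are further invariants
  obtained for free. They supply the linear equations that separate the coordinates which
  \<open>I2\<close> and its derivatives contain only in combinations.

  Two obstacles come from E. The coefficients of an invariant are merely smooth there, so polynomial
  arguments need a fixed base point. Conversely, such arguments yield a denominator that is nonzero
  somewhere, while the conclusion demands one that is nonzero somewhere on every fibre; invariance
  along the flow bridges this gap as well. The flow may meet zeros of denominators, hence the
  cross-multiplied identities, which are polynomial along lines in the parameter space of the
  equation.\<close>

lemma smooth_coinduct:
  fixes f :: "'a::euclidean_space \<Rightarrow> real"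
  assumes "f \<in> S" "\<And>f p. f \<in> S \<Longrightarrow> f differentiable (at p)"
    "\<And>f w. f \<in> S \<Longrightarrow> (\<lambda>q. frechet_derivative f (at q) w) \<in> S"
  shows "smooth f"
proof -
  have "foldr (\<lambda>w h q. frechet_derivative h (at q) w) ws f \<in> S" for ws
    by (induction ws) (auto simp: assms)
  then show ?thesis
    unfolding smooth_def by (auto intro: assms)
qed

lemma smooth_differentiable: "smooth f \<Longrightarrow> f differentiable (at p)"
  unfolding smooth_def by (metis foldr.simps(1) id_apply)

lemma smooth_has_derivative: "smooth f \<Longrightarrow> (f has_derivative frechet_derivative f (at p)) (at p)"
  using frechet_derivative_works smooth_differentiable by blast

lemma smooth_derivative: "smooth f \<Longrightarrow> smooth (\<lambda>q. frechet_derivative f (at q) w)"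
  unfolding smooth_def
proof (intro allI)
  fix ws p
  assume *: "\<forall>ws p. foldr (\<lambda>w h q. frechet_derivative h (at q) w) ws f differentiable (at p)"
  show "foldr (\<lambda>w h q. frechet_derivative h (at q) w) ws (\<lambda>q. frechet_derivative f (at q) w) differentiable at p"
    \<comment> \<open>\<open>foldr\<close> processes the last list entry first, so a trailing
      \<open>w\<close> is the innermost derivative.\<close>
    using *[rule_format, of "ws @ [w]" p] by simp
qed

text \<open>The derivative of a product is a sum of products, so coinduction over smooth functions
  needs a set closed under both operations. The domain is arbitrary here, in contrast to
  \<open>real_algebra\<close>.\<close>

inductive_set generated_algebra :: "('a \<Rightarrow> real) set \<Rightarrow> ('a \<Rightarrow> real) set" for S where
  const: "(\<lambda>z. r) \<in> generated_algebra S"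
| gen: "f \<in> S \<Longrightarrow> f \<in> generated_algebra S"
| add: "f \<in> generated_algebra S \<Longrightarrow> g \<in> generated_algebra S \<Longrightarrow> (\<lambda>z. f z + g z) \<in> generated_algebra S"
| mult: "f \<in> generated_algebra S \<Longrightarrow> g \<in> generated_algebra S \<Longrightarrow> (\<lambda>z. f z * g z) \<in> generated_algebra S"

text \<open>By the product rule the algebra is closed under directional derivatives as soon as those
  of the generators lie in it; \<open>smooth_coinduct\<close> then applies to the algebra
  itself.\<close>

lemma generated_algebra_smooth:
  fixes f :: "'a::euclidean_space \<Rightarrow> real"
  assumes f: "f \<in> generated_algebra S"
    and diff: "\<And>f p. f \<in> S \<Longrightarrow> f differentiable (at p)"
    and deriv: "\<And>f w. f \<in> S \<Longrightarrow> (\<lambda>q. frechet_derivative f (at q) w) \<in> generated_algebra S"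
  shows "smooth f"
proof (rule smooth_coinduct[OF f])
  show d: "f differentiable (at p)" if "f \<in> generated_algebra S" for f p
    using that by induction (auto intro: diff)
  show "(\<lambda>q. frechet_derivative f (at q) w) \<in> generated_algebra S"
    if "f \<in> generated_algebra S" for f w
    using that
  proof induction
    case (add f g)
    have "frechet_derivative (\<lambda>z. f z + g z) (at q) w =
        frechet_derivative f (at q) w + frechet_derivative g (at q) w" for q
      by (subst frechet_derivative_at[symmetric, OF has_derivative_add])
        (use add.hyps d in \<open>auto simp: frechet_derivative_works[symmetric]\<close>)
    then show ?case
      using add.IH by (auto intro: generated_algebra.intros)
  next
    case (mult f g)
    have "frechet_derivative (\<lambda>z. f z * g z) (at q) w =
        f q * frechet_derivative g (at q) w + frechet_derivative f (at q) w * g q" for q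
      by (subst frechet_derivative_at[symmetric, OF has_derivative_mult])
        (use mult.hyps d in \<open>auto simp: frechet_derivative_works[symmetric]\<close>)
    then show ?case
      using mult.IH mult.hyps by (simp add: generated_algebra.add generated_algebra.mult)
  qed (auto intro: generated_algebra.intros deriv simp: frechet_derivative_const)
qed

lemma smooth_const [simp]: "smooth (\<lambda>_. r)"
  by (rule generated_algebra_smooth[of _ "{}"]) (auto intro: generated_algebra.const)

lemma smooth_add: "smooth f \<Longrightarrow> smooth g \<Longrightarrow> smooth (\<lambda>z. f z + g z)"
  and smooth_mult: "smooth f \<Longrightarrow> smooth g \<Longrightarrow> smooth (\<lambda>z. f z * g z)"
  by (rule generated_algebra_smooth[of _ "Collect smooth"];
      auto intro: generated_algebra.intros smooth_differentiable smooth_derivative)+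

lemma smooth_compose_linear:
  fixes g :: "real \<Rightarrow> real"
  assumes "smooth g" "bounded_linear L"
  shows "smooth (\<lambda>p. g (L p))"
proof (rule generated_algebra_smooth[of _ "{\<lambda>p. g (L p) | g. smooth g}"])
  note L = bounded_linear_imp_has_derivative[OF assms(2)]
  have *: "((\<lambda>p. g (L p)) has_derivative (\<lambda>w. frechet_derivative g (at (L p)) (L w))) (at p)"
    if "smooth g" for g :: "real \<Rightarrow> real" and p
    using has_derivative_compose[OF L smooth_has_derivative[OF that]] .
  show "f differentiable at p" if "f \<in> {\<lambda>p. g (L p) |g. smooth g}" for f p
    using that * by (auto simp: differentiable_def)
  show "(\<lambda>q. frechet_derivative f (at q) w) \<in> generated_algebra {\<lambda>p. g (L p) |g. smooth g}"
    if "f \<in> {\<lambda>p. g (L p) |g. smooth g}" for f w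
  proof -
    obtain g where g: "smooth g" "f = (\<lambda>p. g (L p))" using \<open>f \<in> _\<close> by auto
    have "(\<lambda>q. frechet_derivative f (at q) w) = (\<lambda>q. frechet_derivative g (at (L q)) (L w))"
      using frechet_derivative_at[OF *[OF g(1)]] g(2) by metis
    then show ?thesis
      using smooth_derivative[OF g(1), of "L w"] by (auto intro!: generated_algebra.gen)
  qed
qed (use assms in \<open>auto intro: generated_algebra.gen\<close>)

lemma smooth_ident: "smooth (\<lambda>r::real. r)"
  by (rule generated_algebra_smooth[of _ "{\<lambda>r. r}"])
    (auto intro: generated_algebra.intros simp: frechet_derivative_ident)

lemma smooth_linear: "bounded_linear L \<Longrightarrow> smooth (\<lambda>p. L p :: real)"
  using smooth_compose_linear[OF smooth_ident] .

lemma smooth_DERIV: "smooth a \<Longrightarrow> (a has_real_derivative deriv a t) (at t)"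
  using smooth_differentiable[of a t] by (meson DERIV_deriv_iff_real_differentiable)

lemma smooth_deriv: "smooth a \<Longrightarrow> smooth (deriv a)"
proof -
  assume a: "smooth a"
  have "frechet_derivative a (at t) 1 = deriv a t" for t
    using frechet_derivative_at[OF smooth_DERIV[OF a, unfolded has_field_derivative_def]]
    by (metis mult.right_neutral)
  then show "smooth (deriv a)"
    using smooth_derivative[OF a, of 1] by simp
qed

text \<open>Both mixed second derivatives are the limit of the same symmetric difference quotient.\<close>

lemma second_difference_quotient:
  fixes f :: "'a::euclidean_space \<Rightarrow> real"
  assumes f: "smooth f"
  shows "((\<lambda>h. (f (p + h *\<^sub>R v + h *\<^sub>R w) - f (p + h *\<^sub>R v) - f (p + h *\<^sub>R w) + f p) / h\<^sup>2) \<longlongrightarrow>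
    frechet_derivative (\<lambda>q. frechet_derivative f (at q) v) (at p) w) (at_right 0)"
proof -
  define G where "G q = frechet_derivative f (at q) v" for q
  define G' where "G' = frechet_derivative G (at p)"
  have G: "(G has_derivative G') (at p)"
    unfolding G'_def G_def by (intro smooth_has_derivative smooth_derivative f)
  interpret G': bounded_linear G' using G by (rule has_derivative_bounded_linear)
  \<comment> \<open>For 0 < s < h the two increments used below satisfy |s v| + |s v + h w| <= h (2
    |v| + |w|); the summand 1 keeps \<open>K\<close> positive.\<close>
  define K where "K = 2 * norm v + norm w + 1"
  have "K > 0" by (simp add: K_def add_nonneg_pos)
  show ?thesis unfolding G_def[symmetric] G'_def[symmetric]
  proof (rule tendstoI)
    fix e :: real assume "e > 0"
    define e' where "e' = e / (2 * K)"
    have "e' > 0" using \<open>e > 0\<close> \<open>K > 0\<close> by (simp add: e'_def)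
    obtain d where d: "d > 0" "\<And>y. norm (y - p) < d \<Longrightarrow> \<bar>G y - G p - G' (y - p)\<bar> \<le> e' * norm (y - p)"
      using G \<open>e' > 0\<close> unfolding has_derivative_at_alt by (metis real_norm_def)
    have "dist ((f (p + h *\<^sub>R v + h *\<^sub>R w) - f (p + h *\<^sub>R v) - f (p + h *\<^sub>R w) + f p) / h\<^sup>2) (G' w) < e"
      if h: "h > 0" "h < d / K" for h
    proof -
      \<comment> \<open>With the shift by \<open>h w\<close> frozen, the mean value theorem in the
        direction \<open>v\<close> turns the second difference into a first difference of
        \<open>G\<close>, and differentiability of \<open>G\<close> at the single point
        \<open>p\<close> suffices.\<close>
      define g where "g s = f (p + s *\<^sub>R v + h *\<^sub>R w) - f (p + s *\<^sub>R v)" for s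
      have line: "((\<lambda>s. f (p + s *\<^sub>R v + k *\<^sub>R w)) has_real_derivative G (p + s *\<^sub>R v + k *\<^sub>R w)) (at s)" for s k
      proof -
        have "((\<lambda>s. f (p + s *\<^sub>R v + k *\<^sub>R w)) has_derivative
            (\<lambda>r. frechet_derivative f (at (p + s *\<^sub>R v + k *\<^sub>R w)) (r *\<^sub>R v))) (at s)"
          by (rule has_derivative_compose[OF _ smooth_has_derivative[OF f]])
            (auto intro!: derivative_eq_intros)
        then show ?thesis
          unfolding has_field_derivative_def G_def
          by (simp add: linear_scale[OF linear_frechet_derivative[OF smooth_differentiable[OF f]]] mult.commute[of _ "frechet_derivative f _ _"])
      qed
      have "(g has_real_derivative (G (p + s *\<^sub>R v + h *\<^sub>R w) - G (p + s *\<^sub>R v))) (at s)" for s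
        unfolding g_def using DERIV_diff[OF line[of h s] line[of 0 s]] by simp
      then obtain s where s: "0 < s" "s < h" "g h - g 0 = h * (G (p + s *\<^sub>R v + h *\<^sub>R w) - G (p + s *\<^sub>R v))"
        using MVT2[OF h(1), of g "\<lambda>s. G (p + s *\<^sub>R v + h *\<^sub>R w) - G (p + s *\<^sub>R v)"] by auto
      have n1: "norm (s *\<^sub>R v) \<le> h * norm v" using s by (simp add: mult_right_mono)
      have n2: "norm (s *\<^sub>R v + h *\<^sub>R w) \<le> h * (norm v + norm w)"
        using norm_triangle_ineq[of "s *\<^sub>R v" "h *\<^sub>R w"] n1 h by (simp add: algebra_simps)
      have hK: "h * K < d" using h \<open>K > 0\<close> by (simp add: field_simps)
      have b1: "h * norm v < d"
        using hK h(1) unfolding K_def by (smt (verit, best) mult_less_cancel_left_pos norm_ge_zero)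
      have b2: "h * (norm v + norm w) < d"
        using hK h(1) unfolding K_def by (smt (verit, best) mult_less_cancel_left_pos norm_ge_zero)
      have 1: "\<bar>G (p + s *\<^sub>R v) - G p - G' (s *\<^sub>R v)\<bar> \<le> e' * (h * norm v)"
        using d(2)[of "p + s *\<^sub>R v"] n1 b1 \<open>e' > 0\<close>
        by (simp del: norm_scaleR) (meson le_less_trans mult_left_mono less_imp_le order_trans)
      have 2: "\<bar>G (p + s *\<^sub>R v + h *\<^sub>R w) - G p - G' (s *\<^sub>R v + h *\<^sub>R w)\<bar> \<le> e' * (h * (norm v + norm w))"
        using d(2)[of "p + s *\<^sub>R v + h *\<^sub>R w"] n2 b2 \<open>e' > 0\<close>
        by (simp del: norm_scaleR add: add.assoc) (meson le_less_trans mult_left_mono less_imp_le order_trans)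
      have lin: "G' (s *\<^sub>R v + h *\<^sub>R w) - G' (s *\<^sub>R v) = h * G' w"
        by (simp add: G'.add G'.scaleR)
      have "\<bar>(G (p + s *\<^sub>R v + h *\<^sub>R w) - G (p + s *\<^sub>R v)) - h * G' w\<bar> \<le> e' * (h * (norm v + norm w)) + e' * (h * norm v)"
        using 1 2 lin by linarith
      also have "\<dots> \<le> e' * (h * K)"
        unfolding K_def using \<open>e' > 0\<close> h by (simp add: algebra_simps)
      also have "\<dots> < e * h"
        using \<open>K > 0\<close> h \<open>e > 0\<close> by (simp add: e'_def)
      finally have "h * \<bar>(G (p + s *\<^sub>R v + h *\<^sub>R w) - G (p + s *\<^sub>R v)) - h * G' w\<bar> < h * (e * h)"
        using h by simp
      moreover have "\<bar>(g h - g 0) - h\<^sup>2 * G' w\<bar> =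
          h * \<bar>(G (p + s *\<^sub>R v + h *\<^sub>R w) - G (p + s *\<^sub>R v)) - h * G' w\<bar>"
        unfolding s(3) power2_eq_square mult.assoc right_diff_distrib[symmetric] abs_mult using h by simp
      ultimately have "\<bar>(g h - g 0) - h\<^sup>2 * G' w\<bar> < e * h\<^sup>2"
        by (simp add: power2_eq_square mult.left_commute)
      then have "\<bar>(g h - g 0) / h\<^sup>2 - G' w\<bar> < e"
        using h by (simp add: abs_less_iff field_simps)
      then show ?thesis
        by (simp add: dist_real_def g_def algebra_simps)
    qed
    moreover have "\<forall>\<^sub>F h in at_right 0. 0 < h \<and> h < d / K"
      using eventually_at_right_less[of 0] eventually_at_right_real[of 0 "d / K"] d(1) \<open>K > 0\<close>
      by (auto elim: eventually_mono)
    ultimately show "\<forall>\<^sub>F h in at_right 0. dist ((f (p + h *\<^sub>R v + h *\<^sub>R w) - f (p + h *\<^sub>R v) - f (p + h *\<^sub>R w) + f p) / h\<^sup>2) (G' w) < e"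
      by (auto elim: eventually_mono)
  qed
qed

lemma smooth_mixed_derivatives:
  fixes f :: "'a::euclidean_space \<Rightarrow> real"
  assumes f: "smooth f"
  shows "frechet_derivative (\<lambda>q. frechet_derivative f (at q) v) (at p) w =
    frechet_derivative (\<lambda>q. frechet_derivative f (at q) w) (at p) v"
proof (rule tendsto_unique[OF _ second_difference_quotient[OF f]])
  show "((\<lambda>h. (f (p + h *\<^sub>R v + h *\<^sub>R w) - f (p + h *\<^sub>R v) - f (p + h *\<^sub>R w) + f p) / h\<^sup>2) \<longlongrightarrow>
    frechet_derivative (\<lambda>q. frechet_derivative f (at q) w) (at p) v) (at_right 0)"
    using second_difference_quotient[OF f, of p w v] by (simp add: algebra_simps)
qed simp

section \<open>Differential calculus on the jet space\<close>

definition fpoly :: "mindex set \<Rightarrow> (jet \<Rightarrow> real) set" where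
  "fpoly C = real_algebra ({\<lambda>z. h (pt z) | h. smooth h} \<union> {\<lambda>z. z (Jet \<alpha> \<sigma>) | \<alpha> \<sigma>. \<sigma> \<in> C})"

text \<open>Constant coefficients and no base coordinates: members are polynomial along every line
  in the parameter space of the equation, those of \<open>fpoly\<close> only along lines within a
  fibre over E.\<close>

definition cpoly :: "mindex set \<Rightarrow> (jet \<Rightarrow> real) set" where
  "cpoly C = real_algebra {\<lambda>z. z (Jet \<alpha> \<sigma>) | \<alpha> \<sigma>. \<sigma> \<in> C}"

abbreviation alg :: "(jet \<Rightarrow> real) set" where "alg \<equiv> fpoly UNIV"

abbreviation jpoly :: "(jet \<Rightarrow> real) set" where "jpoly \<equiv> cpoly UNIV"

lemma real_algebra_mono: "S \<subseteq> T \<Longrightarrow> real_algebra S \<subseteq> real_algebra T"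
proof
  fix f assume "S \<subseteq> T" "f \<in> real_algebra S"
  from this(2) show "f \<in> real_algebra T"
    by induction (use \<open>S \<subseteq> T\<close> in \<open>auto intro: real_algebra.intros\<close>)
qed

lemma real_algebra_uminus: "f \<in> real_algebra S \<Longrightarrow> (\<lambda>z. - f z) \<in> real_algebra S"
  using real_algebra.mult[OF real_algebra.const[of "-1"]] by fastforce

lemma real_algebra_diff:
  "f \<in> real_algebra S \<Longrightarrow> g \<in> real_algebra S \<Longrightarrow> (\<lambda>z. f z - g z) \<in> real_algebra S"
  using real_algebra.add[OF _ real_algebra_uminus] by fastforce

lemma real_algebra_power: "f \<in> real_algebra S \<Longrightarrow> (\<lambda>z. f z ^ n) \<in> real_algebra S"
  by (induction n) (auto intro: real_algebra.intros)

lemma real_algebra_sum: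
  "(\<And>i. i \<in> A \<Longrightarrow> f i \<in> real_algebra S) \<Longrightarrow> (\<lambda>z. \<Sum>i\<in>A. f i z) \<in> real_algebra S"
  by (induction A rule: infinite_finite_induct) (auto intro: real_algebra.intros)

lemma real_algebra_divide: "f \<in> real_algebra S \<Longrightarrow> (\<lambda>z. f z / r) \<in> real_algebra S"
  using real_algebra.mult[OF real_algebra.const[of "1 / r"]] by fastforce

lemmas algebra_intros = real_algebra.const real_algebra.add real_algebra.mult real_algebra_uminus
  real_algebra_diff real_algebra_power real_algebra_sum real_algebra_divide

lemmas fpoly_intros = algebra_intros[where S = "{\<lambda>z. h (pt z) | h. smooth h} \<union> {\<lambda>z. z (Jet \<alpha> \<sigma>) | \<alpha> \<sigma>. \<sigma> \<in> C}" for C,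
    folded fpoly_def]
lemmas cpoly_intros = algebra_intros[where S = "{\<lambda>z. z (Jet \<alpha> \<sigma>) | \<alpha> \<sigma>. \<sigma> \<in> C}" for C, folded cpoly_def]

lemma fibre_poly_eq: "fibre_poly k = fpoly {\<sigma>. order \<sigma> \<le> k}"
  by (simp add: fibre_poly_def fpoly_def)

lemma fpoly_mono: "C \<subseteq> C' \<Longrightarrow> fpoly C \<subseteq> fpoly C'"
  unfolding fpoly_def by (rule real_algebra_mono) blast

lemma cpoly_mono: "C \<subseteq> C' \<Longrightarrow> cpoly C \<subseteq> cpoly C'"
  unfolding cpoly_def by (rule real_algebra_mono) blast

lemma cpoly_fpoly: "cpoly C \<subseteq> fpoly C"
  unfolding fpoly_def cpoly_def by (rule real_algebra_mono) auto

lemma cpoly_jet: "\<sigma> \<in> C \<Longrightarrow> (\<lambda>z. z (Jet \<alpha> \<sigma>)) \<in> cpoly C"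
  unfolding cpoly_def by (rule real_algebra.gen) blast

lemma fpoly_jet: "\<sigma> \<in> C \<Longrightarrow> (\<lambda>z. z (Jet \<alpha> \<sigma>)) \<in> fpoly C"
  unfolding fpoly_def by (rule real_algebra.gen) blast

lemma fpoly_pt: "smooth h \<Longrightarrow> (\<lambda>z. h (pt z)) \<in> fpoly C"
  unfolding fpoly_def by (rule real_algebra.gen) blast

lemma base_comp_eq: "base_comp Ti = fst" "base_comp Xi = (\<lambda>p. fst (snd p))" "base_comp Yi = (\<lambda>p. fst (snd (snd p)))"
  by auto

lemma bounded_linear_base_comp: "bounded_linear (base_comp i)"
  by (cases i) (auto simp: base_comp_eq intro!: bounded_linear_intros)

lemma base_comp_pt [simp]: "base_comp i (pt z) = z (Base i)"
  by (cases i) (auto simp: pt_def)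

lemma fpoly_time: "smooth a \<Longrightarrow> (\<lambda>z. a (z (Base i))) \<in> fpoly C"
  using fpoly_pt[OF smooth_compose_linear[OF _ bounded_linear_base_comp]] by simp

lemma fpoly_base: "(\<lambda>z. z (Base i)) \<in> fpoly C"
  using fpoly_time[OF smooth_ident] .

lemma fpoly_induct [consumes 1, case_names const pt jet add mult]:
  assumes "f \<in> fpoly C" "\<And>r. P (\<lambda>z. r)" "\<And>h. smooth h \<Longrightarrow> P (\<lambda>z. h (pt z))"
    "\<And>\<alpha> \<sigma>. \<sigma> \<in> C \<Longrightarrow> P (\<lambda>z. z (Jet \<alpha> \<sigma>))"
    "\<And>f g. f \<in> fpoly C \<Longrightarrow> g \<in> fpoly C \<Longrightarrow> P f \<Longrightarrow> P g \<Longrightarrow> P (\<lambda>z. f z + g z)"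
    "\<And>f g. f \<in> fpoly C \<Longrightarrow> g \<in> fpoly C \<Longrightarrow> P f \<Longrightarrow> P g \<Longrightarrow> P (\<lambda>z. f z * g z)"
  shows "P f"
  using assms(1) unfolding fpoly_def
proof induction
  case (gen f)
  then show ?case using assms(3,4) by blast
qed (use assms(2,5,6) in \<open>simp_all add: fpoly_def\<close>)

lemma cpoly_induct [consumes 1, case_names const jet add mult]:
  assumes "f \<in> cpoly C" "\<And>r. P (\<lambda>z. r)" "\<And>\<alpha> \<sigma>. \<sigma> \<in> C \<Longrightarrow> P (\<lambda>z. z (Jet \<alpha> \<sigma>))"
    "\<And>f g. f \<in> cpoly C \<Longrightarrow> g \<in> cpoly C \<Longrightarrow> P f \<Longrightarrow> P g \<Longrightarrow> P (\<lambda>z. f z + g z)"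
    "\<And>f g. f \<in> cpoly C \<Longrightarrow> g \<in> cpoly C \<Longrightarrow> P f \<Longrightarrow> P g \<Longrightarrow> P (\<lambda>z. f z * g z)"
  shows "P f"
  using assms(1) unfolding cpoly_def
proof induction
  case (gen f)
  then show ?case using assms(3) by blast
qed (use assms(2,4,5) in \<open>simp_all add: cpoly_def\<close>)

lemma fpoly_cong:
  assumes "f \<in> fpoly C" "\<And>\<alpha> \<sigma>. \<sigma> \<in> C \<Longrightarrow> z (Jet \<alpha> \<sigma>) = z' (Jet \<alpha> \<sigma>)" "pt z = pt z'"
  shows "f z = f z'"
  using assms by (induction rule: fpoly_induct) auto

lemma cpoly_cong:
  assumes "f \<in> cpoly C" "\<And>\<alpha> \<sigma>. \<sigma> \<in> C \<Longrightarrow> z (Jet \<alpha> \<sigma>) = z' (Jet \<alpha> \<sigma>)"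
  shows "f z = f z'"
  using assms by (induction rule: cpoly_induct) auto

lemma alg_fibre_poly: "f \<in> alg \<Longrightarrow> \<exists>k. f \<in> fibre_poly k"
proof (induction rule: fpoly_induct)
  case (const r)
  show ?case by (auto simp: fibre_poly_eq intro: fpoly_intros)
next
  case (pt h)
  then show ?case by (auto simp: fibre_poly_eq intro: fpoly_pt)
next
  case (jet \<alpha> \<sigma>)
  have "(\<lambda>z. z (Jet \<alpha> \<sigma>)) \<in> fibre_poly (order \<sigma>)" by (auto simp: fibre_poly_eq intro!: fpoly_jet)
  then show ?case ..
next
  case (add f g)
  then obtain k l where "f \<in> fibre_poly (max k l)" "g \<in> fibre_poly (max k l)"
    unfolding fibre_poly_eq
    by (metis (no_types, lifting) Collect_mono fpoly_mono max.cobounded1 max.cobounded2 order_trans subsetD)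
  then show ?case by (auto simp: fibre_poly_eq intro: fpoly_intros)
next
  case (mult f g)
  then obtain k l where "f \<in> fibre_poly (max k l)" "g \<in> fibre_poly (max k l)"
    unfolding fibre_poly_eq
    by (metis (no_types, lifting) Collect_mono fpoly_mono max.cobounded1 max.cobounded2 order_trans subsetD)
  then show ?case by (auto simp: fibre_poly_eq intro: fpoly_intros)
qed

lemma fibre_poly_alg: "f \<in> fibre_poly k \<Longrightarrow> f \<in> alg"
  unfolding fibre_poly_eq using fpoly_mono[of _ UNIV] by blast

lemma fibre_poly_mono: "k \<le> l \<Longrightarrow> f \<in> fibre_poly k \<Longrightarrow> f \<in> fibre_poly l"
  unfolding fibre_poly_eq using fpoly_mono[of "{\<sigma>. order \<sigma> \<le> k}" "{\<sigma>. order \<sigma> \<le> l}"] order_trans by blast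

lemma jpoly_alg: "f \<in> jpoly \<Longrightarrow> f \<in> alg"
  using cpoly_fpoly by blast

section \<open>Directional derivatives and the chain rule along curves\<close>

lemma Lie_eqI:
  "((\<lambda>s. f (\<lambda>c. z c + s * \<xi> z c)) has_real_derivative d) (at 0) \<Longrightarrow> Lie \<xi> f z = d"
  unfolding Lie_def by (rule DERIV_imp_deriv)

text \<open>\<open>Lie\<close> tests only straight lines, while \<open>solve\<close> and
  \<open>transport\<close> produce curved paths. This is the chain rule along all paths that are
  differentiable in each coordinate; members of \<open>alg\<close> satisfy it because they involve
  finitely many coordinates.\<close>

definition curve_differentiable :: "(jet \<Rightarrow> real) \<Rightarrow> bool" where
  "curve_differentiable f \<longleftrightarrow> (\<forall>\<gamma> \<gamma>' s. (\<forall>c. ((\<lambda>r. \<gamma> r c) has_real_derivative \<gamma>' c) (at s)) \<longrightarrow>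
     ((\<lambda>r. f (\<gamma> r)) has_real_derivative Lie (\<lambda>_. \<gamma>') f (\<gamma> s)) (at s))"

lemma curve_differentiableD:
  assumes "curve_differentiable f" "\<And>c. ((\<lambda>r. \<gamma> r c) has_real_derivative \<gamma>' c) (at s)"
  shows "((\<lambda>r. f (\<gamma> r)) has_real_derivative Lie (\<lambda>_. \<gamma>') f (\<gamma> s)) (at s)"
  using assms unfolding curve_differentiable_def by blast

text \<open>It suffices to compute the derivative along every curve, provided that it only depends on the
  velocity of the curve.\<close>

lemma curve_differentiableI:
  assumes "\<And>\<gamma> \<gamma>' s. (\<And>c. ((\<lambda>r. \<gamma> r c) has_real_derivative \<gamma>' c) (at s)) \<Longrightarrow>
     ((\<lambda>r. f (\<gamma> r)) has_real_derivative d (\<gamma> s) \<gamma>') (at s)"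
  shows "curve_differentiable f" "Lie \<xi> f z = d z (\<xi> z)"
proof -
  show L: "Lie \<xi> f z = d z (\<xi> z)" for \<xi> z
  proof (rule Lie_eqI)
    have "((\<lambda>r. z c + r * \<xi> z c) has_real_derivative \<xi> z c) (at 0)" for c
      by (auto intro!: derivative_eq_intros)
    from assms[OF this] show "((\<lambda>s. f (\<lambda>c. z c + s * \<xi> z c)) has_real_derivative d z (\<xi> z)) (at 0)"
      by simp
  qed
  show "curve_differentiable f"
    unfolding curve_differentiable_def using assms by (auto simp: L)
qed

lemma Lie_line:
  assumes "curve_differentiable f"
  shows "((\<lambda>s. f (\<lambda>c. z c + s * \<xi> z c)) has_real_derivative Lie \<xi> f z) (at 0)"
proof -
  have "((\<lambda>r. z c + r * \<xi> z c) has_real_derivative \<xi> z c) (at 0)" for c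
    by (auto intro!: derivative_eq_intros)
  from curve_differentiableD[OF assms, of "\<lambda>s c. z c + s * \<xi> z c" "\<xi> z" 0, OF this] show ?thesis
    by (simp add: Lie_def)
qed

lemma Lie_const [simp]: "Lie \<xi> (\<lambda>z. r) = (\<lambda>z. 0)"
  by (simp add: Lie_def fun_eq_iff)

lemma curve_differentiable_const: "curve_differentiable (\<lambda>z. r)"
  by (rule curve_differentiableI[where d = "\<lambda>_ _. 0"]) simp

lemma Lie_coord [simp]: "Lie \<xi> (\<lambda>z. z c) = (\<lambda>z. \<xi> z c)"
  by (rule ext, rule curve_differentiableI(2)[where d = "\<lambda>_ w. w c"]) simp

lemma curve_differentiable_coord: "curve_differentiable (\<lambda>z. z c)"
  by (rule curve_differentiableI[where d = "\<lambda>_ w. w c"]) simp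

lemma pt_has_derivative:
  assumes "\<And>c. ((\<lambda>r. \<gamma> r c) has_real_derivative \<gamma>' c) (at s)"
  shows "((\<lambda>r. pt (\<gamma> r)) has_vector_derivative pt \<gamma>') (at s)"
  unfolding pt_def using assms
  by (auto intro!: has_vector_derivative_Pair simp: has_real_derivative_iff_has_vector_derivative)

lemma pt_curve:
  assumes "smooth h" "\<And>c. ((\<lambda>r. \<gamma> r c) has_real_derivative \<gamma>' c) (at s)"
  shows "((\<lambda>r. h (pt (\<gamma> r))) has_real_derivative frechet_derivative h (at (pt (\<gamma> s))) (pt \<gamma>')) (at s)"
proof -
  have "((\<lambda>r. h (pt (\<gamma> r))) has_derivative (\<lambda>r. frechet_derivative h (at (pt (\<gamma> s))) (r *\<^sub>R pt \<gamma>'))) (at s)"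
    by (rule has_derivative_compose[OF pt_has_derivative[OF assms(2), unfolded has_vector_derivative_def]
          smooth_has_derivative[OF assms(1)]])
  then show ?thesis
    unfolding has_field_derivative_def
    by (simp add: linear_scale[OF linear_frechet_derivative[OF smooth_differentiable[OF assms(1)]]]
        mult.commute[of _ "frechet_derivative h _ _"])
qed

lemma Lie_pt: "smooth h \<Longrightarrow> Lie \<xi> (\<lambda>z. h (pt z)) = (\<lambda>z. frechet_derivative h (at (pt z)) (pt (\<xi> z)))"
  by (rule ext, rule curve_differentiableI(2)[where d = "\<lambda>z w. frechet_derivative h (at (pt z)) (pt w)"])
    (rule pt_curve)

lemma curve_differentiable_pt: "smooth h \<Longrightarrow> curve_differentiable (\<lambda>z. h (pt z))"
  by (rule curve_differentiableI[where d = "\<lambda>z w. frechet_derivative h (at (pt z)) (pt w)"])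
    (rule pt_curve)

lemma
  assumes "curve_differentiable f" "curve_differentiable g"
  shows curve_differentiable_add: "curve_differentiable (\<lambda>z. f z + g z)"
    and curve_differentiable_mult: "curve_differentiable (\<lambda>z. f z * g z)"
    and Lie_add': "Lie \<xi> (\<lambda>z. f z + g z) = (\<lambda>z. Lie \<xi> f z + Lie \<xi> g z)"
    and Lie_mult': "Lie \<xi> (\<lambda>z. f z * g z) = (\<lambda>z. Lie \<xi> f z * g z + f z * Lie \<xi> g z)"
proof -
  have L: "Lie (\<lambda>_. \<xi> z) f z = Lie \<xi> f z" for \<xi> f z by (simp add: Lie_def)
  have A: "((\<lambda>r. f (\<gamma> r) + g (\<gamma> r)) has_real_derivative Lie (\<lambda>_. \<gamma>') f (\<gamma> s) + Lie (\<lambda>_. \<gamma>') g (\<gamma> s)) (at s)"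
    and M: "((\<lambda>r. f (\<gamma> r) * g (\<gamma> r)) has_real_derivative
      Lie (\<lambda>_. \<gamma>') f (\<gamma> s) * g (\<gamma> s) + f (\<gamma> s) * Lie (\<lambda>_. \<gamma>') g (\<gamma> s)) (at s)"
    if "\<And>c. ((\<lambda>r. \<gamma> r c) has_real_derivative \<gamma>' c) (at s)" for \<gamma> \<gamma>' s
    using curve_differentiableD[OF assms(1), of \<gamma> \<gamma>' s, OF that] curve_differentiableD[OF assms(2), of \<gamma> \<gamma>' s, OF that]
    by (auto intro!: derivative_eq_intros)
  note A = curve_differentiableI[where d = "\<lambda>z w. Lie (\<lambda>_. w) f z + Lie (\<lambda>_. w) g z", OF A, unfolded L]
  note M = curve_differentiableI[where d = "\<lambda>z w. Lie (\<lambda>_. w) f z * g z + f z * Lie (\<lambda>_. w) g z", OF M, unfolded L]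
  show "curve_differentiable (\<lambda>z. f z + g z)" "curve_differentiable (\<lambda>z. f z * g z)"
    "Lie \<xi> (\<lambda>z. f z + g z) = (\<lambda>z. Lie \<xi> f z + Lie \<xi> g z)"
    "Lie \<xi> (\<lambda>z. f z * g z) = (\<lambda>z. Lie \<xi> f z * g z + f z * Lie \<xi> g z)"
    using A(1) M(1) by (auto simp: fun_eq_iff A(2) M(2))
qed

lemma alg_curve_differentiable: "f \<in> fpoly C \<Longrightarrow> curve_differentiable f"
  by (induction rule: fpoly_induct)
    (auto intro: curve_differentiable_const curve_differentiable_pt curve_differentiable_coord
      curve_differentiable_add curve_differentiable_mult)

lemma Lie_add: "f \<in> alg \<Longrightarrow> g \<in> alg \<Longrightarrow> Lie \<xi> (\<lambda>z. f z + g z) = (\<lambda>z. Lie \<xi> f z + Lie \<xi> g z)"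
  and Lie_mult: "f \<in> alg \<Longrightarrow> g \<in> alg \<Longrightarrow> Lie \<xi> (\<lambda>z. f z * g z) = (\<lambda>z. Lie \<xi> f z * g z + f z * Lie \<xi> g z)"
  by (simp_all add: Lie_add' Lie_mult' alg_curve_differentiable)

lemma Lie_uminus: "f \<in> alg \<Longrightarrow> Lie \<xi> (\<lambda>z. - f z) = (\<lambda>z. - Lie \<xi> f z)"
  using Lie_mult[of "\<lambda>_. -1" f \<xi>] by (simp add: fpoly_intros)

lemma Lie_diff: "f \<in> alg \<Longrightarrow> g \<in> alg \<Longrightarrow> Lie \<xi> (\<lambda>z. f z - g z) = (\<lambda>z. Lie \<xi> f z - Lie \<xi> g z)"
  using Lie_add[of f "\<lambda>z. - g z" \<xi>] by (simp add: fpoly_intros Lie_uminus)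

lemma Lie_power: "f \<in> alg \<Longrightarrow> Lie \<xi> (\<lambda>z. f z ^ n) = (\<lambda>z. n * f z ^ (n - 1) * Lie \<xi> f z)"
proof (induction n)
  case (Suc n)
  then show ?case
    by (cases n) (auto simp: Lie_mult fpoly_intros fun_eq_iff algebra_simps)
qed simp

lemma Lie_sum: "(\<And>i. i \<in> A \<Longrightarrow> f i \<in> alg) \<Longrightarrow> Lie \<xi> (\<lambda>z. \<Sum>i\<in>A. f i z) = (\<lambda>z. \<Sum>i\<in>A. Lie \<xi> (f i) z)"
  by (induction A rule: infinite_finite_induct) (auto simp: Lie_add fpoly_intros)

lemma Lie_time: "smooth a \<Longrightarrow> Lie \<xi> (\<lambda>z. a (z (Base i))) = (\<lambda>z. deriv a (z (Base i)) * \<xi> z (Base i))"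
  by (rule ext, rule curve_differentiableI(2)[where d = "\<lambda>z w. deriv a (z (Base i)) * w (Base i)"])
    (rule DERIV_chain2[OF smooth_DERIV])

lemma Lie_divide: "f \<in> alg \<Longrightarrow> Lie \<xi> (\<lambda>z. f z / r) = (\<lambda>z. Lie \<xi> f z / r)"
  using Lie_mult[of "\<lambda>_. 1 / r" f \<xi>] by (simp add: fpoly_intros)

lemmas Lie_simps = Lie_add Lie_mult Lie_uminus Lie_diff Lie_power Lie_divide

subsection \<open>Dependence on the vector field\<close>

lemma pt_add: "pt (\<lambda>c. v c + w c) = pt v + pt w"
  and pt_scale: "pt (\<lambda>c. r * v c) = r *\<^sub>R pt v"
  by (auto simp: pt_def)

lemma Lie_vector_add: "f \<in> alg \<Longrightarrow> Lie (\<lambda>z c. \<xi> z c + \<eta> z c) f z = Lie \<xi> f z + Lie \<eta> f z"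
  by (induction arbitrary: z rule: fpoly_induct)
    (auto simp: Lie_pt pt_add linear_add[OF linear_frechet_derivative[OF smooth_differentiable]] Lie_simps
      algebra_simps)

lemma Lie_vector_scale: "f \<in> alg \<Longrightarrow> Lie (\<lambda>z c. r z * \<xi> z c) f z = r z * Lie \<xi> f z"
  by (induction arbitrary: z rule: fpoly_induct)
    (auto simp: Lie_pt pt_scale linear_scale[OF linear_frechet_derivative[OF smooth_differentiable]] Lie_simps
      algebra_simps)

lemma Lie_vector_sum:
  "f \<in> alg \<Longrightarrow> Lie (\<lambda>z c. \<Sum>i\<in>A. r i z * \<xi> i z c) f z = (\<Sum>i\<in>A. r i z * Lie (\<xi> i) f z)"
proof (induction A rule: infinite_finite_induct)
  case (insert i A)
  then show ?case
    using Lie_vector_add[of f "\<lambda>z c. r i z * \<xi> i z c" "\<lambda>z c. \<Sum>i\<in>A. r i z * \<xi> i z c" z]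
    by (simp add: Lie_vector_scale)
qed (auto simp: Lie_def)

text \<open>Numbering the five coordinates of E turns the derivative of \<open>h (pt z)\<close> into
  a finite sum, to which the product rule and the symmetry of second derivatives apply.\<close>

definition pt_coord :: "nat \<Rightarrow> coord" where
  "pt_coord k = [Base Ti, Base Xi, Base Yi, Jet Ud (0, 0, 0), Jet Vd (0, 0, 0)] ! k"

definition pt_vec :: "nat \<Rightarrow> point" where
  "pt_vec k = [(1, 0, 0, 0, 0), (0, 1, 0, 0, 0), (0, 0, 1, 0, 0), (0, 0, 0, 1, 0), (0, 0, 0, 0, 1)] ! k"

lemma pt_expansion: "pt w = (\<Sum>k<5. w (pt_coord k) *\<^sub>R pt_vec k)"
  by (simp add: pt_def pt_coord_def pt_vec_def eval_nat_numeral)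

lemma Lie_pt_sum:
  assumes "smooth h"
  shows "Lie \<xi> (\<lambda>z. h (pt z)) = (\<lambda>z. \<Sum>k<5. frechet_derivative h (at (pt z)) (pt_vec k) * \<xi> z (pt_coord k))"
proof
  interpret linear "frechet_derivative h (at (pt z))" for z
    by (intro linear_frechet_derivative smooth_differentiable assms)
  show "Lie \<xi> (\<lambda>z. h (pt z)) z = (\<Sum>k<5. frechet_derivative h (at (pt z)) (pt_vec k) * \<xi> z (pt_coord k))" for z
    by (simp add: Lie_pt[OF assms] pt_expansion[of "\<xi> z"] sum scale mult.commute)
qed

lemma pt_coord_cases: "k < 5 \<Longrightarrow> (\<exists>i. pt_coord k = Base i) \<or> (\<exists>\<alpha>. pt_coord k = Jet \<alpha> (0, 0, 0))"
  by (auto simp: pt_coord_def less_Suc_eq numeral_eq_Suc)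

lemma Lie_fpoly:
  assumes "f \<in> fpoly C" "\<And>i. (\<lambda>z. \<xi> z (Base i)) \<in> fpoly C'" "\<And>\<alpha>. (\<lambda>z. \<xi> z (Jet \<alpha> (0, 0, 0))) \<in> fpoly C'"
    "\<And>\<alpha> \<sigma>. \<sigma> \<in> C \<Longrightarrow> (\<lambda>z. \<xi> z (Jet \<alpha> \<sigma>)) \<in> fpoly C'" "C \<subseteq> C'"
  shows "Lie \<xi> f \<in> fpoly C'"
  using assms(1)
proof (induction rule: fpoly_induct)
  case (pt h)
  have "(\<lambda>z. \<Sum>k<5. frechet_derivative h (at (pt z)) (pt_vec k) * \<xi> z (pt_coord k)) \<in> fpoly C'"
    using pt_coord_cases assms(2,3)
    by (intro fpoly_intros fpoly_pt[OF smooth_derivative[OF pt]]) fastforce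
  then show ?case by (simp add: Lie_pt_sum pt)
next
  case (mult f g)
  then have "f \<in> fpoly C'" "g \<in> fpoly C'" using fpoly_mono[OF assms(5)] by auto
  with mult show ?case
    by (simp add: Lie_mult' alg_curve_differentiable fpoly_intros)
qed (auto simp: Lie_add' alg_curve_differentiable assms intro: fpoly_intros)

lemma Lie_alg: "f \<in> alg \<Longrightarrow> (\<And>c. (\<lambda>z. \<xi> z c) \<in> alg) \<Longrightarrow> Lie \<xi> f \<in> alg"
  by (erule Lie_fpoly) auto

text \<open>Both sides are derivations in \<open>f\<close>, so only generators matter. For functions
  pulled back from E the second-order terms cancel by the symmetry of the Hessian.\<close>

lemma Lie_commutator:
  assumes "f \<in> alg" and \<xi>: "\<And>c. (\<lambda>z. \<xi> z c) \<in> alg" and \<eta>: "\<And>c. (\<lambda>z. \<eta> z c) \<in> alg"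
  shows "Lie \<xi> (Lie \<eta> f) z - Lie \<eta> (Lie \<xi> f) z =
    Lie (\<lambda>z c. Lie \<xi> (\<lambda>z. \<eta> z c) z - Lie \<eta> (\<lambda>z. \<xi> z c) z) f z"
  using assms(1)
proof (induction arbitrary: z rule: fpoly_induct)
  case (pt h)
  define H where "H k = (\<lambda>q. frechet_derivative h (at q) (pt_vec k))" for k
  have H: "smooth (H k)" for k unfolding H_def by (rule smooth_derivative[OF pt])
  define K where "K k l q = frechet_derivative (H k) (at q) (pt_vec l)" for k l q
  have sym: "K k l q = K l k q" for k l q
    unfolding K_def H_def by (rule smooth_mixed_derivatives[OF pt])
  have 1: "Lie \<zeta> (\<lambda>z. h (pt z)) = (\<lambda>z. \<Sum>k<5. H k (pt z) * \<zeta> z (pt_coord k))" for \<zeta>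
    by (simp add: Lie_pt_sum pt H_def)
  have 2: "Lie \<zeta> (Lie \<omega> (\<lambda>z. h (pt z))) z = (\<Sum>k<5. \<Sum>l<5. K k l (pt z) * \<zeta> z (pt_coord l) * \<omega> z (pt_coord k))
      + (\<Sum>k<5. H k (pt z) * Lie \<zeta> (\<lambda>z. \<omega> z (pt_coord k)) z)"
    if "\<And>c. (\<lambda>z. \<omega> z c) \<in> alg" for \<zeta> \<omega>
    unfolding 1 by (subst Lie_sum)
      (auto simp: that Lie_mult fpoly_pt H fpoly_intros Lie_pt_sum K_def sum.distrib sum_distrib_right)
  have 3: "(\<Sum>k<5. \<Sum>l<5. K k l (pt z) * \<xi> z (pt_coord l) * \<eta> z (pt_coord k)) =
      (\<Sum>k<5. \<Sum>l<5. K k l (pt z) * \<eta> z (pt_coord l) * \<xi> z (pt_coord k))"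
    by (subst sum.swap) (auto intro!: sum.cong simp: sym[of _ _ "pt z"])
  show ?case
    unfolding 2[OF \<xi>] 2[OF \<eta>] 3 unfolding 1
    by (simp add: sum_subtractf right_diff_distrib)
next
  case (add f g)
  then show ?case using Lie_alg[OF _ \<xi>] Lie_alg[OF _ \<eta>] by (simp add: Lie_add algebra_simps)
next
  case (mult f g)
  define \<zeta> where "\<zeta> = (\<lambda>z c. Lie \<xi> (\<lambda>z. \<eta> z c) z - Lie \<eta> (\<lambda>z. \<xi> z c) z)"
  have *: "Lie \<xi> (Lie \<eta> f) z = Lie \<eta> (Lie \<xi> f) z + Lie \<zeta> f z" "Lie \<xi> (Lie \<eta> g) z = Lie \<eta> (Lie \<xi> g) z + Lie \<zeta> g z"
    using mult.IH[of z] by (auto simp: \<zeta>_def)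
  show ?case
    unfolding \<zeta>_def[symmetric]
    using mult.hyps Lie_alg[OF _ \<xi>] Lie_alg[OF _ \<eta>]
    by (simp add: Lie_add Lie_mult fpoly_intros * algebra_simps)
qed simp_all

subsection \<open>Total derivatives\<close>

lemma D_const [simp]: "D i (\<lambda>z. r) = (\<lambda>z. 0)"
  and D_base [simp]: "D i (\<lambda>z. z (Base j)) = (\<lambda>z. if i = j then 1 else 0)"
  and D_jet [simp]: "D i (\<lambda>z. z (Jet \<alpha> \<sigma>)) = (\<lambda>z. z (Jet \<alpha> (inc i \<sigma>)))"
  and D_time: "smooth a \<Longrightarrow> D i (\<lambda>z. a (z (Base j))) = (\<lambda>z. if i = j then deriv a (z (Base j)) else 0)"
  and D_add: "f \<in> alg \<Longrightarrow> g \<in> alg \<Longrightarrow> D i (\<lambda>z. f z + g z) = (\<lambda>z. D i f z + D i g z)"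
  and D_mult: "f \<in> alg \<Longrightarrow> g \<in> alg \<Longrightarrow> D i (\<lambda>z. f z * g z) = (\<lambda>z. D i f z * g z + f z * D i g z)"
  and D_uminus: "f \<in> alg \<Longrightarrow> D i (\<lambda>z. - f z) = (\<lambda>z. - D i f z)"
  and D_diff: "f \<in> alg \<Longrightarrow> g \<in> alg \<Longrightarrow> D i (\<lambda>z. f z - g z) = (\<lambda>z. D i f z - D i g z)"
  and D_power: "f \<in> alg \<Longrightarrow> D i (\<lambda>z. f z ^ n) = (\<lambda>z. n * f z ^ (n - 1) * D i f z)"
  and D_divide: "f \<in> alg \<Longrightarrow> D i (\<lambda>z. f z / r) = (\<lambda>z. D i f z / r)"
  and D_sum: "(\<And>j. j \<in> A \<Longrightarrow> F j \<in> alg) \<Longrightarrow> D i (\<lambda>z. \<Sum>j\<in>A. F j z) = (\<lambda>z. \<Sum>j\<in>A. D i (F j) z)"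
  by (auto simp: D_def Lie_simps Lie_time Lie_sum)

lemmas D_simps = D_add D_mult D_uminus D_diff D_power D_divide

text \<open>The condition on \<open>inc i (0, 0, 0)\<close> accounts for the smooth coefficients:
  differentiating \<open>h (pt z)\<close> brings in coordinates of first order.\<close>

lemma D_fpoly:
  assumes "f \<in> fpoly C" "inc i (0, 0, 0) \<in> C'" "inc i ` C \<subseteq> C'" "C \<subseteq> C'"
  shows "D i f \<in> fpoly C'"
  unfolding D_def using assms by (intro Lie_fpoly[OF assms(1)]) (auto intro: fpoly_intros fpoly_jet)

lemma D_alg: "f \<in> alg \<Longrightarrow> D i f \<in> alg"
  by (erule D_fpoly) auto

lemma D_cpoly:
  assumes "f \<in> cpoly C" "inc i ` C \<subseteq> C'" "C \<subseteq> C'"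
  shows "D i f \<in> cpoly C'"
  using assms(1)
proof (induction rule: cpoly_induct)
  case (mult f g)
  then have "f \<in> cpoly C'" "g \<in> cpoly C'" "f \<in> alg" "g \<in> alg"
    using cpoly_mono[OF assms(3)] cpoly_fpoly fpoly_mono[of C UNIV] by auto
  with mult show ?case by (simp add: D_mult cpoly_intros)
next
  case (add f g)
  then have "f \<in> alg" "g \<in> alg"
    using cpoly_fpoly fpoly_mono[of C UNIV] by auto
  with add show ?case by (simp add: D_add cpoly_intros)
qed (use assms(2) in \<open>auto intro: cpoly_intros cpoly_jet\<close>)

lemma D_jpoly: "f \<in> jpoly \<Longrightarrow> D i f \<in> jpoly"
  by (erule D_cpoly) auto

lemma total_field_alg: "(\<lambda>z. total_field i z c) \<in> alg"
  by (cases c) (auto intro: fpoly_intros fpoly_jet)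

lemma inc_commute: "inc i (inc j \<sigma>) = inc j (inc i \<sigma>)"
  by (cases \<sigma>; cases i; cases j) auto

lemma D_commute: "f \<in> alg \<Longrightarrow> D i (D j f) = D j (D i f)"
proof
  fix z assume f: "f \<in> alg"
  have "Lie (total_field i) (\<lambda>z. total_field j z c) z - Lie (total_field j) (\<lambda>z. total_field i z c) z = 0" for z c
    by (cases c) (auto simp: inc_commute)
  then have "D i (D j f) z - D j (D i f) z = Lie (\<lambda>z c. 0) f z"
    unfolding D_def using Lie_commutator[of f "total_field i" "total_field j" z, OF f total_field_alg total_field_alg] by simp
  then show "D i (D j f) z = D j (D i f) z" by (simp add: Lie_def)
qed

lemma D_funpow_alg: "f \<in> alg \<Longrightarrow> (D i ^^ n) f \<in> alg"
  by (induction n) (auto intro: D_alg)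

lemma D_funpow_commute: "f \<in> alg \<Longrightarrow> D j ((D i ^^ n) f) = (D i ^^ n) (D j f)"
proof (induction n)
  case (Suc n)
  then show ?case by (simp add: D_commute[of _ j i] D_funpow_alg)
qed simp

lemma D_multi_alg: "f \<in> alg \<Longrightarrow> D_multi \<sigma> f \<in> alg"
  by (cases \<sigma>) (auto intro: D_funpow_alg)

lemma D_multi_0 [simp]: "D_multi (0, 0, 0) f = f"
  by simp

lemma D_multi_inc: "f \<in> alg \<Longrightarrow> D_multi (inc i \<sigma>) f = D i (D_multi \<sigma> f)"
  by (cases \<sigma>; cases i) (auto simp: D_funpow_commute D_funpow_alg)

lemma mindex_induct [case_names zero inc]:
  assumes "P (0, 0, 0)" "\<And>i \<sigma>. P \<sigma> \<Longrightarrow> P (inc i \<sigma>)"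
  shows "P \<sigma>"
proof -
  have 1: "P (0, 0, l)" for l
    by (induction l) (use assms(1) assms(2)[of "(0, 0, _)" Yi] in auto)
  have 2: "P (0, j, l)" for j l
    by (induction j) (use 1 assms(2)[of "(0, _, l)" Xi] in auto)
  have "P (i, j, l)" for i j l
    by (induction i) (use 2 assms(2)[of "(_, j, l)" Ti] in auto)
  then show ?thesis by (cases \<sigma>) auto
qed

subsection \<open>Prolongation\<close>

definition smooth_field :: "(point \<Rightarrow> point) \<Rightarrow> bool" where
  "smooth_field X \<longleftrightarrow> (\<forall>i. smooth (\<lambda>p. base_comp i (X p))) \<and> (\<forall>\<alpha>. smooth (\<lambda>p. fibre_comp \<alpha> (X p)))"

lemma
  assumes "smooth_field X"
  shows base_comp_alg: "(\<lambda>z. base_comp i (X (pt z))) \<in> alg"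
    and characteristic_alg: "characteristic X \<alpha> \<in> alg"
    and prolong_alg: "(\<lambda>z. prolong X z c) \<in> alg"
proof -
  show b: "(\<lambda>z. base_comp i (X (pt z))) \<in> alg" for i
    using assms by (auto simp: smooth_field_def intro!: fpoly_pt[of "\<lambda>p. base_comp i (X p)"])
  have "(\<lambda>z. fibre_comp \<alpha> (X (pt z))) \<in> alg" for \<alpha>
    using assms by (auto simp: smooth_field_def intro!: fpoly_pt[of "\<lambda>p. fibre_comp \<alpha> (X p)"])
  then show c: "characteristic X \<alpha> \<in> alg" for \<alpha>
    unfolding characteristic_def by (intro fpoly_intros b fpoly_jet) auto
  show "(\<lambda>z. prolong X z c) \<in> alg"
    by (cases c) (auto intro!: fpoly_intros b fpoly_jet D_multi_alg[OF c])
qed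

lemma prolong_0 [simp]: "prolong X z (Jet \<alpha> (0, 0, 0)) = fibre_comp \<alpha> (X (pt z))"
  by (simp add: characteristic_def)

text \<open>The recursive form of the prolongation formula: \<open>D i\<close> also hits the base
  components in the last sum, and this excess is subtracted. The components of low order are
  computed from it.\<close>

lemma prolong_inc:
  assumes X: "smooth_field X"
  shows "prolong X z (Jet \<alpha> (inc i \<sigma>)) = D i (\<lambda>z. prolong X z (Jet \<alpha> \<sigma>)) z
    - (\<Sum>j\<in>{Ti, Xi, Yi}. D i (\<lambda>z. base_comp j (X (pt z))) z * z (Jet \<alpha> (inc j \<sigma>)))"
proof -
  have "D i (\<lambda>z. prolong X z (Jet \<alpha> \<sigma>)) z = D i (D_multi \<sigma> (characteristic X \<alpha>)) z
      + (\<Sum>j\<in>{Ti, Xi, Yi}. D i (\<lambda>z. base_comp j (X (pt z))) z * z (Jet \<alpha> (inc j \<sigma>))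
           + base_comp j (X (pt z)) * z (Jet \<alpha> (inc i (inc j \<sigma>))))"
    unfolding prolong.simps
    by (subst D_add) (auto intro!: fpoly_intros D_multi_alg characteristic_alg[OF X] base_comp_alg[OF X] fpoly_jet
        simp: D_sum D_mult D_add base_comp_alg[OF X] fpoly_jet fpoly_intros)
  then show ?thesis
    by (simp del: D_multi.simps add: D_multi_inc characteristic_alg[OF X] inc_commute[of i] sum.distrib)
qed

text \<open>On coordinates this is \<open>prolong_inc\<close>; \<open>Lie_commutator\<close> carries
  it over to the whole algebra.\<close>

lemma prolong_D:
  assumes X: "smooth_field X" and f: "f \<in> alg"
  shows "Lie (prolong X) (D i f) z = D i (Lie (prolong X) f) z
    - (\<Sum>j\<in>{Ti, Xi, Yi}. D i (\<lambda>z. base_comp j (X (pt z))) z * D j f z)"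
proof -
  have *: "Lie (prolong X) (\<lambda>z. total_field i z c) z - D i (\<lambda>z. prolong X z c) z =
      (\<Sum>j\<in>{Ti, Xi, Yi}. - D i (\<lambda>z. base_comp j (X (pt z))) z * total_field j z c)" for z c
  proof (cases c)
    case (Base k)
    then show ?thesis by (cases k) auto
  next
    case (Jet \<alpha> \<sigma>)
    then show ?thesis by (simp add: prolong_inc[OF X] del: prolong.simps(2))
  qed
  show ?thesis
    using Lie_commutator[of f "prolong X" "total_field i" z, OF f prolong_alg[OF X] total_field_alg]
    unfolding D_def[symmetric] *
    by (subst (asm) Lie_vector_sum[OF f]) (simp add: D_def)
qed

section \<open>The equation\<close>

abbreviation v_xx :: "jet \<Rightarrow> real" where "v_xx z \<equiv> z (Jet Vd (0, 2, 0))"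
abbreviation v_xy :: "jet \<Rightarrow> real" where "v_xy z \<equiv> z (Jet Vd (0, 1, 1))"
abbreviation v_yy :: "jet \<Rightarrow> real" where "v_yy z \<equiv> z (Jet Vd (0, 0, 2))"

fun eqn :: "dep \<Rightarrow> jet \<Rightarrow> real" where
  "eqn Ud = F1"
| "eqn Vd = F2"

text \<open>The terms of the two equations other than \<open>u\<^sub>t\<^sub>x\<close> and \<open>v\<^sub>t\<^sub>x\<close>.\<close>

fun rest :: "dep \<Rightarrow> jet \<Rightarrow> real" where
  "rest Ud = (\<lambda>z. u_x z * u_y z + u_0 z * u_xy z + v_x z * u_x z + v_0 z * u_xx z - u_yy z)"
| "rest Vd = (\<lambda>z. v_x z * v_x z + v_0 z * v_xx z - u_x z * v_y z + u_0 z * v_xy z - v_yy z + 2 * u_y z * v_x z)"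

text \<open>The first bound counts t-derivatives separately. Since \<open>rest\<close> contains
  none, a differential consequence expresses a coordinate through ones with fewer t-derivatives, and
  the equation can be solved by recursion on their number.\<close>

definition region :: "nat \<Rightarrow> nat \<Rightarrow> mindex set" where
  "region n k = {(i, j, l). i \<le> n \<and> i + j + l \<le> k}"

lemma alg_jet: "(\<lambda>z. z (Jet \<alpha> \<sigma>)) \<in> alg"
  by (rule fpoly_jet) simp

lemma jpoly_jet: "(\<lambda>z. z (Jet \<alpha> \<sigma>)) \<in> jpoly"
  by (rule cpoly_jet) simp

lemmas alg_intros = fpoly_intros[where C = UNIV] alg_jet fpoly_base[where C = UNIV]
lemmas jpoly_intros = cpoly_intros[where C = UNIV] jpoly_jet

lemma eqn_eq: "eqn \<alpha> = (\<lambda>z. z (Jet \<alpha> (1, 1, 0)) + rest \<alpha> z)"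
proof (cases \<alpha>)
  case Ud
  have "F1 z = z (Jet Ud (1, 1, 0)) + rest Ud z" for z
    unfolding F1_def by (simp add: D_simps alg_intros flip: numeral_2_eq_2)
  then show ?thesis using Ud by (simp add: fun_eq_iff)
next
  case Vd
  have "F2 z = z (Jet Vd (1, 1, 0)) + rest Vd z" for z
    unfolding F2_def by (simp add: D_simps alg_intros flip: numeral_2_eq_2)
  then show ?thesis using Vd by (simp add: fun_eq_iff)
qed

lemma rest_region: "rest \<alpha> \<in> cpoly (region 0 2)"
  by (cases \<alpha>) (auto simp: region_def intro!: cpoly_intros cpoly_jet)

lemma rest_jpoly: "rest \<alpha> \<in> jpoly"
  using rest_region cpoly_mono[of _ UNIV] by blast

lemma eqn_jpoly: "eqn \<alpha> \<in> jpoly"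
  unfolding eqn_eq by (intro jpoly_intros rest_jpoly)

lemma D_region: "f \<in> cpoly (region n k) \<Longrightarrow> D i f \<in> cpoly (region (n + (if i = Ti then 1 else 0)) (k + 1))"
  by (erule D_cpoly) (cases i; auto simp: region_def)+

lemma D_multi_region:
  assumes "f \<in> cpoly (region n k)"
  shows "D_multi (i, j, l) f \<in> cpoly (region (n + i) (k + i + j + l))"
proof -
  have y: "(D Yi ^^ l) f \<in> cpoly (region n (k + l))"
    by (induction l) (use assms D_region[of _ _ _ Yi] in auto)
  have x: "(D Xi ^^ j) ((D Yi ^^ l) f) \<in> cpoly (region n (k + j + l))"
    by (induction j) (use y D_region[of _ _ _ Xi] in \<open>auto simp: algebra_simps\<close>)
  have "(D Ti ^^ i) ((D Xi ^^ j) ((D Yi ^^ l) f)) \<in> cpoly (region (n + i) (k + i + j + l))"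
    by (induction i) (use x D_region[of _ _ _ Ti] in \<open>auto simp: algebra_simps\<close>)
  then show ?thesis by simp
qed

lemma D_multi_jpoly: "f \<in> jpoly \<Longrightarrow> D_multi \<sigma> f \<in> jpoly"
proof (induction \<sigma> rule: mindex_induct)
  case (inc i \<sigma>)
  then show ?case by (simp del: D_multi.simps add: D_multi_inc jpoly_alg D_jpoly)
qed simp

lemma D_multi_eqn: "D_multi \<sigma> (eqn \<alpha>) = (\<lambda>z. z (Jet \<alpha> (inc Ti (inc Xi \<sigma>))) + D_multi \<sigma> (rest \<alpha>) z)"
proof (induction \<sigma> rule: mindex_induct)
  case zero
  then show ?case by (simp add: eqn_eq)
next
  case (inc i \<sigma>)
  show ?case
    by (simp del: D_multi.simps add: D_multi_inc jpoly_alg[OF eqn_jpoly] jpoly_alg[OF rest_jpoly] inc.IH D_add alg_jet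
        D_multi_alg inc_commute[of i])
qed

lemma equation_eqn: "equation k = {z. \<forall>\<sigma> \<alpha>. order \<sigma> + 2 \<le> k \<longrightarrow> D_multi \<sigma> (eqn \<alpha>) z = 0}"
proof -
  have "D_multi \<sigma> F1 z = 0 \<and> D_multi \<sigma> F2 z = 0 \<longleftrightarrow> (\<forall>\<alpha>. D_multi \<sigma> (eqn \<alpha>) z = 0)" for \<sigma> z
    by (metis dep.exhaust eqn.simps)
  then show ?thesis unfolding equation_def by blast
qed

lemma equation_inf_eqn: "z \<in> equation_inf \<longleftrightarrow> (\<forall>\<sigma> \<alpha>. D_multi \<sigma> (eqn \<alpha>) z = 0)"
  unfolding equation_inf_def equation_eqn by (simp del: D_multi.simps order.simps) blast

lemma equation_inf_sub: "equation_inf \<subseteq> equation k"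
  by (auto simp: equation_inf_def)

lemma equation_iff:
  "z \<in> equation k \<longleftrightarrow> (\<forall>i j l \<alpha>. i + j + l + 2 \<le> k \<longrightarrow> z (Jet \<alpha> (Suc i, Suc j, l)) = - D_multi (i, j, l) (rest \<alpha>) z)"
  unfolding equation_eqn by (auto simp del: D_multi.simps simp: D_multi_eqn eq_neg_iff_add_eq_0)

lemma equation_inf_iff:
  "z \<in> equation_inf \<longleftrightarrow> (\<forall>i j l \<alpha>. z (Jet \<alpha> (Suc i, Suc j, l)) = - D_multi (i, j, l) (rest \<alpha>) z)"
  unfolding equation_inf_eqn by (auto simp del: D_multi.simps simp: D_multi_eqn eq_neg_iff_add_eq_0)

subsection \<open>Parametrisation by the coordinates without mixed derivatives in t and x\<close>

text \<open>Coordinates with both t- and x-derivatives are overwritten level by level in the number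
  of t-derivatives; each level uses only lower ones.\<close>

fun solve_step :: "nat \<Rightarrow> jet \<Rightarrow> jet" where
  "solve_step n z (Base i) = z (Base i)"
| "solve_step n z (Jet \<alpha> (i, j, l)) =
     (if i = Suc n \<and> j > 0 then - D_multi (n, j - 1, l) (rest \<alpha>) z else z (Jet \<alpha> (i, j, l)))"

primrec solve_upto :: "nat \<Rightarrow> jet \<Rightarrow> jet" where
  "solve_upto 0 z = z"
| "solve_upto (Suc n) z = solve_step n (solve_upto n z)"

text \<open>A coordinate with \<open>i\<close> t-derivatives is final after \<open>i\<close> steps
  and is read off at that stage.\<close>

fun solve :: "jet \<Rightarrow> jet" where
  "solve z (Base i) = z (Base i)"
| "solve z (Jet \<alpha> (i, j, l)) = solve_upto i z (Jet \<alpha> (i, j, l))"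

declare solve.simps(2) [simp del] D_multi.simps [simp del]

lemma solve_upto_Jet: "i \<le> n \<Longrightarrow> solve_upto n z (Jet \<alpha> (i, j, l)) = solve z (Jet \<alpha> (i, j, l))"
proof (induction n)
  case 0
  then show ?case by (simp add: solve.simps)
next
  case (Suc n)
  then show ?case by (cases "i = Suc n") (simp_all add: solve.simps)
qed

lemma solve_upto_free: "i = 0 \<or> j = 0 \<Longrightarrow> solve_upto n z (Jet \<alpha> (i, j, l)) = z (Jet \<alpha> (i, j, l))"
  by (induction n) auto

lemma solve_free: "i = 0 \<or> j = 0 \<Longrightarrow> solve z (Jet \<alpha> (i, j, l)) = z (Jet \<alpha> (i, j, l))"
  by (simp add: solve.simps solve_upto_free)

lemma solve_rec: "solve z (Jet \<alpha> (Suc i, Suc j, l)) = - D_multi (i, j, l) (rest \<alpha>) (solve z)"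
proof -
  have "D_multi (i, j, l) (rest \<alpha>) (solve_upto i z) = D_multi (i, j, l) (rest \<alpha>) (solve z)"
    by (rule cpoly_cong[OF D_multi_region[OF rest_region]]) (auto simp: region_def solve_upto_Jet)
  then show ?thesis by (simp add: solve.simps)
qed

lemma pt_solve [simp]: "pt (solve z) = pt z"
  by (simp add: pt_def solve_free)

lemma solve_equation: "solve z \<in> equation_inf"
  unfolding equation_inf_iff using solve_rec by blast

text \<open>A point of \<open>equation k\<close> already obeys the recursion up to order
  \<open>k\<close>, so \<open>solve\<close> changes only higher coordinates and lifts the point to
  \<open>equation_inf\<close>.\<close>

lemma solve_agree: "z \<in> equation k \<Longrightarrow> i + j + l \<le> k \<Longrightarrow> solve z (Jet \<alpha> (i, j, l)) = z (Jet \<alpha> (i, j, l))"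
proof (induction i arbitrary: \<alpha> j l rule: less_induct)
  case (less i)
  show ?case
  proof (cases "i = 0 \<or> j = 0")
    case False
    then obtain i' j' where ij: "i = Suc i'" "j = Suc j'" by (metis not0_implies_Suc)
    have "D_multi (i', j', l) (rest \<alpha>) (solve z) = D_multi (i', j', l) (rest \<alpha>) z"
      by (rule cpoly_cong[OF D_multi_region[OF rest_region]])
        (use less.prems ij less.IH[OF _ less.prems(1)] in \<open>auto simp: region_def simp del: solve.simps\<close>)
    then show ?thesis
      using less.prems ij by (simp del: D_multi.simps solve.simps add: solve_rec equation_iff)
  qed (simp add: solve_free del: solve.simps)
qed

lemma solve_id: "z \<in> equation_inf \<Longrightarrow> solve z = z"
proof
  fix c assume "z \<in> equation_inf"
  then show "solve z c = z c"
  proof (cases c)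
    case (Jet \<alpha> \<sigma>)
    obtain i j l where "\<sigma> = (i, j, l)" by (cases \<sigma>)
    then show ?thesis
      using Jet solve_agree[of z "i + j + l" i j l \<alpha>] equation_inf_sub \<open>z \<in> equation_inf\<close> by blast
  qed simp
qed

text \<open>Points of \<open>equation k\<close> lift to \<open>equation_inf\<close> with the same
  k-jet, so all later arguments can stay on \<open>equation_inf\<close>.\<close>

lemma nonzero_on_fibres_iff:
  assumes "Q \<in> fibre_poly k"
  shows "nonzero_on_fibres k Q \<longleftrightarrow> (\<forall>p. \<exists>z\<in>equation_inf. pt z = p \<and> Q z \<noteq> 0)"
proof
  assume *: "nonzero_on_fibres k Q"
  show "\<forall>p. \<exists>z\<in>equation_inf. pt z = p \<and> Q z \<noteq> 0"
  proof
    fix p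
    obtain z where z: "z \<in> equation k" "pt z = p" "Q z \<noteq> 0"
      using * unfolding nonzero_on_fibres_def by blast
    have "Q (solve z) = Q z"
      by (rule fpoly_cong[OF assms[unfolded fibre_poly_eq]])
        (auto simp: solve_agree[OF z(1)] simp del: solve.simps)
    then show "\<exists>z\<in>equation_inf. pt z = p \<and> Q z \<noteq> 0"
      using z solve_equation[of z] pt_solve[of z] by metis
  qed
qed (use equation_inf_sub in \<open>unfold nonzero_on_fibres_def, blast\<close>)

subsection \<open>Lines in the parameter space\<close>

definition polyfun :: "(real \<Rightarrow> real) \<Rightarrow> bool" where
  "polyfun g \<longleftrightarrow> (\<exists>p. g = poly p)"

lemma polyfun_const: "polyfun (\<lambda>s. r)"
  unfolding polyfun_def by (rule exI[of _ "[:r:]"]) auto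

lemma polyfun_ident: "polyfun (\<lambda>s. s)"
  unfolding polyfun_def by (rule exI[of _ "[:0, 1:]"]) auto

lemma polyfun_add: "polyfun f \<Longrightarrow> polyfun g \<Longrightarrow> polyfun (\<lambda>s. f s + g s)"
  unfolding polyfun_def by (force simp: fun_eq_iff intro: poly_add[symmetric])

lemma polyfun_mult: "polyfun f \<Longrightarrow> polyfun g \<Longrightarrow> polyfun (\<lambda>s. f s * g s)"
  unfolding polyfun_def by (force simp: fun_eq_iff intro: poly_mult[symmetric])

lemma polyfun_uminus: "polyfun f \<Longrightarrow> polyfun (\<lambda>s. - f s)"
  using polyfun_mult[OF polyfun_const[of "-1"]] by simp

lemma polyfun_diff: "polyfun f \<Longrightarrow> polyfun g \<Longrightarrow> polyfun (\<lambda>s. f s - g s)"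
  using polyfun_add[OF _ polyfun_uminus] by simp

lemma polyfun_continuous: "polyfun f \<Longrightarrow> continuous_on A f"
  unfolding polyfun_def by (auto intro: continuous_intros)

lemma polyfun_finite_zeros: "polyfun f \<Longrightarrow> f s \<noteq> 0 \<Longrightarrow> finite {s. f s = 0}"
  unfolding polyfun_def using poly_roots_finite by (metis poly_0)

text \<open>An affine line in the free coordinates, carried to the equation by \<open>solve\<close>.
  Every jet coordinate stays polynomial in \<open>s\<close>, which reduces questions about the
  equation to polynomials in one variable.\<close>

definition line :: "jet \<Rightarrow> jet \<Rightarrow> real \<Rightarrow> jet" where
  "line z0 z1 s = solve (\<lambda>c. z0 c + s * (z1 c - z0 c))"

lemma line_equation: "line z0 z1 s \<in> equation_inf"
  by (simp add: line_def solve_equation)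

lemma line_ends: "z0 \<in> equation_inf \<Longrightarrow> line z0 z1 0 = z0" "z1 \<in> equation_inf \<Longrightarrow> line z0 z1 1 = z1"
  by (simp_all add: line_def solve_id del: solve.simps)

lemma pt_line: "pt z0 = pt z1 \<Longrightarrow> pt (line z0 z1 s) = pt z0"
  by (simp add: line_def) (simp add: pt_def)

lemma cpoly_polyfun:
  assumes "f \<in> cpoly C" "\<And>\<alpha> \<sigma>. \<sigma> \<in> C \<Longrightarrow> polyfun (\<lambda>s. \<gamma> s (Jet \<alpha> \<sigma>))"
  shows "polyfun (\<lambda>s. f (\<gamma> s))"
  using assms(1)
  by (induction rule: cpoly_induct) (auto intro: polyfun_const polyfun_add polyfun_mult assms(2))

lemma line_polyfun: "polyfun (\<lambda>s. line z0 z1 s (Jet \<alpha> (i, j, l)))"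
proof (induction i arbitrary: \<alpha> j l rule: less_induct)
  case (less i)
  show ?case
  proof (cases "i = 0 \<or> j = 0")
    case True
    then show ?thesis
      unfolding line_def by (simp only: solve_free) (intro polyfun_add polyfun_mult polyfun_ident polyfun_const)
  next
    case False
    then obtain i' j' where ij: "i = Suc i'" "j = Suc j'" by (metis not0_implies_Suc)
    have "polyfun (\<lambda>s. D_multi (i', j', l) (rest \<alpha>) (line z0 z1 s))"
      by (rule cpoly_polyfun[OF D_multi_region[OF rest_region]])
        (use less.IH ij in \<open>auto simp: region_def simp del: solve.simps\<close>)
    then show ?thesis unfolding line_def ij solve_rec by (rule polyfun_uminus)
  qed
qed

lemma jpoly_line: "f \<in> jpoly \<Longrightarrow> polyfun (\<lambda>s. f (line z0 z1 s))"
  by (rule cpoly_polyfun) (auto simp: line_polyfun)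

lemma alg_line:
  assumes "f \<in> alg" "pt z0 = pt z1"
  shows "polyfun (\<lambda>s. f (line z0 z1 s))"
  using assms(1)
proof (induction rule: fpoly_induct)
  case (jet \<alpha> \<sigma>)
  show ?case using line_polyfun by (cases \<sigma>) blast
qed (auto intro: polyfun_const polyfun_add polyfun_mult simp: pt_line[OF assms(2)])

text \<open>Plays the role of irreducibility of the equation: two nonzero polynomials in
  \<open>s\<close> have only finitely many zeros together.\<close>

lemma nonzero_product:
  assumes "polyfun (\<lambda>s. f (line z0 z1 s))" "polyfun (\<lambda>s. g (line z0 z1 s))"
    "z0 \<in> equation_inf" "z1 \<in> equation_inf" "f z0 \<noteq> 0" "g z1 \<noteq> 0"
  shows "\<exists>s. f (line z0 z1 s) * g (line z0 z1 s) \<noteq> 0"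
proof (rule ccontr)
  assume "\<not> ?thesis"
  then have "UNIV \<subseteq> {s. f (line z0 z1 s) = 0} \<union> {s. g (line z0 z1 s) = 0}" by auto
  moreover have "finite {s. f (line z0 z1 s) = 0}" "finite {s. g (line z0 z1 s) = 0}"
    using polyfun_finite_zeros[OF assms(1), of 0] polyfun_finite_zeros[OF assms(2), of 1] assms line_ends by auto
  ultimately have "finite (UNIV :: real set)" by (meson finite_UnI finite_subset)
  then show False by (simp add: infinite_UNIV_char_0)
qed

lemma nonzero_on_fibres_mult:
  assumes "P \<in> fibre_poly k" "Q \<in> fibre_poly k" "nonzero_on_fibres k P" "nonzero_on_fibres k Q"
  shows "nonzero_on_fibres k (\<lambda>z. P z * Q z)"
proof -
  have PQ: "(\<lambda>z. P z * Q z) \<in> fibre_poly k"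
    using assms(1,2) by (simp add: fibre_poly_eq fpoly_intros)
  have "\<exists>z\<in>equation_inf. pt z = p \<and> P z * Q z \<noteq> 0" for p
  proof -
    obtain z0 z1 where z: "z0 \<in> equation_inf" "z1 \<in> equation_inf" "pt z0 = p" "pt z1 = p" "P z0 \<noteq> 0" "Q z1 \<noteq> 0"
      using assms by (metis nonzero_on_fibres_iff)
    then have "pt z0 = pt z1" by simp
    from nonzero_product[of P z0 z1 Q, OF alg_line[OF _ this] alg_line[OF _ this]]
    obtain s where "P (line z0 z1 s) * Q (line z0 z1 s) \<noteq> 0"
      using z assms(1,2) fibre_poly_alg by blast
    then show ?thesis
      using z line_equation[of z0 z1 s] pt_line[OF \<open>pt z0 = pt z1\<close>, of s] by blast
  qed
  then show ?thesis using PQ by (simp add: nonzero_on_fibres_iff)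
qed

text \<open>Cancels a factor within a single fibre, as is needed when coefficients are merely smooth
  on E.\<close>

lemma fibre_density:
  assumes "f \<in> alg" "g \<in> alg" "\<And>z. z \<in> equation_inf \<Longrightarrow> pt z = p \<Longrightarrow> f z * g z = 0"
    "z1 \<in> equation_inf" "pt z1 = p" "g z1 \<noteq> 0" "z \<in> equation_inf" "pt z = p"
  shows "f z = 0"
proof (rule ccontr)
  assume "f z \<noteq> 0"
  moreover have pt: "pt z = pt z1" using assms by simp
  ultimately obtain s where "f (line z z1 s) * g (line z z1 s) \<noteq> 0"
    using nonzero_product[OF alg_line[OF assms(1) pt] alg_line[OF assms(2) pt]] assms by blast
  then show False
    using assms(3)[OF line_equation pt_line[OF pt, unfolded assms(8)]] by simp
qed

lemma jpoly_density:
  assumes "f \<in> jpoly" "g \<in> jpoly" "\<And>z. z \<in> equation_inf \<Longrightarrow> f z * g z = 0"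
    "z1 \<in> equation_inf" "g z1 \<noteq> 0" "z \<in> equation_inf"
  shows "f z = 0"
proof (rule ccontr)
  assume "f z \<noteq> 0"
  then obtain s where "f (line z z1 s) * g (line z z1 s) \<noteq> 0"
    using nonzero_product[OF jpoly_line[OF assms(1)] jpoly_line[OF assms(2)]] assms by blast
  then show False using assms(3)[OF line_equation] by simp
qed

subsection \<open>Tangent vector fields\<close>

text \<open>The straight line along the field leaves the equation. Its image under
  \<open>solve\<close> stays inside, and tangency to all differential consequences ensures that the
  image still has velocity \<open>\<xi> z\<close> at 0.\<close>

lemma tangent_vanish:
  assumes z: "z \<in> equation_inf" and tangent: "\<And>\<sigma> \<alpha>. Lie \<xi> (D_multi \<sigma> (eqn \<alpha>)) z = 0"
    and f: "f \<in> alg" "\<And>z. z \<in> equation_inf \<Longrightarrow> f z = 0"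
  shows "Lie \<xi> f z = 0"
proof -
  define \<gamma> where "\<gamma> s = solve (\<lambda>c. z c + s * \<xi> z c)" for s
  have \<gamma>0: "\<gamma> 0 = z" by (simp add: \<gamma>_def solve_id[OF z] del: solve.simps)
  have \<gamma>': "((\<lambda>s. \<gamma> s (Jet \<alpha> (i, j, l))) has_real_derivative \<xi> z (Jet \<alpha> (i, j, l))) (at 0)" for i j l \<alpha>
  proof (induction i arbitrary: \<alpha> j l rule: less_induct)
    case (less i)
    show ?case
    proof (cases "i = 0 \<or> j = 0")
      case True
      then show ?thesis
        unfolding \<gamma>_def by (simp only: solve_free) (auto intro!: derivative_eq_intros)
    next
      case False
      then obtain i' j' where ij: "i = Suc i'" "j = Suc j'" by (metis not0_implies_Suc)
      define C where "C = {Jet \<alpha> (a, b, c) | \<alpha> a b c. a \<le> i'}"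
      \<comment> \<open>Differentiability of \<open>\<gamma>\<close> is known so far only for
        coordinates with at most \<open>i'\<close> t-derivatives. Elsewhere it is replaced by the
        straight line, which \<open>?R\<close> does not notice.\<close>
      define \<delta> where "\<delta> s c = (if c \<in> C then \<gamma> s c else z c + s * \<xi> z c)" for s c
      let ?R = "D_multi (i', j', l) (rest \<alpha>)"
      have R: "?R \<in> alg" using jpoly_alg[OF rest_jpoly] by (rule D_multi_alg)
      have \<delta>: "?R (\<gamma> s) = ?R (\<delta> s)" for s
        by (rule cpoly_cong[OF D_multi_region[OF rest_region]]) (auto simp: region_def \<delta>_def C_def)
      have \<delta>0: "\<delta> 0 = z" by (auto simp: \<delta>_def \<gamma>0)
      have "((\<lambda>s. \<delta> s c) has_real_derivative \<xi> z c) (at 0)" for c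
      proof (cases "c \<in> C")
        case True
        then show ?thesis using less.IH ij by (auto simp: \<delta>_def C_def)
      next
        case False
        then show ?thesis by (auto simp: \<delta>_def intro!: derivative_eq_intros)
      qed
      from curve_differentiableD[OF alg_curve_differentiable[OF R], of \<delta> "\<xi> z" 0, OF this]
      have "((\<lambda>s. - ?R (\<gamma> s)) has_real_derivative - Lie \<xi> ?R z) (at 0)"
        unfolding \<delta> \<delta>0 by (auto intro!: derivative_eq_intros simp: Lie_def)
      moreover have "\<xi> z (Jet \<alpha> (Suc i', Suc j', l)) + Lie \<xi> ?R z = 0"
        using tangent[of "(i', j', l)" \<alpha>] unfolding D_multi_eqn by (simp add: Lie_add alg_jet R del: D_multi.simps)
      ultimately show ?thesis
        unfolding ij \<gamma>_def solve_rec by (simp add: add_eq_0_iff2)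
    qed
  qed
  have "((\<lambda>s. \<gamma> s c) has_real_derivative \<xi> z c) (at 0)" for c
  proof (cases c)
    case (Jet \<alpha> \<sigma>)
    then show ?thesis using \<gamma>' by (cases \<sigma>) auto
  qed (auto simp: \<gamma>_def intro!: derivative_eq_intros)
  from curve_differentiableD[OF alg_curve_differentiable[OF f(1)], of \<gamma> "\<xi> z" 0, OF this]
  have "((\<lambda>s. f (\<gamma> s)) has_real_derivative Lie \<xi> f z) (at 0)"
    unfolding \<gamma>0 by (simp add: Lie_def)
  moreover have "f (\<gamma> s) = 0" for s using f(2)[OF solve_equation] by (simp add: \<gamma>_def)
  ultimately have "((\<lambda>s. 0) has_real_derivative Lie \<xi> f z) (at 0)" by simp
  then show ?thesis by (rule DERIV_unique) simp
qed

lemma D_vanish: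
  assumes "f \<in> alg" "\<And>z. z \<in> equation_inf \<Longrightarrow> f z = 0" "z \<in> equation_inf"
  shows "D i f z = 0"
  unfolding D_def
proof (rule tangent_vanish[OF assms(3) _ assms(1,2)])
  show "Lie (total_field i) (D_multi \<sigma> (eqn \<alpha>)) z = 0" for \<sigma> \<alpha>
    using D_multi_inc[OF jpoly_alg[OF eqn_jpoly], of i \<sigma> \<alpha>] assms(3)
    unfolding equation_inf_eqn D_def by metis
qed

text \<open>Invariance of the two equations passes to all their differential consequences: by
  \<open>prolong_D\<close> the derivative of a total derivative consists of total derivatives of
  functions that vanish on the equation.\<close>

lemma prolong_vanish:
  assumes X: "smooth_field X" and eqn: "\<And>z \<alpha>. z \<in> equation_inf \<Longrightarrow> Lie (prolong X) (eqn \<alpha>) z = 0"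
    and f: "f \<in> alg" "\<And>z. z \<in> equation_inf \<Longrightarrow> f z = 0" "z \<in> equation_inf"
  shows "Lie (prolong X) f z = 0"
proof (rule tangent_vanish[OF f(3) _ f(1,2)])
  show "Lie (prolong X) (D_multi \<sigma> (eqn \<alpha>)) z = 0" for \<sigma> \<alpha>
    using \<open>z \<in> equation_inf\<close>
  proof (induction \<sigma> arbitrary: z rule: mindex_induct)
    case zero
    then show ?case using eqn by simp
  next
    case (inc i \<sigma>)
    define g where "g = D_multi \<sigma> (eqn \<alpha>)"
    have g: "g \<in> alg" unfolding g_def by (intro D_multi_alg jpoly_alg eqn_jpoly)
    have g0: "g z = 0" if "z \<in> equation_inf" for z
      using that unfolding g_def equation_inf_eqn by blast
    have "Lie (prolong X) (D i g) z = 0"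
      unfolding prolong_D[OF X g]
      using D_vanish[OF Lie_alg[OF g prolong_alg[OF X]] inc.IH[folded g_def] inc.prems] D_vanish[OF g g0 inc.prems]
      by simp
    then show ?case
      unfolding D_multi_inc[OF jpoly_alg[OF eqn_jpoly]] g_def .
  qed
qed

section \<open>Rational functions\<close>

text \<open>Equality is demanded only where the denominator is nonzero, so the values of
  \<open>f\<close> elsewhere are arbitrary. \<open>frac_at z\<close> says that \<open>z\<close> lies
  in the domain of some such representation.\<close>

definition is_frac :: "(jet \<Rightarrow> real) \<Rightarrow> (jet \<Rightarrow> real) \<Rightarrow> (jet \<Rightarrow> real) \<Rightarrow> bool" where
  "is_frac f P Q \<longleftrightarrow> P \<in> alg \<and> Q \<in> alg \<and> (\<forall>z. Q z \<noteq> 0 \<longrightarrow> f z = P z / Q z)"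

definition frac_at :: "jet \<Rightarrow> (jet \<Rightarrow> real) \<Rightarrow> bool" where
  "frac_at z f \<longleftrightarrow> (\<exists>P Q. is_frac f P Q \<and> Q z \<noteq> 0)"

lemma frac_atI: "P \<in> alg \<Longrightarrow> Q \<in> alg \<Longrightarrow> Q z \<noteq> 0 \<Longrightarrow> (\<And>z. Q z \<noteq> 0 \<Longrightarrow> f z = P z / Q z) \<Longrightarrow> frac_at z f"
  unfolding frac_at_def is_frac_def by blast

lemma Lie_frac_line:
  assumes "is_frac f P Q" "Q z \<noteq> 0"
  shows "((\<lambda>s. f (\<lambda>c. z c + s * \<xi> z c)) has_real_derivative
    (Lie \<xi> P z * Q z - P z * Lie \<xi> Q z) / (Q z)\<^sup>2) (at 0)"
proof -
  have P: "P \<in> alg" and Q: "Q \<in> alg" and f: "\<And>z. Q z \<noteq> 0 \<Longrightarrow> f z = P z / Q z"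
    using assms(1) by (auto simp: is_frac_def)
  let ?l = "\<lambda>s c. z c + s * \<xi> z c"
  note dP = Lie_line[OF alg_curve_differentiable[OF P], of z \<xi>]
    and dQ = Lie_line[OF alg_curve_differentiable[OF Q], of z \<xi>]
  have "isCont (\<lambda>s. Q (?l s)) 0" by (rule DERIV_isCont[OF dQ])
  then have "\<forall>\<^sub>F s in nhds 0. Q (?l s) \<noteq> 0"
    using assms(2) tendsto_imp_eventually_ne[of "\<lambda>s. Q (?l s)" "Q z" "at 0" 0]
    by (simp add: eventually_nhds_conv_at isCont_def)
  then have ev: "\<forall>\<^sub>F s in nhds 0. P (?l s) / Q (?l s) = f (?l s)"
    by eventually_elim (simp add: f)
  have "((\<lambda>s. P (?l s) / Q (?l s)) has_real_derivative (Lie \<xi> P z * Q z - P z * Lie \<xi> Q z) / (Q z)\<^sup>2) (at 0)"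
    using DERIV_divide[OF dP dQ] assms(2) by (simp add: power2_eq_square)
  then show ?thesis
    by (subst (asm) DERIV_cong_ev[OF refl ev refl])
qed

lemma Lie_frac: "is_frac f P Q \<Longrightarrow> Q z \<noteq> 0 \<Longrightarrow> Lie \<xi> f z = (Lie \<xi> P z * Q z - P z * Lie \<xi> Q z) / (Q z)\<^sup>2"
  by (rule Lie_eqI[OF Lie_frac_line])

lemma frac_Lie:
  assumes "is_frac f P Q" "\<And>c. (\<lambda>z. \<xi> z c) \<in> alg"
  shows "is_frac (Lie \<xi> f) (\<lambda>z. Lie \<xi> P z * Q z - P z * Lie \<xi> Q z) (\<lambda>z. (Q z)\<^sup>2)"
  using assms(1) Lie_frac[OF assms(1)] Lie_alg[OF _ assms(2)] by (auto simp: is_frac_def intro!: alg_intros)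

lemma frac_at_Lie: "frac_at z f \<Longrightarrow> (\<And>c. (\<lambda>z. \<xi> z c) \<in> alg) \<Longrightarrow> frac_at z (Lie \<xi> f)"
proof -
  assume "frac_at z f" and \<xi>: "\<And>c. (\<lambda>z. \<xi> z c) \<in> alg"
  then obtain P Q where f: "is_frac f P Q" and "Q z \<noteq> 0" unfolding frac_at_def by blast
  then have "(Q z)\<^sup>2 \<noteq> 0" by simp
  with frac_Lie[OF f \<xi>] show "frac_at z (Lie \<xi> f)" unfolding frac_at_def
    by (intro exI conjI)
qed

lemma frac_at_D: "frac_at z f \<Longrightarrow> frac_at z (D i f)"
  unfolding D_def by (rule frac_at_Lie) (auto intro: total_field_alg)

lemma frac_at_alg: "f \<in> alg \<Longrightarrow> frac_at z f"
  by (rule frac_atI[of f "\<lambda>z. 1"]) (auto intro: alg_intros)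

lemma
  assumes "frac_at z f" "frac_at z g"
  shows frac_at_add: "frac_at z (\<lambda>z. f z + g z)"
    and frac_at_mult: "frac_at z (\<lambda>z. f z * g z)"
proof -
  obtain P Q R S where *: "P \<in> alg" "Q \<in> alg" "\<And>z. Q z \<noteq> 0 \<Longrightarrow> f z = P z / Q z" "Q z \<noteq> 0"
    "R \<in> alg" "S \<in> alg" "\<And>z. S z \<noteq> 0 \<Longrightarrow> g z = R z / S z" "S z \<noteq> 0"
    using assms unfolding frac_at_def is_frac_def by blast
  show "frac_at z (\<lambda>z. f z + g z)"
    by (rule frac_atI[of "\<lambda>z. P z * S z + R z * Q z" "\<lambda>z. Q z * S z"])
      (use * in \<open>auto intro!: alg_intros simp: field_simps\<close>)
  show "frac_at z (\<lambda>z. f z * g z)"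
    by (rule frac_atI[of "\<lambda>z. P z * R z" "\<lambda>z. Q z * S z"])
      (use * in \<open>auto intro!: alg_intros simp: field_simps\<close>)
qed

lemma frac_line:
  assumes "frac_at z f"
  shows "((\<lambda>s. f (\<lambda>c. z c + s * \<xi> z c)) has_real_derivative Lie \<xi> f z) (at 0)"
proof -
  obtain P Q where f: "is_frac f P Q" "Q z \<noteq> 0" using assms unfolding frac_at_def by blast
  show ?thesis using Lie_frac_line[OF f, of \<xi>] unfolding Lie_frac[OF f] .
qed

lemma
  assumes "frac_at z f" "frac_at z g"
  shows Lie_at_add: "Lie \<xi> (\<lambda>z. f z + g z) z = Lie \<xi> f z + Lie \<xi> g z"
    and Lie_at_diff: "Lie \<xi> (\<lambda>z. f z - g z) z = Lie \<xi> f z - Lie \<xi> g z"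
    and Lie_at_mult: "Lie \<xi> (\<lambda>z. f z * g z) z = Lie \<xi> f z * g z + f z * Lie \<xi> g z"
proof -
  note d = frac_line[OF assms(1), of \<xi>] frac_line[OF assms(2), of \<xi>]
  show "Lie \<xi> (\<lambda>z. f z + g z) z = Lie \<xi> f z + Lie \<xi> g z"
    using DERIV_add[OF d] by (rule Lie_eqI)
  show "Lie \<xi> (\<lambda>z. f z - g z) z = Lie \<xi> f z - Lie \<xi> g z"
    using DERIV_diff[OF d] by (rule Lie_eqI)
  show "Lie \<xi> (\<lambda>z. f z * g z) z = Lie \<xi> f z * g z + f z * Lie \<xi> g z"
    using DERIV_mult[OF d] by (intro Lie_eqI) (simp add: mult.commute)
qed

lemma prolong_D_frac:
  assumes X: "smooth_field X" and f: "frac_at z f"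
  shows "Lie (prolong X) (D i f) z = D i (Lie (prolong X) f) z
    - (\<Sum>j\<in>{Ti, Xi, Yi}. D i (\<lambda>z. base_comp j (X (pt z))) z * D j f z)"
proof -
  obtain P Q where f: "is_frac f P Q" "Q z \<noteq> 0" using f unfolding frac_at_def by blast
  then have P: "P \<in> alg" and Q: "Q \<in> alg" by (auto simp: is_frac_def)
  note DX = D_alg[OF Lie_alg[OF P prolong_alg[OF X]]] Lie_alg[OF P prolong_alg[OF X]]
    D_alg[OF Lie_alg[OF Q prolong_alg[OF X]]] Lie_alg[OF Q prolong_alg[OF X]] D_alg[OF P] D_alg[OF Q] P Q
  have 1: "Lie (prolong X) (D i f) z = (Lie (prolong X) (\<lambda>z. D i P z * Q z - P z * D i Q z) z * (Q z)\<^sup>2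
      - (D i P z * Q z - P z * D i Q z) * Lie (prolong X) (\<lambda>z. (Q z)\<^sup>2) z) / ((Q z)\<^sup>2)\<^sup>2"
    using Lie_frac[OF frac_Lie[of f P Q "total_field i", OF f(1) total_field_alg], of z "prolong X"] f(2) by (simp add: D_def)
  have 2: "D i (Lie (prolong X) f) z = (D i (\<lambda>z. Lie (prolong X) P z * Q z - P z * Lie (prolong X) Q z) z * (Q z)\<^sup>2
      - (Lie (prolong X) P z * Q z - P z * Lie (prolong X) Q z) * D i (\<lambda>z. (Q z)\<^sup>2) z) / ((Q z)\<^sup>2)\<^sup>2"
    using Lie_frac[OF frac_Lie[OF f(1) prolong_alg[OF X]], of z "total_field i"] f(2) by (simp add: D_def)
  have 3: "D j f z = (D j P z * Q z - P z * D j Q z) / (Q z)\<^sup>2" for j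
    using Lie_frac[OF f] by (simp add: D_def)
  have 4: "D i (Lie (prolong X) P) z = Lie (prolong X) (D i P) z
      + (\<Sum>j\<in>{Ti, Xi, Yi}. D i (\<lambda>z. base_comp j (X (pt z))) z * D j P z)"
    "D i (Lie (prolong X) Q) z = Lie (prolong X) (D i Q) z
      + (\<Sum>j\<in>{Ti, Xi, Yi}. D i (\<lambda>z. base_comp j (X (pt z))) z * D j Q z)"
    using prolong_D[OF X P, of i z] prolong_D[OF X Q, of i z] by auto
  show ?thesis
    unfolding 1 2 3
    using f(2) by (simp add: Lie_mult Lie_diff Lie_power D_mult D_diff D_power DX alg_intros 4 power2_eq_square)
      (simp add: field_simps)
qed

section \<open>The symmetry algebra\<close>

definition field :: "(real \<Rightarrow> real) \<Rightarrow> (real \<Rightarrow> real) \<Rightarrow> (real \<Rightarrow> real) \<Rightarrow> (real \<Rightarrow> real) \<Rightarrow> (real \<Rightarrow> real) \<Rightarrow> point \<Rightarrow> point" where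
  "field a b c d e = (\<lambda>p. X1 a p + X2 b p + X3 c p + X4 d p + X5 e p)"

definition tm :: "(real \<Rightarrow> real) \<Rightarrow> jet \<Rightarrow> real" where
  "tm a z = a (z (Base Ti))"

lemma tm_alg: "smooth a \<Longrightarrow> tm a \<in> alg"
  unfolding tm_def by (rule fpoly_time)

lemma D_tm: "smooth a \<Longrightarrow> D i (tm a) = (\<lambda>z. if i = Ti then tm (deriv a) z else 0)"
  unfolding tm_def by (simp add: D_time)

lemma sym_algE:
  assumes "X \<in> sym_alg"
  obtains a b c d e where "X = field a b c d e" "smooth a" "smooth b" "smooth c" "smooth d" "smooth e"
  using assms unfolding sym_alg_def field_def by blast

lemma field_sym_alg:
  "smooth a \<Longrightarrow> smooth b \<Longrightarrow> smooth c \<Longrightarrow> smooth d \<Longrightarrow> smooth e \<Longrightarrow> field a b c d e \<in> sym_alg"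
  unfolding sym_alg_def field_def by blast

lemma smooth_power: "smooth f \<Longrightarrow> smooth (\<lambda>p. f p ^ n)"
  by (induction n) (auto intro: smooth_mult)

lemma smooth_uminus: "smooth f \<Longrightarrow> smooth (\<lambda>p. - f p)"
  using smooth_mult[OF smooth_const[of "-1"]] by simp

lemma smooth_diff: "smooth f \<Longrightarrow> smooth g \<Longrightarrow> smooth (\<lambda>p. f p - g p)"
  using smooth_add[OF _ smooth_uminus] by simp

lemma smooth_fst: "smooth a \<Longrightarrow> smooth (\<lambda>p :: point. a (fst p))"
  using smooth_compose_linear[of a fst] by (simp add: bounded_linear_fst)

lemma smooth_projections:
  "smooth (\<lambda>p :: point. fst (snd p))" "smooth (\<lambda>p :: point. fst (snd (snd p)))"
  "smooth (\<lambda>p :: point. fst (snd (snd (snd p))))" "smooth (\<lambda>p :: point. snd (snd (snd (snd p))))"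
  by (intro smooth_linear bounded_linear_intros)+

locale symmetry =
  fixes a b c d e :: "real \<Rightarrow> real"
  assumes smooth: "smooth a" "smooth b" "smooth c" "smooth d" "smooth e"
begin

abbreviation X :: "point \<Rightarrow> point" where "X \<equiv> field a b c d e"

lemma base_comp_field:
  "base_comp Ti (X (pt z)) = tm d z"
  "base_comp Xi (X (pt z)) = tm a z + z (Base Yi) * tm c z + (z (Base Yi))\<^sup>2 * tm (deriv e) z + 2 * z (Base Xi) * tm e z"
  "base_comp Yi (X (pt z)) = tm b z + 1/2 * tm (deriv d) z * z (Base Yi) + z (Base Yi) * tm e z"
  by (simp_all add: field_def X1_def X2_def X3_def X4_def X5_def pt_def tm_def)

lemma fibre_comp_field:
  "fibre_comp Ud (X (pt z)) = tm (deriv b) z - 2 * tm c z + 1/2 * (z (Base Yi) * tm (deriv (deriv d)) z - u_0 z * tm (deriv d) z)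
     + u_0 z * tm e z - 3 * z (Base Yi) * tm (deriv e) z"
  "fibre_comp Vd (X (pt z)) = tm (deriv a) z + u_0 z * tm c z + z (Base Yi) * tm (deriv c) z - tm (deriv d) z * v_0 z
     + (z (Base Yi))\<^sup>2 * tm (deriv (deriv e)) z + 2 * z (Base Yi) * u_0 z * tm (deriv e) z + 2 * v_0 z * tm e z
     + 2 * z (Base Xi) * tm (deriv e) z"
  by (simp_all add: field_def X1_def X2_def X3_def X4_def X5_def pt_def tm_def)

lemma smooth_field: "smooth_field X"
proof -
  note intros = smooth_add smooth_mult smooth_diff smooth_uminus smooth_power smooth_const
    smooth_projections
    smooth_fst[OF smooth(1)] smooth_fst[OF smooth(2)] smooth_fst[OF smooth(3)] smooth_fst[OF smooth(4)] smooth_fst[OF smooth(5)]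
    smooth_fst[OF smooth_deriv[OF smooth(1)]] smooth_fst[OF smooth_deriv[OF smooth(2)]]
    smooth_fst[OF smooth_deriv[OF smooth(3)]] smooth_fst[OF smooth_deriv[OF smooth(4)]]
    smooth_fst[OF smooth_deriv[OF smooth(5)]] smooth_fst[OF smooth_deriv[OF smooth_deriv[OF smooth(4)]]]
    smooth_fst[OF smooth_deriv[OF smooth_deriv[OF smooth(5)]]]
  have "smooth (\<lambda>p. base_comp i (X p))" for i
  proof (cases i)
    case Ti
    have "(\<lambda>p. base_comp i (X p)) = (\<lambda>p. d (fst p))"
      by (auto simp: Ti field_def X1_def X2_def X3_def X4_def X5_def)
    then show ?thesis by (simp only:) (intro intros)
  next
    case Xi
    have "(\<lambda>p. base_comp i (X p)) = (\<lambda>p. a (fst p) + fst (snd (snd p)) * c (fst p)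
        + (fst (snd (snd p)))\<^sup>2 * deriv e (fst p) + 2 * fst (snd p) * e (fst p))"
      by (auto simp: Xi field_def X1_def X2_def X3_def X4_def X5_def)
    then show ?thesis by (simp only:) (intro intros)
  next
    case Yi
    have "(\<lambda>p. base_comp i (X p)) = (\<lambda>p. b (fst p) + 1/2 * deriv d (fst p) * fst (snd (snd p))
        + fst (snd (snd p)) * e (fst p))"
      by (auto simp: Yi field_def X1_def X2_def X3_def X4_def X5_def)
    then show ?thesis by (simp only:) (intro intros)
  qed
  moreover have "smooth (\<lambda>p. fibre_comp \<alpha> (X p))" for \<alpha>
  proof (cases \<alpha>)
    case Ud
    have "(\<lambda>p. fibre_comp \<alpha> (X p)) = (\<lambda>p. deriv b (fst p) - 2 * c (fst p)
        + 1/2 * (fst (snd (snd p)) * deriv (deriv d) (fst p) - fst (snd (snd (snd p))) * deriv d (fst p))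
        + fst (snd (snd (snd p))) * e (fst p) - 3 * fst (snd (snd p)) * deriv e (fst p))"
      by (auto simp: Ud field_def X1_def X2_def X3_def X4_def X5_def)
    then show ?thesis by (simp only:) (intro intros)
  next
    case Vd
    have "(\<lambda>p. fibre_comp \<alpha> (X p)) = (\<lambda>p. deriv a (fst p) + fst (snd (snd (snd p))) * c (fst p)
        + fst (snd (snd p)) * deriv c (fst p) - deriv d (fst p) * snd (snd (snd (snd p)))
        + (fst (snd (snd p)))\<^sup>2 * deriv (deriv e) (fst p) + 2 * fst (snd (snd p)) * fst (snd (snd (snd p))) * deriv e (fst p)
        + 2 * snd (snd (snd (snd p))) * e (fst p) + 2 * fst (snd p) * deriv e (fst p))"
      by (auto simp: Vd field_def X1_def X2_def X3_def X4_def X5_def)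
    then show ?thesis by (simp only:) (intro intros)
  qed
  ultimately show ?thesis by (simp add: smooth_field_def)
qed

lemmas tm_rules = tm_alg[OF smooth(1)] tm_alg[OF smooth(2)] tm_alg[OF smooth(3)] tm_alg[OF smooth(4)] tm_alg[OF smooth(5)]
  tm_alg[OF smooth_deriv[OF smooth(1)]] tm_alg[OF smooth_deriv[OF smooth(2)]] tm_alg[OF smooth_deriv[OF smooth(3)]]
  tm_alg[OF smooth_deriv[OF smooth(4)]] tm_alg[OF smooth_deriv[OF smooth(5)]]
  tm_alg[OF smooth_deriv[OF smooth_deriv[OF smooth(4)]]] tm_alg[OF smooth_deriv[OF smooth_deriv[OF smooth(5)]]]
  D_tm[OF smooth(1)] D_tm[OF smooth(2)] D_tm[OF smooth(3)] D_tm[OF smooth(4)] D_tm[OF smooth(5)]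
  D_tm[OF smooth_deriv[OF smooth(1)]] D_tm[OF smooth_deriv[OF smooth(2)]] D_tm[OF smooth_deriv[OF smooth(3)]]
  D_tm[OF smooth_deriv[OF smooth(4)]] D_tm[OF smooth_deriv[OF smooth(5)]]
  D_tm[OF smooth_deriv[OF smooth_deriv[OF smooth(4)]]] D_tm[OF smooth_deriv[OF smooth_deriv[OF smooth(5)]]]

lemmas calc = tm_rules D_simps alg_intros

lemma D_base_comp:
  "D i (\<lambda>z. base_comp Ti (X (pt z))) = (\<lambda>z. if i = Ti then tm (deriv d) z else 0)"
  "D i (\<lambda>z. base_comp Xi (X (pt z))) = (\<lambda>z. case i of
      Ti \<Rightarrow> tm (deriv a) z + z (Base Yi) * tm (deriv c) z + (z (Base Yi))\<^sup>2 * tm (deriv (deriv e)) z + 2 * z (Base Xi) * tm (deriv e) z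
    | Xi \<Rightarrow> 2 * tm e z
    | Yi \<Rightarrow> tm c z + 2 * z (Base Yi) * tm (deriv e) z)"
  "D i (\<lambda>z. base_comp Yi (X (pt z))) = (\<lambda>z. case i of
      Ti \<Rightarrow> tm (deriv b) z + 1/2 * tm (deriv (deriv d)) z * z (Base Yi) + z (Base Yi) * tm (deriv e) z
    | Xi \<Rightarrow> 0
    | Yi \<Rightarrow> 1/2 * tm (deriv d) z + tm e z)"
  unfolding base_comp_field by (cases i; simp add: calc fun_eq_iff)+

declare prolong.simps(2) [simp del]

lemma prolong_rec:
  "(\<lambda>z. prolong X z (Jet \<alpha> (inc i \<sigma>))) = (\<lambda>z. D i (\<lambda>z. prolong X z (Jet \<alpha> \<sigma>)) z
    - (\<Sum>j\<in>{Ti, Xi, Yi}. D i (\<lambda>z. base_comp j (X (pt z))) z * z (Jet \<alpha> (inc j \<sigma>))))"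
  using prolong_inc[OF smooth_field] by blast

lemma prolong_u_x: "(\<lambda>z. prolong X z (Jet Ud (0, 1, 0))) = (\<lambda>z. - (1/2 * tm (deriv d) z + tm e z) * u_x z)"
  using prolong_rec[of Ud Xi "(0, 0, 0)"]
  by (simp add: calc D_base_comp fibre_comp_field fun_eq_iff, (simp add: algebra_simps)?)

lemma prolong_u_y: "(\<lambda>z. prolong X z (Jet Ud (0, 0, 1))) = (\<lambda>z. 1/2 * tm (deriv (deriv d)) z - 3 * tm (deriv e) z
    - (tm c z + 2 * z (Base Yi) * tm (deriv e) z) * u_x z - tm (deriv d) z * u_y z)"
  using prolong_rec[of Ud Yi "(0, 0, 0)"]
  by (simp add: calc D_base_comp fibre_comp_field fun_eq_iff, (simp add: field_simps)?)

lemma prolong_u_xx: "(\<lambda>z. prolong X z (Jet Ud (0, 2, 0))) = (\<lambda>z. - (1/2 * tm (deriv d) z + 3 * tm e z) * u_xx z)"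
  using prolong_rec[of Ud Xi "(0, 1, 0)"] unfolding prolong_u_x
  by (simp add: calc D_base_comp fun_eq_iff flip: numeral_2_eq_2, (simp add: algebra_simps flip: numeral_2_eq_2)?)

lemma prolong_u_xy: "(\<lambda>z. prolong X z (Jet Ud (0, 1, 1))) = (\<lambda>z. - (tm (deriv d) z + 2 * tm e z) * u_xy z
    - (tm c z + 2 * z (Base Yi) * tm (deriv e) z) * u_xx z)"
  using prolong_rec[of Ud Yi "(0, 1, 0)"] unfolding prolong_u_x
  by (simp add: calc D_base_comp fun_eq_iff flip: numeral_2_eq_2, (simp add: algebra_simps flip: numeral_2_eq_2)?)

lemma prolong_u_yy: "(\<lambda>z. prolong X z (Jet Ud (0, 0, 2))) = (\<lambda>z. - 2 * tm (deriv e) z * u_x z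
    - 2 * (tm c z + 2 * z (Base Yi) * tm (deriv e) z) * u_xy z - (3/2 * tm (deriv d) z + tm e z) * u_yy z)"
  using prolong_rec[of Ud Yi "(0, 0, 1)"] unfolding prolong_u_y
  by (simp add: calc D_base_comp fun_eq_iff flip: numeral_2_eq_2, (simp add: algebra_simps flip: numeral_2_eq_2)?)

lemma prolong_u_tx: "(\<lambda>z. prolong X z (Jet Ud (1, 1, 0))) = (\<lambda>z. - (1/2 * tm (deriv (deriv d)) z + tm (deriv e) z) * u_x z
    - (3/2 * tm (deriv d) z + tm e z) * z (Jet Ud (1, 1, 0))
    - (tm (deriv a) z + z (Base Yi) * tm (deriv c) z + (z (Base Yi))\<^sup>2 * tm (deriv (deriv e)) z + 2 * z (Base Xi) * tm (deriv e) z) * u_xx z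
    - (tm (deriv b) z + 1/2 * tm (deriv (deriv d)) z * z (Base Yi) + z (Base Yi) * tm (deriv e) z) * u_xy z)"
  using prolong_rec[of Ud Ti "(0, 1, 0)"] unfolding prolong_u_x
  by (simp add: calc D_base_comp fun_eq_iff flip: numeral_2_eq_2, (simp add: algebra_simps flip: numeral_2_eq_2)?)

lemma prolong_v_x: "(\<lambda>z. prolong X z (Jet Vd (0, 1, 0))) = (\<lambda>z. (tm c z + 2 * z (Base Yi) * tm (deriv e) z) * u_x z
    - tm (deriv d) z * v_x z + 2 * tm (deriv e) z)"
  using prolong_rec[of Vd Xi "(0, 0, 0)"]
  by (simp add: calc D_base_comp fibre_comp_field fun_eq_iff, (simp add: algebra_simps)?)

lemma prolong_v_y: "(\<lambda>z. prolong X z (Jet Vd (0, 0, 1))) = (\<lambda>z. (tm c z + 2 * z (Base Yi) * tm (deriv e) z) * (u_y z - v_x z)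
    + tm (deriv c) z + 2 * z (Base Yi) * tm (deriv (deriv e)) z + 2 * u_0 z * tm (deriv e) z
    + (tm e z - 3/2 * tm (deriv d) z) * v_y z)"
  using prolong_rec[of Vd Yi "(0, 0, 0)"]
  by (simp add: calc D_base_comp fibre_comp_field fun_eq_iff, (simp add: algebra_simps)?)

lemma prolong_v_xx: "(\<lambda>z. prolong X z (Jet Vd (0, 2, 0))) = (\<lambda>z. (tm c z + 2 * z (Base Yi) * tm (deriv e) z) * u_xx z
    - (tm (deriv d) z + 2 * tm e z) * v_xx z)"
  using prolong_rec[of Vd Xi "(0, 1, 0)"] unfolding prolong_v_x
  by (simp add: calc D_base_comp fun_eq_iff flip: numeral_2_eq_2, (simp add: algebra_simps flip: numeral_2_eq_2)?)

lemma prolong_v_xy: "(\<lambda>z. prolong X z (Jet Vd (0, 1, 1))) = (\<lambda>z. 2 * tm (deriv e) z * u_x z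
    + (tm c z + 2 * z (Base Yi) * tm (deriv e) z) * (u_xy z - v_xx z) - (3/2 * tm (deriv d) z + tm e z) * v_xy z)"
  using prolong_rec[of Vd Yi "(0, 1, 0)"] unfolding prolong_v_x
  by (simp add: calc D_base_comp fun_eq_iff flip: numeral_2_eq_2, (simp add: algebra_simps flip: numeral_2_eq_2)?)

lemma prolong_v_yy: "(\<lambda>z. prolong X z (Jet Vd (0, 0, 2))) = (\<lambda>z. 2 * tm (deriv e) z * (2 * u_y z - v_x z)
    + (tm c z + 2 * z (Base Yi) * tm (deriv e) z) * (u_yy z - 2 * v_xy z) + 2 * tm (deriv (deriv e)) z
    - 2 * tm (deriv d) z * v_yy z)"
  using prolong_rec[of Vd Yi "(0, 0, 1)"] unfolding prolong_v_y
  by (simp add: calc D_base_comp fun_eq_iff flip: numeral_2_eq_2, (simp add: algebra_simps flip: numeral_2_eq_2)?)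

lemma prolong_v_tx: "(\<lambda>z. prolong X z (Jet Vd (1, 1, 0))) = (\<lambda>z. (tm (deriv c) z + 2 * z (Base Yi) * tm (deriv (deriv e)) z) * u_x z
    + (tm c z + 2 * z (Base Yi) * tm (deriv e) z) * z (Jet Ud (1, 1, 0)) - tm (deriv (deriv d)) z * v_x z
    - 2 * tm (deriv d) z * z (Jet Vd (1, 1, 0)) + 2 * tm (deriv (deriv e)) z
    - (tm (deriv a) z + z (Base Yi) * tm (deriv c) z + (z (Base Yi))\<^sup>2 * tm (deriv (deriv e)) z + 2 * z (Base Xi) * tm (deriv e) z) * v_xx z
    - (tm (deriv b) z + 1/2 * tm (deriv (deriv d)) z * z (Base Yi) + z (Base Yi) * tm (deriv e) z) * v_xy z)"
  using prolong_rec[of Vd Ti "(0, 1, 0)"] unfolding prolong_v_x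
  by (simp add: calc D_base_comp fun_eq_iff flip: numeral_2_eq_2, (simp add: algebra_simps flip: numeral_2_eq_2)?)

lemmas prolong_low = prolong_u_x[THEN fun_cong] prolong_u_y[THEN fun_cong] prolong_u_xx[THEN fun_cong]
  prolong_u_xy[THEN fun_cong] prolong_u_yy[THEN fun_cong] prolong_u_tx[THEN fun_cong] prolong_v_x[THEN fun_cong]
  prolong_v_y[THEN fun_cong] prolong_v_xx[THEN fun_cong] prolong_v_xy[THEN fun_cong] prolong_v_yy[THEN fun_cong]
  prolong_v_tx[THEN fun_cong]

text \<open>The infinitesimal symmetry condition: the derivatives of the two equations are
  combinations of the equations themselves, so the prolonged fields are tangent to the
  equation.\<close>

lemma prolong_eqn_u: "Lie (prolong X) (eqn Ud) z = - (3/2 * tm (deriv d) z + tm e z) * eqn Ud z"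
  unfolding eqn_eq rest.simps
  by (simp add: Lie_simps alg_intros prolong_low[simplified] fibre_comp_field) (simp add: field_simps power2_eq_square)

lemma prolong_eqn_v: "Lie (prolong X) (eqn Vd) z =
    - 2 * tm (deriv d) z * eqn Vd z + (tm c z + 2 * z (Base Yi) * tm (deriv e) z) * eqn Ud z"
  unfolding eqn_eq rest.simps
  by (simp add: Lie_simps alg_intros prolong_low[simplified] fibre_comp_field) (simp add: field_simps power2_eq_square)

lemma vanish:
  assumes "f \<in> alg" "\<And>z. z \<in> equation_inf \<Longrightarrow> f z = 0" "z \<in> equation_inf"
  shows "Lie (prolong X) f z = 0"
proof (rule prolong_vanish[OF smooth_field _ assms])
  fix z \<alpha> assume "z \<in> equation_inf"
  then have e: "eqn \<alpha> z = 0" for \<alpha> unfolding equation_inf_eqn by (metis D_multi_0)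
  have "Lie (prolong X) (eqn Ud) z = 0" "Lie (prolong X) (eqn Vd) z = 0"
    by (simp_all only: prolong_eqn_u prolong_eqn_v e mult_zero_right add_0_right)
  then show "Lie (prolong X) (eqn \<alpha>) z = 0" by (metis dep.exhaust)
qed

end

section \<open>Invariance of the generators\<close>

text \<open>Excludes the zeros of all denominators in \<open>I2\<close> and the three
  derivations.\<close>

definition good :: "jet \<Rightarrow> bool" where
  "good z \<longleftrightarrow> u_x z \<noteq> 0 \<and> u_xx z \<noteq> 0"

text \<open>The first index names a derivation by the base direction that it adds: \<open>Xi\<close>
  stands for \<open>nabla1\<close>, \<open>Yi\<close> for \<open>nabla2\<close>, \<open>Ti\<close>
  for \<open>nabla3\<close>. The second index selects the total derivative whose coefficient is
  meant.\<close>

fun nnum :: "indep \<Rightarrow> indep \<Rightarrow> jet \<Rightarrow> real" where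
  "nnum Xi Xi = (\<lambda>z. u_x z)"
| "nnum Xi _ = (\<lambda>z. 0)"
| "nnum Yi Xi = (\<lambda>z. u_xy z)"
| "nnum Yi Yi = (\<lambda>z. - 1)"
| "nnum Yi Ti = (\<lambda>z. 0)"
| "nnum Ti Xi = (\<lambda>z. v_x z * u_x z + v_0 z * u_xx z + u_yy z)"
| "nnum Ti Yi = (\<lambda>z. u_x z * u_x z + u_0 z * u_xx z - 2 * u_xy z)"
| "nnum Ti Ti = (\<lambda>z. u_xx z)"

fun nden :: "indep \<Rightarrow> indep \<Rightarrow> jet \<Rightarrow> real" where
  "nden Xi _ = (\<lambda>z. u_xx z)"
| "nden Yi Xi = (\<lambda>z. u_x z * u_xx z)"
| "nden Yi _ = (\<lambda>z. u_x z)"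
| "nden Ti _ = (\<lambda>z. u_x z ^ 3)"

definition nab :: "indep \<Rightarrow> (jet \<Rightarrow> real) \<Rightarrow> jet \<Rightarrow> real" where
  "nab k f z = (\<Sum>i\<in>{Ti, Xi, Yi}. nnum k i z / nden k i z * D i f z)"

lemma nab_eq: "nab Xi = nabla1" "nab Yi = nabla2" "nab Ti = nabla3"
proof -
  show "nab Xi = nabla1" by (simp add: fun_eq_iff nab_def nabla1_def)
  show "nab Yi = nabla2" by (simp add: fun_eq_iff nab_def nabla2_def right_diff_distrib)
  have "D Xi (\<lambda>z. v_0 z * u_x z) z + u_yy z = nnum Ti Xi z"
    "D Xi (\<lambda>z. u_0 z * u_x z - 2 * u_y z) z = nnum Ti Yi z" for z
    by (simp_all add: D_simps alg_intros flip: numeral_2_eq_2)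
  then show "nab Ti = nabla3"
    by (simp add: fun_eq_iff nab_def nabla3_def distrib_left add_divide_distrib del: nnum.simps(6,7))
qed

lemma nnum_fpoly: "nnum k i \<in> fibre_poly 2"
  by (cases k; cases i; auto simp: fibre_poly_eq intro!: fpoly_intros fpoly_jet)

lemma nden_fpoly: "nden k i \<in> fibre_poly 2"
  by (cases k; cases i; auto simp: fibre_poly_eq intro!: fpoly_intros fpoly_jet)

lemmas nnum_alg = fibre_poly_alg[OF nnum_fpoly]
  and nden_alg = fibre_poly_alg[OF nden_fpoly]

lemma nden_nonzero: "good z \<Longrightarrow> nden k i z \<noteq> 0"
  by (cases k; cases i) (auto simp: good_def)

lemma frac_at_ncoef: "good z \<Longrightarrow> frac_at z (\<lambda>z. nnum k i z / nden k i z)"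
  by (rule frac_atI[of "nnum k i" "nden k i"]) (auto simp: nnum_alg nden_alg nden_nonzero)

lemma nab_expand: "nab k f = (\<lambda>z. nnum k Ti z / nden k Ti z * D Ti f z + (nnum k Xi z / nden k Xi z * D Xi f z
    + nnum k Yi z / nden k Yi z * D Yi f z))"
  by (simp add: nab_def fun_eq_iff)

lemma exists_good:
  "\<exists>z\<in>equation_inf. pt z = p \<and> u_x z = 1 \<and> u_xx z = 1"
proof -
  define z where "z = (\<lambda>c. case c of Base i \<Rightarrow> base_comp i p
    | Jet \<alpha> \<sigma> \<Rightarrow> if \<sigma> = (0, 0, 0) then fibre_comp \<alpha> p else 1)"
  have "pt z = p" by (cases p) (simp add: z_def pt_def)
  moreover have "u_x (solve z) = 1" "u_xx (solve z) = 1" by (simp_all add: solve_free) (simp_all add: z_def)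
  ultimately show ?thesis using solve_equation[of z] pt_solve[of z] by blast
qed

lemma nonzero_on_fibres_good:
  assumes "Q \<in> fibre_poly k" "\<And>z. good z \<Longrightarrow> Q z \<noteq> 0"
  shows "nonzero_on_fibres k Q"
  unfolding nonzero_on_fibres_iff[OF assms(1)]
proof
  fix p
  obtain z where "z \<in> equation_inf" "pt z = p" "u_x z = 1" "u_xx z = 1" using exists_good by blast
  then show "\<exists>z\<in>equation_inf. pt z = p \<and> Q z \<noteq> 0" using assms(2)[of z] by (auto simp: good_def)
qed

context symmetry
begin

text \<open>Numerator and denominator are relative invariants of the same weight, - (2 d' + 4
  e).\<close>

lemma prolong_I2:
  assumes "u_x z \<noteq> 0"
  shows "Lie (prolong X) I2 z = 0"
proof -
  define P where "P = (\<lambda>z. u_x z * u_x z * u_xy z + u_x z * u_xx z * v_x z + u_xx z * u_yy z - u_xy z * u_xy z)"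
  have "is_frac I2 P (\<lambda>z. u_x z ^ 4)"
    unfolding is_frac_def P_def by (auto simp: I2_def power2_eq_square intro!: alg_intros)
  from Lie_frac[OF this] have "Lie (prolong X) I2 z =
      (Lie (prolong X) P z * u_x z ^ 4 - P z * Lie (prolong X) (\<lambda>z. u_x z ^ 4) z) / (u_x z ^ 4)\<^sup>2"
    using assms by simp
  also have "Lie (prolong X) (\<lambda>z. u_x z ^ 4) z = - (2 * tm (deriv d) z + 4 * tm e z) * u_x z ^ 4"
    by (simp add: Lie_power alg_jet prolong_low[simplified]) (simp add: algebra_simps eval_nat_numeral)
  also have "Lie (prolong X) P z = - (2 * tm (deriv d) z + 4 * tm e z) * P z"
    unfolding P_def
    by (simp add: Lie_simps alg_intros prolong_low[simplified]) (simp add: field_simps)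
  finally show ?thesis by (simp add: algebra_simps)
qed

text \<open>The condition on the coefficients under which a combination of total derivatives
  commutes with the prolonged field, given the commutator in \<open>prolong_D\<close>.\<close>

lemma prolong_ncoef:
  assumes "good z"
  shows "Lie (prolong X) (\<lambda>z. nnum k j z / nden k j z) z =
    (\<Sum>i\<in>{Ti, Xi, Yi}. nnum k i z / nden k i z * D i (\<lambda>z. base_comp j (X (pt z))) z)"
proof -
  have nz: "u_x z \<noteq> 0" "u_xx z \<noteq> 0" using assms by (auto simp: good_def)
  have "is_frac (\<lambda>z. nnum k j z / nden k j z) (nnum k j) (nden k j)"
    by (simp add: is_frac_def nnum_alg nden_alg)
  from Lie_frac[OF this nden_nonzero[OF assms]] show ?thesis
    using nz by (cases k; cases j)
      (simp_all add: Lie_simps alg_intros prolong_low[simplified] fibre_comp_field D_base_comp,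
        (simp add: field_simps eval_nat_numeral)+)
qed

lemma prolong_nab:
  assumes z: "good z" and f: "frac_at z f"
  shows "Lie (prolong X) (nab k f) z = nab k (Lie (prolong X) f) z"
proof -
  let ?c = "\<lambda>i z. nnum k i z / nden k i z"
  have t: "frac_at z (\<lambda>z. ?c i z * D i f z)" for i
    by (intro frac_at_mult frac_at_ncoef frac_at_D z f)
  have "Lie (prolong X) (nab k f) z = (\<Sum>i\<in>{Ti, Xi, Yi}. Lie (prolong X) (\<lambda>z. ?c i z * D i f z) z)"
    unfolding nab_expand Lie_at_add[OF t frac_at_add[OF t t]] Lie_at_add[OF t t] by simp
  also have "\<dots> = (\<Sum>i\<in>{Ti, Xi, Yi}. (\<Sum>j\<in>{Ti, Xi, Yi}. ?c j z * D j (\<lambda>z. base_comp i (X (pt z))) z) * D i f z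
      + ?c i z * (D i (Lie (prolong X) f) z - (\<Sum>j\<in>{Ti, Xi, Yi}. D i (\<lambda>z. base_comp j (X (pt z))) z * D j f z)))"
    by (intro sum.cong refl) (simp only: Lie_at_mult[OF frac_at_ncoef[OF z] frac_at_D[OF f]]
        prolong_ncoef[OF z] prolong_D_frac[OF smooth_field f])
  also have "\<dots> = nab k (Lie (prolong X) f) z"
    by (simp add: nab_def algebra_simps)
  finally show ?thesis .
qed

end

lemma sym_alg_symmetry:
  assumes "X \<in> sym_alg"
  obtains a b c d e where "symmetry a b c d e" "X = field a b c d e"
  using sym_algE[OF assms] by (metis symmetry.intro)

lemma diff_invariant_I2: "diff_invariant 2 I2"
  unfolding diff_invariant_def
proof (intro bexI conjI ballI impI)
  define P where "P = (\<lambda>z. (u_x z)^2 * u_xy z + u_x z * u_xx z * v_x z + u_xx z * u_yy z - (u_xy z)^2)"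
  show "I2 = (\<lambda>z. P z / (u_x z)^4)" by (simp add: fun_eq_iff I2_def P_def)
  show "P \<in> fibre_poly 2" unfolding P_def fibre_poly_eq by (intro fpoly_intros fpoly_jet) auto
  show Q: "(\<lambda>z. (u_x z)^4) \<in> fibre_poly 2" unfolding fibre_poly_eq by (intro fpoly_intros fpoly_jet) auto
  show "nonzero_on_fibres 2 (\<lambda>z. (u_x z)^4)"
    by (rule nonzero_on_fibres_good[OF Q]) (auto simp: good_def)
  fix X z assume "X \<in> sym_alg" "(u_x z)^4 \<noteq> 0"
  then show "Lie (prolong X) I2 z = 0"
    by (auto elim!: sym_alg_symmetry intro: symmetry.prolong_I2)
qed

lemma invariant_derivation_nab: "invariant_derivation (nab k)"
  unfolding invariant_derivation_def
proof (intro conjI exI allI ballI impI)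
  show "nab k f z = (\<Sum>i\<in>{Ti, Xi, Yi}. (\<lambda>i z. nnum k i z / nden k i z) i z * D i f z)" for f z
    by (simp add: nab_def)
  show "rational_fun 2 ((\<lambda>i z. nnum k i z / nden k i z) i)" for i
    unfolding rational_fun_def
    using nnum_fpoly[of k i] nden_fpoly[of k i] nonzero_on_fibres_good[OF nden_fpoly nden_nonzero] by blast
  fix X l f assume X: "X \<in> sym_alg" and f: "rational_fun l f"
  obtain P Q where PQ: "P \<in> fibre_poly l" "Q \<in> fibre_poly l" "nonzero_on_fibres l Q" "f = (\<lambda>z. P z / Q z)"
    using f unfolding rational_fun_def by blast
  define m where "m = max l 2"
  have Q: "Q \<in> fibre_poly m" "nonzero_on_fibres m Q"
    using PQ fibre_poly_mono[of l m Q] by (auto simp: m_def nonzero_on_fibres_iff)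
  have R: "(\<lambda>z. u_x z * u_xx z) \<in> fibre_poly m"
    by (auto simp: m_def fibre_poly_eq intro!: fpoly_intros fpoly_jet)
  have "nonzero_on_fibres m (\<lambda>z. u_x z * u_xx z)"
    by (rule nonzero_on_fibres_good[OF R]) (auto simp: good_def)
  note nz = nonzero_on_fibres_mult[OF Q(1) R Q(2) this]
  have QR: "(\<lambda>z. Q z * (u_x z * u_xx z)) \<in> fibre_poly m"
    using Q R by (simp add: fibre_poly_eq fpoly_intros)
  show "generically (\<lambda>z. Lie (prolong X) (nab k f) z = nab k (Lie (prolong X) f) z)"
    unfolding generically_def
  proof (intro exI bexI conjI ballI impI)
    fix z assume "Q z * (u_x z * u_xx z) \<noteq> 0"
    then have "good z" "Q z \<noteq> 0" by (auto simp: good_def)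
    moreover from this have "frac_at z f"
      by (intro frac_atI[of P Q]) (use PQ fibre_poly_alg in auto)
    ultimately show "Lie (prolong X) (nab k f) z = nab k (Lie (prolong X) f) z"
      using X by (auto elim!: sym_alg_symmetry intro: symmetry.prolong_nab)
  qed (use nz QR in auto)
qed

text \<open>Only powers of \<open>u_x\<close> and \<open>u_xx\<close> occur as denominators, so
  statements about iterated derivatives hold at every good point. With the exponent
  \<open>Suc n\<close> the denominator vanishes exactly off the good points.\<close>

definition regular :: "(jet \<Rightarrow> real) \<Rightarrow> bool" where
  "regular f \<longleftrightarrow> (\<exists>P\<in>jpoly. \<exists>n. \<forall>z. good z \<longrightarrow> f z = P z / (u_x z * u_xx z) ^ Suc n)"

lemma regularI: "P \<in> jpoly \<Longrightarrow> (\<And>z. good z \<Longrightarrow> f z = P z / (u_x z * u_xx z) ^ Suc n) \<Longrightarrow> regular f"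
  unfolding regular_def by blast

lemma good_iff: "good z \<longleftrightarrow> (u_x z * u_xx z) ^ Suc n \<noteq> 0"
  by (auto simp: good_def)

lemma regular_frac:
  assumes "regular f"
  obtains P n where "P \<in> jpoly" "is_frac f P (\<lambda>z. (u_x z * u_xx z) ^ Suc n)"
proof -
  obtain P n where P: "P \<in> jpoly" "\<And>z. good z \<Longrightarrow> f z = P z / (u_x z * u_xx z) ^ Suc n"
    using assms unfolding regular_def by blast
  then have "is_frac f P (\<lambda>z. (u_x z * u_xx z) ^ Suc n)"
    unfolding is_frac_def using good_iff[of _ n] by (auto simp: jpoly_alg intro!: alg_intros simp del: power_Suc)
  with P(1) show ?thesis by (rule that)
qed

lemma regular_frac_at: "regular f \<Longrightarrow> good z \<Longrightarrow> frac_at z f"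
  by (erule regular_frac) (use good_iff[of z] in \<open>unfold frac_at_def, blast\<close>)

lemma regular_jpoly: "f \<in> jpoly \<Longrightarrow> regular f"
  by (rule regularI[of "\<lambda>z. f z * (u_x z * u_xx z)" _ 0]) (auto intro!: jpoly_intros simp: good_def)

lemma regular_cong: "regular f \<Longrightarrow> (\<And>z. good z \<Longrightarrow> g z = f z) \<Longrightarrow> regular g"
  unfolding regular_def by metis

lemma regular_add: "regular f \<Longrightarrow> regular g \<Longrightarrow> regular (\<lambda>z. f z + g z)"
  and regular_mult: "regular f \<Longrightarrow> regular g \<Longrightarrow> regular (\<lambda>z. f z * g z)"
proof -
  assume "regular f" "regular g"
  then obtain P m R n where PR: "P \<in> jpoly" "\<And>z. good z \<Longrightarrow> f z = P z / (u_x z * u_xx z) ^ Suc m"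
    "R \<in> jpoly" "\<And>z. good z \<Longrightarrow> g z = R z / (u_x z * u_xx z) ^ Suc n"
    unfolding regular_def by blast
  have *: "f z + g z = (P z * (u_x z * u_xx z) ^ Suc n + R z * (u_x z * u_xx z) ^ Suc m) / (u_x z * u_xx z) ^ Suc (m + Suc n)"
    "f z * g z = P z * R z / (u_x z * u_xx z) ^ Suc (m + Suc n)" if "good z" for z
  proof -
    define q where "q = u_x z * u_xx z"
    have "q \<noteq> 0" using that by (auto simp: q_def good_def)
    then have q: "q ^ Suc m \<noteq> 0" "q ^ Suc n \<noteq> 0" "q ^ Suc (m + Suc n) = q ^ Suc m * q ^ Suc n"
      by (simp_all add: power_add)
    show "f z + g z = (P z * (u_x z * u_xx z) ^ Suc n + R z * (u_x z * u_xx z) ^ Suc m) / (u_x z * u_xx z) ^ Suc (m + Suc n)"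
      "f z * g z = P z * R z / (u_x z * u_xx z) ^ Suc (m + Suc n)"
      unfolding PR(2,4)[OF that] q_def[symmetric] q(3)
      by (rule add_frac_eq[OF q(1,2)], rule times_divide_times_eq)
  qed
  show "regular (\<lambda>z. f z + g z)" by (rule regularI[OF _ *(1)]) (intro jpoly_intros PR; assumption)
  show "regular (\<lambda>z. f z * g z)" by (rule regularI[OF _ *(2)]) (intro jpoly_intros PR; assumption)
qed

lemma regular_D:
  assumes "regular f"
  shows "regular (D i f)"
proof -
  obtain P n where P: "P \<in> jpoly" "is_frac f P (\<lambda>z. (u_x z * u_xx z) ^ Suc n)"
    using assms by (rule regular_frac)
  let ?Q = "\<lambda>z. (u_x z * u_xx z) ^ Suc n"
  have Q: "?Q \<in> jpoly" by (intro jpoly_intros)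
  show ?thesis
  proof (rule regularI)
    show "(\<lambda>z. D i P z * ?Q z - P z * D i ?Q z) \<in> jpoly" by (intro jpoly_intros D_jpoly P Q)
    fix z assume z: "good z"
    have "(?Q z)\<^sup>2 = (u_x z * u_xx z) ^ Suc (n + Suc n)"
      by (simp only: power2_eq_square power_add[symmetric]) simp
    moreover have "D i f z = (D i P z * ?Q z - P z * D i ?Q z) / (?Q z)\<^sup>2"
      unfolding D_def by (rule Lie_frac[OF P(2)]) (use good_iff[of z n] z in blast)
    ultimately show "D i f z = (D i P z * ?Q z - P z * D i ?Q z) / (u_x z * u_xx z) ^ Suc (n + Suc n)"
      by (simp only:)
  qed
qed

lemma regular_ncoef: "regular (\<lambda>z. nnum k i z / nden k i z)"
proof -
  have 1: "regular (\<lambda>z. 1 / u_x z)" "regular (\<lambda>z. 1 / u_xx z)"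
    by (rule regularI[of "\<lambda>z. u_xx z" _ 0] regularI[of "\<lambda>z. u_x z" _ 0]; auto intro!: jpoly_intros simp: good_def)+
  have 2: "nnum k i \<in> jpoly" by (cases k; cases i; auto intro!: jpoly_intros)
  have "regular (\<lambda>z. 1 / nden k i z)"
  proof (cases k)
    case Ti
    show ?thesis
      by (rule regular_cong[OF regular_mult[OF 1(1) regular_mult[OF 1(1) 1(1)]]])
        (simp add: Ti power3_eq_cube)
  next
    case Yi
    show ?thesis
      using 1(1) regular_cong[OF regular_mult[OF 1]] by (cases i) (simp_all add: Yi)
  qed (use 1 in simp)
  from regular_mult[OF regular_jpoly[OF 2] this] show ?thesis by simp
qed

lemma regular_nab: "regular f \<Longrightarrow> regular (nab k f)"
  using regular_add[OF regular_mult[OF regular_ncoef[of k Ti] regular_D[of f Ti]]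
      regular_add[OF regular_mult[OF regular_ncoef[of k Xi] regular_D[of f Xi]]
        regular_mult[OF regular_ncoef[of k Yi] regular_D[of f Yi]]]]
  unfolding nab_expand by blast

lemma regular_I2: "regular I2"
proof (rule regularI)
  show "(\<lambda>z. ((u_x z)^2 * u_xy z + u_x z * u_xx z * v_x z + u_xx z * u_yy z - (u_xy z)^2) * u_xx z ^ 4) \<in> jpoly"
    by (intro jpoly_intros)
  show "I2 z = ((u_x z)^2 * u_xy z + u_x z * u_xx z * v_x z + u_xx z * u_yy z - (u_xy z)^2) * u_xx z ^ 4 / (u_x z * u_xx z) ^ Suc 3"
    if "good z" for z
    using that by (simp add: I2_def good_def power_mult_distrib eval_nat_numeral)
qed

section \<open>Iterated derivatives of the generator\<close>

abbreviation iterates :: "(jet \<Rightarrow> real) set" where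
  "iterates \<equiv> iterated_derivatives {nabla1, nabla2, nabla3} I2"

lemma iterates_I2: "I2 \<in> iterates"
  unfolding iterated_derivatives_def by (rule CollectI, rule exI[of _ "[]"]) simp

lemma iterates_nab: "f \<in> iterates \<Longrightarrow> nab k f \<in> iterates"
proof -
  assume "f \<in> iterates"
  then obtain Ns where "f = foldr (\<lambda>N f. N f) Ns I2" "set Ns \<subseteq> {nabla1, nabla2, nabla3}"
    unfolding iterated_derivatives_def by blast
  moreover have "nab k \<in> {nabla1, nabla2, nabla3}" by (cases k) (auto simp: nab_eq)
  ultimately show ?thesis
    unfolding iterated_derivatives_def by (intro CollectI exI[of _ "nab k # Ns"]) simp
qed

lemma iterates_induct [consumes 1, case_names I2 nab]:
  assumes "f \<in> iterates" "P I2" "\<And>k f. f \<in> iterates \<Longrightarrow> P f \<Longrightarrow> P (nab k f)"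
  shows "P f"
proof -
  obtain Ns where Ns: "f = foldr (\<lambda>N f. N f) Ns I2" "set Ns \<subseteq> {nabla1, nabla2, nabla3}"
    using assms(1) unfolding iterated_derivatives_def by blast
  have "foldr (\<lambda>N f. N f) Ns I2 \<in> iterates \<and> P (foldr (\<lambda>N f. N f) Ns I2)"
    using Ns(2)
  proof (induction Ns)
    case (Cons N Ns)
    then obtain k where "N = nab k" using nab_eq by (auto dest: sym)
    then show ?case using Cons assms(3) iterates_nab by auto
  qed (simp add: assms(2) iterates_I2)
  then show ?thesis using Ns(1) by simp
qed

lemma regular_iterates: "f \<in> iterates \<Longrightarrow> regular f"
  by (induction rule: iterates_induct) (auto intro: regular_I2 regular_nab)

lemma invariant_iterates: "f \<in> iterates \<Longrightarrow> X \<in> sym_alg \<Longrightarrow> good z \<Longrightarrow> Lie (prolong X) f z = 0"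
proof (induction arbitrary: z rule: iterates_induct)
  case I2
  then show ?case by (auto simp: good_def elim!: sym_alg_symmetry intro: symmetry.prolong_I2)
next
  case (nab k f)
  obtain a b c d e where X: "symmetry a b c d e" "X = field a b c d e"
    using nab.prems(1) by (rule sym_alg_symmetry)
  \<comment> \<open>A function that vanishes at all good points is a fraction with numerator 0;
    hence its total derivatives vanish there too.\<close>
  have "Lie (prolong X) f z = (\<lambda>z. 0) z / (u_x z * u_xx z) ^ Suc 0" if "good z" for z
    using nab.IH nab.prems(1) that by simp
  then have "is_frac (Lie (prolong X) f) (\<lambda>z. 0) (\<lambda>z. (u_x z * u_xx z) ^ Suc 0)"
    unfolding is_frac_def using good_iff[of _ 0] by (auto intro!: alg_intros)
  from Lie_frac[OF this] have "D i (Lie (prolong X) f) z = 0" for i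
    using nab.prems good_iff[of z 0] by (simp add: D_def)
  then have "nab k (Lie (prolong X) f) z = 0" by (simp add: nab_def)
  moreover have "Lie (prolong X) (nab k f) z = nab k (Lie (prolong X) f) z"
    unfolding X(2) by (rule symmetry.prolong_nab[OF X(1) nab.prems(2) regular_frac_at[OF regular_iterates[OF nab.hyps] nab.prems(2)]])
  ultimately show ?case by simp
qed

section \<open>Moving the base point\<close>

text \<open>The flow of Galilean boosts acts on jets by replacing \<open>D\<^sub>t\<close> by \<open>D\<^sub>t - A D\<^sub>x - B D\<^sub>y\<close>.\<close>

definition boost_step :: "real \<Rightarrow> real \<Rightarrow> (mindex \<Rightarrow> real) \<Rightarrow> mindex \<Rightarrow> real" where
  "boost_step A B w \<sigma> = w (inc Ti \<sigma>) - A * w (inc Xi \<sigma>) - B * w (inc Yi \<sigma>)"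

definition boost :: "real \<Rightarrow> real \<Rightarrow> (mindex \<Rightarrow> real) \<Rightarrow> mindex \<Rightarrow> real" where
  "boost A B w = (\<lambda>(i, j, l). (boost_step A B ^^ i) w (0, j, l))"

lemma boost_step_shift: "(boost_step A B ^^ n) (\<lambda>\<sigma>. w (inc k \<sigma>)) \<sigma> = (boost_step A B ^^ n) w (inc k \<sigma>)"
  by (induction n arbitrary: \<sigma>) (simp_all add: boost_step_def inc_commute[of k])

lemma boost_step_linear:
  "(boost_step A B ^^ n) (\<lambda>\<sigma>. v \<sigma> - r * w \<sigma>) \<sigma> = (boost_step A B ^^ n) v \<sigma> - r * (boost_step A B ^^ n) w \<sigma>"
proof (induction n arbitrary: \<sigma>)
  case (Suc n)
  show ?case
    unfolding funpow.simps comp_def boost_step_def[of A B "(boost_step A B ^^ n) w" for w] Suc.IH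
    by (simp add: algebra_simps)
qed simp

lemma boost_inc_t:
  "boost A B w (inc Ti \<sigma>) = boost A B (\<lambda>\<sigma>. w (inc Ti \<sigma>)) \<sigma> - A * boost A B w (inc Xi \<sigma>) - B * boost A B w (inc Yi \<sigma>)"
proof (cases \<sigma>)
  case (fields i j l)
  have "boost A B w (inc Ti \<sigma>) = (boost_step A B ^^ i) (boost_step A B w) (0, j, l)"
    unfolding fields by (simp add: boost_def funpow_swap1)
  also have "boost_step A B w = (\<lambda>\<sigma>. (\<lambda>\<sigma>. w (inc Ti \<sigma>) - A * w (inc Xi \<sigma>)) \<sigma> - B * w (inc Yi \<sigma>))"
    by (simp add: boost_step_def fun_eq_iff)
  finally show ?thesis
    unfolding boost_step_linear unfolding fields by (simp add: boost_def boost_step_shift)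
qed

lemma boost_inc_x: "boost A B (\<lambda>\<sigma>. w (inc Xi \<sigma>)) \<sigma> = boost A B w (inc Xi \<sigma>)"
  and boost_inc_y: "boost A B (\<lambda>\<sigma>. w (inc Yi \<sigma>)) \<sigma> = boost A B w (inc Yi \<sigma>)"
  by (cases \<sigma>; simp add: boost_def boost_step_shift)+

text \<open>A step with the opposite velocity, applied to a boosted family, yields the boost of the
  t-shifted family, so iterating it recovers all t-derivatives.\<close>

lemma boost_inverse: "boost (- A) (- B) (boost A B w) = w"
proof
  have step: "boost_step (- A) (- B) (boost A B w) = boost A B (\<lambda>\<sigma>. w (inc Ti \<sigma>))" for w
    by (simp add: boost_step_def boost_inc_t fun_eq_iff)
  have "(boost_step (- A) (- B) ^^ i) (boost A B w) = boost A B (\<lambda>\<sigma>. w ((inc Ti ^^ i) \<sigma>))" for i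
    by (induction i) (simp_all add: step funpow_swap1)
  moreover have "(inc Ti ^^ i) (0, j, l) = (i, j, l)" for i j l
    by (induction i) auto
  ultimately show "boost (- A) (- B) (boost A B w) \<sigma> = w \<sigma>" for \<sigma>
    by (cases \<sigma>) (simp add: boost_def)
qed

lemma boost_0: "boost 0 0 w = w"
proof -
  have "(boost_step 0 0 ^^ i) w (0, j, l) = w (i, j, l)" for i j l
  proof -
    have "(boost_step 0 0 ^^ i) w = (\<lambda>\<sigma>. w ((inc Ti ^^ i) \<sigma>))"
      by (induction i) (simp_all add: boost_step_def fun_eq_iff funpow_swap1)
    moreover have "(inc Ti ^^ i) (0, j, l) = (i, j, l)" by (induction i) auto
    ultimately show ?thesis by simp
  qed
  then show ?thesis by (auto simp: boost_def fun_eq_iff)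
qed

text \<open>The index shifts commute, so the power of a step affine in \<open>s\<close> is
  differentiated like the power of a number.\<close>

lemma boost_step_derivative:
  "((\<lambda>s. (boost_step (s * A) (s * B) ^^ n) w \<sigma>) has_real_derivative
     - real n * (A * (boost_step (s * A) (s * B) ^^ (n - 1)) w (inc Xi \<sigma>)
       + B * (boost_step (s * A) (s * B) ^^ (n - 1)) w (inc Yi \<sigma>))) (at s)"
proof (induction n arbitrary: \<sigma>)
  case (Suc n)
  let ?S = "boost_step (s * A) (s * B)"
  show ?case
  proof (cases n)
    case 0
    then show ?thesis by (auto simp: boost_step_def intro!: derivative_eq_intros)
  next
    case (Suc m)
    have *: "(?S ^^ n) w \<sigma> = (?S ^^ m) w (inc Ti \<sigma>) - s * A * (?S ^^ m) w (inc Xi \<sigma>) - s * B * (?S ^^ m) w (inc Yi \<sigma>)" for \<sigma>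
      by (simp add: Suc boost_step_def[of "s * A" "s * B" "(?S ^^ m) w"])
    have n: "n - 1 = m" "real n = real m + 1" by (simp_all add: Suc)
    show ?thesis
      unfolding funpow.simps comp_def boost_step_def[of _ _ "(boost_step _ _ ^^ n) w"]
      by (rule derivative_eq_intros Suc.IH refl)+
        (simp only: * n inc_commute[of Xi Ti] inc_commute[of Yi Ti] inc_commute[of Yi Xi] diff_Suc_1 of_nat_Suc,
          simp add: algebra_simps)
  qed
qed simp

text \<open>Shrinks the base point to 0 while \<open>X1\<close> and \<open>X2\<close> with slopes
  \<open>A\<close> and \<open>B\<close> shift v and u. With \<open>A\<close> and \<open>B\<close>
  the negatives of v and u, the point of E reaches 0 at \<open>s = 1\<close>.\<close>

fun transport :: "real \<Rightarrow> real \<Rightarrow> real \<Rightarrow> jet \<Rightarrow> jet" where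
  "transport A B s z (Base i) = (1 - s) * z (Base i)"
| "transport A B s z (Jet \<alpha> \<sigma>) = boost (s * A) (s * B) (\<lambda>\<sigma>. z (Jet \<alpha> \<sigma>)) \<sigma>
     + (if \<sigma> = (0, 0, 0) then s * (if \<alpha> = Ud then B else A) else 0)"

lemma transport_inc_t:
  "transport A B s z (Jet \<alpha> (inc Ti \<sigma>)) = boost (s * A) (s * B) (\<lambda>\<sigma>. z (Jet \<alpha> (inc Ti \<sigma>))) \<sigma>
    - s * A * transport A B s z (Jet \<alpha> (inc Xi \<sigma>)) - s * B * transport A B s z (Jet \<alpha> (inc Yi \<sigma>))"
proof -
  have "inc k \<sigma> \<noteq> (0, 0, 0)" for k by (cases \<sigma>; cases k) auto
  then show ?thesis by (simp add: boost_inc_t)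
qed

lemma boost_step_jpoly:
  "(\<And>\<sigma>. (\<lambda>z. w z \<sigma>) \<in> jpoly) \<Longrightarrow> A \<in> jpoly \<Longrightarrow> B \<in> jpoly \<Longrightarrow> (\<lambda>z. (boost_step (A z) (B z) ^^ n) (w z) \<sigma>) \<in> jpoly"
proof (induction n arbitrary: \<sigma>)
  case (Suc n)
  then show ?case
    unfolding funpow.simps comp_def boost_step_def[of _ _ "(boost_step _ _ ^^ n) _"]
    by (intro jpoly_intros) blast+
qed simp

lemma transport_jet_jpoly:
  assumes "A \<in> jpoly" "B \<in> jpoly"
  shows "(\<lambda>z. transport (A z) (B z) s z (Jet \<alpha> \<sigma>)) \<in> jpoly"
proof -
  have "(\<lambda>z. boost (s * A z) (s * B z) (\<lambda>\<sigma>. z (Jet \<alpha> \<sigma>)) \<sigma>) \<in> jpoly"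
    unfolding boost_def by (cases \<sigma>, simp, intro boost_step_jpoly jpoly_intros assms)
  moreover have "(\<lambda>z. if \<sigma> = (0, 0, 0) then s * (if \<alpha> = Ud then B z else A z) else 0) \<in> jpoly"
    using assms by (cases "\<sigma> = (0, 0, 0)"; cases \<alpha>) (auto intro!: jpoly_intros)
  ultimately show ?thesis unfolding transport.simps by (rule jpoly_intros)
qed

lemma jpoly_subst:
  assumes "f \<in> jpoly" "\<And>\<alpha> \<sigma>. (\<lambda>z. g z (Jet \<alpha> \<sigma>)) \<in> jpoly"
  shows "(\<lambda>z. f (g z)) \<in> jpoly"
  using assms(1) by (induction rule: cpoly_induct) (auto intro: jpoly_intros assms(2))

lemma transport_jpoly: "f \<in> jpoly \<Longrightarrow> (\<lambda>z. f (transport A B s z)) \<in> jpoly"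
  by (erule jpoly_subst) (rule transport_jet_jpoly; intro jpoly_intros)

lemma D_boost:
  "D k (\<lambda>z. boost A B (\<lambda>\<sigma>. z (Jet \<alpha> \<sigma>)) \<sigma>) = (\<lambda>z. boost A B (\<lambda>\<sigma>. z (Jet \<alpha> (inc k \<sigma>))) \<sigma>)"
proof -
  have alg: "(\<lambda>z. (boost_step A B ^^ n) (\<lambda>\<sigma>. z (Jet \<alpha> \<sigma>)) \<sigma>) \<in> alg" for n \<sigma>
    by (intro jpoly_alg boost_step_jpoly[where A = "\<lambda>_. A" and B = "\<lambda>_. B"] jpoly_intros)
  have "D k (\<lambda>z. (boost_step A B ^^ n) (\<lambda>\<sigma>. z (Jet \<alpha> \<sigma>)) \<sigma>)
      = (\<lambda>z. (boost_step A B ^^ n) (\<lambda>\<sigma>. z (Jet \<alpha> (inc k \<sigma>))) \<sigma>)" for n \<sigma>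
  proof (induction n arbitrary: \<sigma>)
    case (Suc n)
    then show ?case by (simp add: boost_step_def[of _ _ "(boost_step A B ^^ n) _"] D_diff D_mult alg alg_intros)
  qed simp
  then show ?thesis unfolding boost_def by (cases \<sigma>) simp
qed

text \<open>A boost replaces the t-derivative by a combination of total derivatives. Base
  coordinates are rescaled by \<open>1 - s\<close>, which is incompatible with total derivatives;
  hence the restriction to \<open>jpoly\<close>.\<close>

lemma D_transport:
  assumes "f \<in> jpoly"
  shows "D k (\<lambda>z. f (transport A B s z)) = (\<lambda>z. D k f (transport A B s z)
    + (if k = Ti then s * A * D Xi f (transport A B s z) + s * B * D Yi f (transport A B s z) else 0))"
  using assms
proof (induction rule: cpoly_induct)
  case (jet \<alpha> \<sigma>)
  let ?c = "if \<sigma> = (0, 0, 0) then s * (if \<alpha> = Ud then B else A) else 0"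
  have alg: "(\<lambda>z. boost (s * A) (s * B) (\<lambda>\<sigma>. z (Jet \<alpha> \<sigma>)) \<sigma>) \<in> alg"
    unfolding boost_def
    by (cases \<sigma>, simp, intro jpoly_alg boost_step_jpoly[where A = "\<lambda>_. s * A" and B = "\<lambda>_. s * B"] jpoly_intros)
  have "D k (\<lambda>z. transport A B s z (Jet \<alpha> \<sigma>)) = D k (\<lambda>z. boost (s * A) (s * B) (\<lambda>\<sigma>. z (Jet \<alpha> \<sigma>)) \<sigma> + ?c)"
    by simp
  also have "\<dots> = (\<lambda>z. boost (s * A) (s * B) (\<lambda>\<sigma>. z (Jet \<alpha> (inc k \<sigma>))) \<sigma>)"
    by (subst D_add[OF alg]) (auto simp: D_boost intro: alg_intros)
  also have "\<dots> = (\<lambda>z. transport A B s z (Jet \<alpha> (inc k \<sigma>))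
      + (if k = Ti then s * A * transport A B s z (Jet \<alpha> (inc Xi \<sigma>)) + s * B * transport A B s z (Jet \<alpha> (inc Yi \<sigma>)) else 0))"
  proof (cases k)
    case Ti
    then show ?thesis by (simp only: transport_inc_t) simp
  next
    case Xi
    have "inc Xi \<sigma> \<noteq> (0, 0, 0)" by (cases \<sigma>) auto
    then show ?thesis by (simp add: Xi boost_inc_x[where w = "\<lambda>\<sigma>. z (Jet \<alpha> \<sigma>)" for z])
  next
    case Yi
    have "inc Yi \<sigma> \<noteq> (0, 0, 0)" by (cases \<sigma>) auto
    then show ?thesis by (simp add: Yi boost_inc_y[where w = "\<lambda>\<sigma>. z (Jet \<alpha> \<sigma>)" for z])
  qed
  finally show ?case by (simp only: D_jet)
next
  case (add f g)
  then show ?case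
    by (simp add: D_add jpoly_alg transport_jpoly fun_eq_iff algebra_simps)
next
  case (mult f g)
  then show ?case
    by (simp add: D_mult jpoly_alg transport_jpoly fun_eq_iff algebra_simps)
qed (auto simp: fun_eq_iff)

text \<open>Galilean invariance: the shifts of u and v in the convective terms cancel the change of
  the mixed derivatives in t and x.\<close>

lemma eqn_transport: "eqn \<alpha> (transport A B s z) = eqn \<alpha> z"
  unfolding eqn_eq
  by (cases \<alpha>) (simp_all add: boost_def boost_step_def algebra_simps flip: numeral_2_eq_2)

lemma transport_equation:
  assumes "z \<in> equation_inf"
  shows "transport A B s z \<in> equation_inf"
proof -
  have "D_multi \<sigma> (eqn \<alpha>) (transport A B s z) = 0" if "z \<in> equation_inf" for \<sigma> \<alpha> z
    using that
  proof (induction \<sigma> arbitrary: z rule: mindex_induct)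
    case zero
    then show ?case by (simp add: eqn_transport del: eqn.simps) (metis equation_inf_eqn D_multi_0)
  next
    case (inc i \<sigma>)
    define f where "f = D_multi \<sigma> (eqn \<alpha>)"
    have f: "f \<in> jpoly" unfolding f_def by (intro D_multi_jpoly eqn_jpoly)
    have 0: "D k (\<lambda>z. f (transport A B s z)) z = 0" for k
      by (rule D_vanish[OF jpoly_alg[OF transport_jpoly[OF f]]])
        (use inc in \<open>auto simp: f_def\<close>)
    \<comment> \<open>The directions x and y come first because the formula for t contains
      both.\<close>
    have "D Xi f (transport A B s z) = 0" "D Yi f (transport A B s z) = 0"
      using 0[of Xi] 0[of Yi] by (simp_all add: D_transport[OF f])
    moreover from this have "D Ti f (transport A B s z) = 0"
      using 0[of Ti] by (simp add: D_transport[OF f])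
    ultimately have "D i f (transport A B s z) = 0" by (cases i) auto
    then show ?case by (simp add: f_def D_multi_inc jpoly_alg[OF eqn_jpoly])
  qed
  then show ?thesis using assms by (simp add: equation_inf_eqn)
qed

subsection \<open>The velocity of the transport\<close>

lemma smooth_affine: "smooth (\<lambda>t::real. r * (t - t0) + r')"
  by (intro smooth_add smooth_mult smooth_const smooth_diff smooth_ident)

lemma deriv_affine: "deriv (\<lambda>t::real. r * (t - t0) + r') = (\<lambda>t. r)"
  by (rule ext, rule DERIV_imp_deriv) (auto intro!: derivative_eq_intros)

text \<open>The velocity of the transport at parameter \<open>s\<close>. The affine coefficients are
  centred at the current time \<open>(1 - s) * z (Base Ti)\<close>, so that there they have the
  value of the base velocity and the slopes \<open>A\<close> and \<open>B\<close>.\<close>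

definition transport_field :: "real \<Rightarrow> real \<Rightarrow> jet \<Rightarrow> real \<Rightarrow> point \<Rightarrow> point" where
  "transport_field A B z s = field
     (\<lambda>t. A * (t - (1 - s) * z (Base Ti)) + (- z (Base Xi)))
     (\<lambda>t. B * (t - (1 - s) * z (Base Ti)) + (- z (Base Yi)))
     (\<lambda>t. 0) (\<lambda>t. - z (Base Ti)) (\<lambda>t. 0)"

lemma transport_symmetry:
  "symmetry (\<lambda>t. A * (t - (1 - s) * z (Base Ti)) + (- z (Base Xi)))
     (\<lambda>t. B * (t - (1 - s) * z (Base Ti)) + (- z (Base Yi))) (\<lambda>t. 0) (\<lambda>t. - z (Base Ti)) (\<lambda>t. 0)"
  by unfold_locales (intro smooth_affine smooth_const)+

lemma transport_field_sym_alg: "transport_field A B z s \<in> sym_alg"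
  unfolding transport_field_def by (intro field_sym_alg smooth_affine smooth_const)

lemma prolong_transport_field_Jet:
  "prolong (transport_field A B z s) z' (Jet \<alpha> (i, j, l)) =
     - real i * (A * z' (Jet \<alpha> (i - 1, Suc j, l)) + B * z' (Jet \<alpha> (i - 1, j, Suc l)))
     + (if (i, j, l) = (0, 0, 0) then if \<alpha> = Ud then B else A else 0)"
proof -
  let ?X = "transport_field A B z s"
  interpret symmetry "\<lambda>t. A * (t - (1 - s) * z (Base Ti)) + (- z (Base Xi))"
    "\<lambda>t. B * (t - (1 - s) * z (Base Ti)) + (- z (Base Yi))" "\<lambda>t. 0" "\<lambda>t. - z (Base Ti)" "\<lambda>t. 0"
    by (rule transport_symmetry)
  have tm0: "tm (\<lambda>t. r) = (\<lambda>z. r)" for r by (simp add: tm_def fun_eq_iff)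
  have D0: "D Ti (\<lambda>z. base_comp Ti (?X (pt z))) = (\<lambda>z. 0)" "D Ti (\<lambda>z. base_comp Xi (?X (pt z))) = (\<lambda>z. A)"
    "D Ti (\<lambda>z. base_comp Yi (?X (pt z))) = (\<lambda>z. B)"
    "D Xi (\<lambda>z. base_comp Ti (?X (pt z))) = (\<lambda>z. 0)" "D Xi (\<lambda>z. base_comp Xi (?X (pt z))) = (\<lambda>z. 0)"
    "D Xi (\<lambda>z. base_comp Yi (?X (pt z))) = (\<lambda>z. 0)"
    "D Yi (\<lambda>z. base_comp Ti (?X (pt z))) = (\<lambda>z. 0)" "D Yi (\<lambda>z. base_comp Xi (?X (pt z))) = (\<lambda>z. 0)"
    "D Yi (\<lambda>z. base_comp Yi (?X (pt z))) = (\<lambda>z. 0)"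
    unfolding transport_field_def D_base_comp deriv_affine deriv_const tm0 by simp_all
  have rec: "prolong ?X z' (Jet \<alpha> (inc i \<sigma>)) = D i (\<lambda>z. prolong ?X z (Jet \<alpha> \<sigma>)) z'
    - (\<Sum>j\<in>{Ti, Xi, Yi}. D i (\<lambda>z. base_comp j (?X (pt z))) z' * z' (Jet \<alpha> (inc j \<sigma>)))" for z' i \<sigma>
    unfolding transport_field_def by (rule prolong_inc[OF smooth_field])
  define \<phi> where "\<phi> = (if \<alpha> = Ud then B else A)"
  define R where "R \<sigma> z' = (case \<sigma> of (i, j, l) \<Rightarrow>
     - real i * (A * z' (Jet \<alpha> (i - 1, Suc j, l)) + B * z' (Jet \<alpha> (i - 1, j, Suc l)))
     + (if (i, j, l) = (0, 0, 0) then \<phi> else 0))" for \<sigma> z'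
  have DR: "D k (R (i, j, l)) z' = - real i * (A * z' (Jet \<alpha> (inc k (i - 1, Suc j, l))) + B * z' (Jet \<alpha> (inc k (i - 1, j, Suc l))))"
    for k i j l z'
    unfolding R_def by (simp add: D_simps alg_intros)
  have "prolong ?X z' (Jet \<alpha> \<sigma>) = R \<sigma> z'" for \<sigma> z'
  proof (induction \<sigma> arbitrary: z' rule: mindex_induct)
    case zero
    have "fibre_comp \<alpha> (?X (pt z')) = \<phi>"
      unfolding transport_field_def \<phi>_def
      by (cases \<alpha>; simp only: fibre_comp_field deriv_affine deriv_const tm0; simp)
    then show ?case by (simp add: R_def)
  next
    case (inc i \<sigma>)
    obtain a b c where \<sigma>: "\<sigma> = (a, b, c)" by (cases \<sigma>)
    have "(\<lambda>z. prolong ?X z (Jet \<alpha> \<sigma>)) = R (a, b, c)" using inc.IH by (auto simp: \<sigma>)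
    then show ?case
      unfolding rec
      by (cases i; cases a) (simp_all add: DR D0 \<sigma> R_def algebra_simps)
  qed
  then show ?thesis by (simp add: R_def \<phi>_def)
qed

text \<open>Makes every orbit an integral curve of a family of symmetries depending on
  \<open>s\<close>, which is what constancy of invariants requires.\<close>

lemma transport_derivative:
  "((\<lambda>s. transport A B s z c) has_real_derivative prolong (transport_field A B z s) (transport A B s z) c) (at s)"
proof (cases c)
  case (Base i)
  have "prolong (transport_field A B z s) (transport A B s z) (Base i) = - z (Base i)"
    by (cases i) (simp_all add: transport_field_def field_def X1_def X2_def X3_def X4_def X5_def pt_def)
  then show ?thesis using Base by (auto intro!: derivative_eq_intros)
next
  case (Jet \<alpha> \<sigma>)
  obtain i j l where \<sigma>: "\<sigma> = (i, j, l)" by (cases \<sigma>)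
  have "((\<lambda>s. transport A B s z (Jet \<alpha> (i, j, l))) has_real_derivative
    - real i * (A * (boost_step (s * A) (s * B) ^^ (i - 1)) (\<lambda>\<sigma>. z (Jet \<alpha> \<sigma>)) (0, Suc j, l)
       + B * (boost_step (s * A) (s * B) ^^ (i - 1)) (\<lambda>\<sigma>. z (Jet \<alpha> \<sigma>)) (0, j, Suc l))
    + (if (i, j, l) = (0, 0, 0) then if \<alpha> = Ud then B else A else 0)) (at s)"
    using boost_step_derivative[where A = A and B = B and n = i and w = "\<lambda>\<sigma>. z (Jet \<alpha> \<sigma>)" and \<sigma> = "(0, j, l)" and s = s]
    by (auto simp: boost_def intro!: derivative_eq_intros)
  then show ?thesis
    unfolding Jet \<sigma> prolong_transport_field_Jet by (simp add: boost_def)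
qed

section \<open>Continuity and polynomial dependence of transported lines\<close>

lemma alg_continuous:
  assumes "f \<in> fpoly C" "\<And>c. continuous_on S (\<lambda>x. g x c)"
  shows "continuous_on S (\<lambda>x. f (g x))"
  using assms(1)
proof (induction rule: fpoly_induct)
  case (pt h)
  have "continuous_on UNIV h"
    using smooth_differentiable[OF pt] by (simp add: differentiable_imp_continuous_on differentiable_on_def)
  moreover have "continuous_on S (\<lambda>x. pt (g x))"
    unfolding pt_def by (intro continuous_intros assms(2))
  ultimately show ?case by (metis continuous_on_compose2 subset_UNIV)
qed (auto intro: continuous_intros assms(2))

lemma boost_step_continuous:
  assumes "continuous_on S A" "continuous_on S B" "\<And>\<sigma>. continuous_on S (\<lambda>x. w x \<sigma>)"
  shows "continuous_on S (\<lambda>x. (boost_step (A x) (B x) ^^ n) (w x) \<sigma>)"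
proof (induction n arbitrary: \<sigma>)
  case (Suc n)
  then show ?case
    unfolding funpow.simps comp_def boost_step_def[of _ _ "(boost_step _ _ ^^ n) _"]
    by (intro continuous_intros assms(1,2)) blast+
qed (simp add: assms(3))

lemma line_continuous: "continuous_on S (\<lambda>x. line z0 z1 x c)"
proof (cases c)
  case (Jet \<alpha> \<sigma>)
  then show ?thesis using polyfun_continuous[OF line_polyfun] by (cases \<sigma>) blast
qed (auto simp: line_def intro!: continuous_intros)

lemma transport_continuous:
  "continuous_on S (\<lambda>x. transport A B (fst x) (line z0 z1 (snd x)) c)"
proof -
  have l: "continuous_on S (\<lambda>x. line z0 z1 (snd x) c)" for c
    by (rule continuous_on_compose2[OF line_continuous[of UNIV] continuous_on_snd]) (auto intro: continuous_intros)
  show ?thesis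
  proof (cases c)
    case (Base i)
    then show ?thesis by (auto intro!: continuous_intros l)
  next
    case (Jet \<alpha> \<sigma>)
    have "continuous_on S (\<lambda>x. boost (fst x * A) (fst x * B) (\<lambda>\<sigma>. line z0 z1 (snd x) (Jet \<alpha> \<sigma>)) \<sigma>)"
      unfolding boost_def by (cases \<sigma>, simp, intro boost_step_continuous continuous_intros l)
    moreover have "continuous_on S (\<lambda>x. if \<sigma> = (0, 0, 0) then fst x * (if \<alpha> = Ud then B else A) else 0)"
      by (cases "\<sigma> = (0, 0, 0)") (auto intro!: continuous_intros)
    ultimately show ?thesis unfolding Jet transport.simps by (rule continuous_on_add)
  qed
qed

lemma pt_transport: "pt (transport A B s z) =
    ((1 - s) * z (Base Ti), (1 - s) * z (Base Xi), (1 - s) * z (Base Yi), u_0 z + s * B, v_0 z + s * A)"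
  by (simp add: pt_def boost_def)

lemma alg_polyfun:
  assumes "f \<in> alg" "\<And>s. pt (g s) = p" "\<And>\<alpha> \<sigma>. polyfun (\<lambda>s. g s (Jet \<alpha> \<sigma>))"
  shows "polyfun (\<lambda>s. f (g s))"
  using assms(1)
  by (induction rule: fpoly_induct) (auto intro: polyfun_const polyfun_add polyfun_mult assms(3) simp: assms(2))

lemma transport_line_polyfun:
  assumes "f \<in> alg" "pt z0 = pt z1"
  shows "polyfun (\<lambda>r. f (transport A B s (line z0 z1 r)))"
proof (rule alg_polyfun[OF assms(1), of _ "pt (transport A B s z0)"])
  show "pt (transport A B s (line z0 z1 r)) = pt (transport A B s z0)" for r
    using pt_line[OF assms(2), of r] unfolding pt_transport by (simp add: pt_def)
  show "polyfun (\<lambda>r. transport A B s (line z0 z1 r) (Jet \<alpha> \<sigma>))" for \<alpha> \<sigma>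
    using jpoly_line[OF transport_jpoly[OF jpoly_jet]] .
qed

text \<open>The equation does not contain t, x, y explicitly, so a point of it can be placed over
  any base point with its jet coordinates unchanged.\<close>

definition rebase :: "point \<Rightarrow> jet \<Rightarrow> jet" where
  "rebase p z c = (case c of Base i \<Rightarrow> base_comp i p | Jet \<alpha> \<sigma> \<Rightarrow> z (Jet \<alpha> \<sigma>))"

lemma rebase_simps [simp]: "rebase p z (Base i) = base_comp i p" "rebase p z (Jet \<alpha> \<sigma>) = z (Jet \<alpha> \<sigma>)"
  by (simp_all add: rebase_def)

lemma jpoly_rebase: "f \<in> jpoly \<Longrightarrow> f (rebase p z) = f z"
  by (erule cpoly_cong) simp

lemma rebase_equation: "z \<in> equation_inf \<Longrightarrow> rebase p z \<in> equation_inf"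
  unfolding equation_inf_eqn using jpoly_rebase[OF D_multi_jpoly[OF eqn_jpoly]] by metis

text \<open>A boost step evaluates only at incremented indices, which are never zero, so the shift
  of u or v itself passes through unchanged.\<close>

lemma boost_add_delta:
  "boost A B (\<lambda>\<sigma>. w \<sigma> + (if \<sigma> = (0, 0, 0) then r else 0)) \<sigma> = boost A B w \<sigma> + (if \<sigma> = (0, 0, 0) then r else 0)"
proof (cases \<sigma>)
  case (fields i j l)
  let ?\<delta> = "\<lambda>\<sigma> :: mindex. if \<sigma> = (0, 0, 0) then 1 else 0 :: real"
  have 1: "(\<lambda>\<sigma>. w \<sigma> + (if \<sigma> = (0, 0, 0) then r else 0)) = (\<lambda>\<sigma>. w \<sigma> - (- r) * ?\<delta> \<sigma>)" by auto
  have 2: "(boost_step A B ^^ n) ?\<delta> (0, j, l) = (if (n, j, l) = (0, 0, 0) then 1 else 0)" for n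
  proof (cases n)
    case (Suc m)
    have "inc k \<sigma> \<noteq> (0, 0, 0)" for k \<sigma> by (cases \<sigma>; cases k) auto
    then have "boost_step A B ?\<delta> = (\<lambda>_. 0)" unfolding boost_step_def by (simp add: fun_eq_iff)
    moreover have "(boost_step A B ^^ m) (\<lambda>_. 0) \<sigma> = 0" for \<sigma>
      by (induction m arbitrary: \<sigma>) (simp_all add: boost_step_def)
    ultimately show ?thesis using Suc by (simp add: funpow_swap1)
  qed simp
  show ?thesis
    unfolding fields 1 boost_def case_prod_conv boost_step_linear 2 by simp
qed

text \<open>The opposite boost recovers the jet coordinates. The base coordinates are lost at
  \<open>s = 1\<close> and are restored by \<open>rebase\<close>.\<close>

lemma transport_surj:
  assumes "z' \<in> equation_inf" "pt z' = pt (transport (- v_0 z0) (- u_0 z0) s z0)"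
  shows "\<exists>z\<in>equation_inf. pt z = pt z0 \<and> transport (- v_0 z0) (- u_0 z0) s z = z'"
proof -
  define A B where "A = - v_0 z0" and "B = - u_0 z0"
  define z where "z = rebase (pt z0) (transport (- A) (- B) s z')"
  have z': "z' (Base i) = (1 - s) * z0 (Base i)" "u_0 z' = u_0 z0 + s * B" "v_0 z' = v_0 z0 + s * A" for i
    using assms(2) unfolding pt_transport A_def[symmetric] B_def[symmetric]
    by (auto simp: pt_def) (cases i; auto)
  have "z \<in> equation_inf" unfolding z_def by (intro rebase_equation transport_equation assms(1))
  moreover have "pt z = pt z0"
    unfolding z_def by (simp add: pt_def boost_def z')
  moreover have "transport A B s z c = z' c" for c
  proof (cases c)
    case (Base i)
    then show ?thesis by (simp add: z_def z')
  next
    case (Jet \<alpha> \<sigma>)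
    let ?r = "s * (if \<alpha> = Ud then B else A)"
    have r: "s * (if \<alpha> = Ud then - B else - A) = - ?r" by simp
    have "(\<lambda>\<sigma>. z (Jet \<alpha> \<sigma>)) = (\<lambda>\<sigma>. boost (- (s * A)) (- (s * B)) (\<lambda>\<sigma>. z' (Jet \<alpha> \<sigma>)) \<sigma> + (if \<sigma> = (0, 0, 0) then - ?r else 0))"
      unfolding z_def rebase_simps transport.simps r by simp
    then have "transport A B s z (Jet \<alpha> \<sigma>) = boost (s * A) (s * B) (boost (- (s * A)) (- (s * B)) (\<lambda>\<sigma>. z' (Jet \<alpha> \<sigma>))) \<sigma>"
      unfolding transport.simps by (simp only: boost_add_delta) auto
    also have "\<dots> = z' (Jet \<alpha> \<sigma>)"
      using boost_inverse[of "- (s * A)" "- (s * B)" "\<lambda>\<sigma>. z' (Jet \<alpha> \<sigma>)"] by simp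
    finally show ?thesis using Jet by simp
  qed
  ultimately show ?thesis unfolding A_def B_def by blast
qed

lemma transport_0: "transport A B 0 z = z"
proof
  show "transport A B 0 z c = z c" for c by (cases c) (simp_all add: boost_0)
qed

section \<open>Invariants along the transport\<close>

context
  fixes P Q :: "jet \<Rightarrow> real" and z0 :: jet
  assumes P: "P \<in> alg" and Q: "Q \<in> alg"
    and nonzero: "\<And>p. \<exists>z\<in>equation_inf. pt z = p \<and> Q z \<noteq> 0"
    and invariant: "\<And>X z. X \<in> sym_alg \<Longrightarrow> z \<in> equation_inf \<Longrightarrow> Q z \<noteq> 0 \<Longrightarrow> Lie (prolong X) (\<lambda>z. P z / Q z) z = 0"
begin

abbreviation T :: "real \<Rightarrow> jet \<Rightarrow> jet" where "T s \<equiv> transport (- v_0 z0) (- u_0 z0) s"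

lemma quotient_constant:
  assumes z: "z \<in> equation_inf" and ab: "a \<le> b" "\<And>s. a \<le> s \<Longrightarrow> s \<le> b \<Longrightarrow> Q (T s z) \<noteq> 0"
  shows "P (T a z) / Q (T a z) = P (T b z) / Q (T b z)"
proof (cases "a = b")
  case False
  have "((\<lambda>s. P (T s z) / Q (T s z)) has_real_derivative 0) (at s)" if s: "a \<le> s" "s \<le> b" for s
  proof -
    let ?X = "transport_field (- v_0 z0) (- u_0 z0) z s"
    have L: "Lie (\<lambda>_. prolong ?X (T s z)) f (T s z) = Lie (prolong ?X) f (T s z)" for f by (simp add: Lie_def)
    note d = curve_differentiableD[OF alg_curve_differentiable, of _ _ "\<lambda>s. T s z" "prolong ?X (T s z)" s,
        OF _ transport_derivative, unfolded L]
    have nz: "Q (T s z) \<noteq> 0" by (rule ab(2)[OF s])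
    have "is_frac (\<lambda>z. P z / Q z) P Q" by (simp add: is_frac_def P Q)
    from Lie_frac[OF this nz, of "prolong ?X"] invariant[OF transport_field_sym_alg transport_equation[OF z] nz]
    have "(Lie (prolong ?X) P (T s z) * Q (T s z) - P (T s z) * Lie (prolong ?X) Q (T s z)) / (Q (T s z))\<^sup>2 = 0"
      by metis
    then have "Lie (prolong ?X) P (T s z) * Q (T s z) - P (T s z) * Lie (prolong ?X) Q (T s z) = 0"
      using nz by simp
    then show ?thesis
      using DERIV_divide[OF d[OF P] d[OF Q] nz] by (simp only: div_0)
  qed
  moreover from this have "continuous_on {a..b} (\<lambda>s. P (T s z) / Q (T s z))"
    by (intro continuous_at_imp_continuous_on ballI DERIV_isCont) auto
  ultimately have "P (T b z) / Q (T b z) = P (T a z) / Q (T a z)"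
    using False ab(1) by (intro DERIV_isconst2[of a b "\<lambda>s. P (T s z) / Q (T s z)"]) auto
  then show ?thesis by simp
qed simp

text \<open>\<open>Q\<close> may vanish on the orbit of \<open>z\<close>. It does not on the orbit
  of \<open>z1\<close>, nor on those of nearby points of the line from \<open>z1\<close> to
  \<open>z\<close>; there the quotient is constant. The cross-multiplied relation is polynomial
  along the line and therefore reaches \<open>z\<close>.\<close>

lemma transport_segment:
  assumes z: "z \<in> equation_inf" "pt z = pt z0" and z1: "z1 \<in> equation_inf" "pt z1 = pt z0"
    and ab: "a \<le> b" "\<And>s. a \<le> s \<Longrightarrow> s \<le> b \<Longrightarrow> Q (T s z1) \<noteq> 0"
  shows "P (T a z) * Q (T b z) = P (T b z) * Q (T a z)"
proof -
  have pt: "pt z1 = pt z" using z z1 by simp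
  define q where "q = (\<lambda>x. Q (T (fst x) (line z1 z (snd x))))"
  \<comment> \<open>The zeros of \<open>Q\<close> over the time interval and the line parameter. By
    compactness the excluded parameters form a closed set, so a whole neighbourhood of 0 avoids
    it.\<close>
  define K where "K = {x \<in> {a..b} \<times> {-1..1}. q x = 0}"
  have "continuous_on ({a..b} \<times> {-1..1}) q"
    unfolding q_def by (rule alg_continuous[OF Q transport_continuous])
  then have "closed K"
    unfolding K_def by (intro continuous_closed_preimage_constant closed_Times) auto
  moreover have "K = K \<inter> ({a..b} \<times> {-1..1})" by (auto simp: K_def)
  ultimately have "compact K"
    by (metis closed_Int_compact compact_Icc compact_Times)
  then have "closed (snd ` K)"
    by (intro compact_imp_closed compact_continuous_image continuous_intros)
  moreover have "0 \<notin> snd ` K"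
    using ab(2) by (auto simp: K_def q_def line_ends[OF z1(1)])
  ultimately obtain \<epsilon> where \<epsilon>: "\<epsilon> > 0" "ball 0 \<epsilon> \<subseteq> - (snd ` K)"
    by (metis ComplI open_Compl open_contains_ball)
  define f where "f = (\<lambda>r. P (T a (line z1 z r)) * Q (T b (line z1 z r)) - P (T b (line z1 z r)) * Q (T a (line z1 z r)))"
  have f: "polyfun f"
    unfolding f_def by (intro polyfun_diff polyfun_mult transport_line_polyfun P Q pt)
  have "f r = 0" if r: "0 < r" "r < min \<epsilon> 1" for r
  proof -
    have "r \<notin> snd ` K" using \<epsilon>(2) r by (auto simp: subset_iff dist_real_def)
    then have nz: "Q (T s (line z1 z r)) \<noteq> 0" if "a \<le> s" "s \<le> b" for s
      using that r by (force simp: K_def q_def image_iff)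
    have "P (T a (line z1 z r)) / Q (T a (line z1 z r)) = P (T b (line z1 z r)) / Q (T b (line z1 z r))"
      by (rule quotient_constant[OF line_equation ab(1) nz])
    then show ?thesis using nz[of a] nz[of b] ab(1) by (simp add: f_def field_simps)
  qed
  then have "{0<..<min \<epsilon> 1} \<subseteq> {r. f r = 0}" by auto
  moreover have "infinite {0<..<min \<epsilon> 1}" by (rule infinite_Ioo) (use \<epsilon>(1) in simp)
  ultimately have "infinite {r. f r = 0}" by (rule infinite_super)
  then have "f 1 = 0" using polyfun_finite_zeros[OF f] by blast
  then show ?thesis by (simp add: f_def line_ends[OF z(1)])
qed

text \<open>Bisection of the time interval: short intervals are covered by
  \<open>transport_segment\<close>, with an auxiliary point that depends on the time, and adjacent
  intervals are joined by cancelling \<open>Q\<close> at the common time along a line in the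
  fibre.\<close>

lemma transport_relation:
  assumes "z0 \<in> equation_inf"
  shows "P z0 * Q (T 1 z0) = P (T 1 z0) * Q z0"
proof -
  define rel where "rel a b \<longleftrightarrow> (\<forall>z\<in>equation_inf. pt z = pt z0 \<longrightarrow> P (T a z) * Q (T b z) = P (T b z) * Q (T a z))" for a b
  have ex: "\<exists>z\<in>equation_inf. pt z = pt z0 \<and> Q (T s z) \<noteq> 0" for s
  proof -
    obtain z' where z': "z' \<in> equation_inf" "pt z' = pt (T s z0)" "Q z' \<noteq> 0" using nonzero by blast
    from transport_surj[OF z'(1,2)] z'(3) show ?thesis by auto
  qed
  have "rel 0 1"
  proof (rule Bolzano[where P = rel])
    fix a b c assume *: "rel a b" "rel b c"
    show "rel a c" unfolding rel_def
    proof (intro ballI impI)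
      fix z assume z: "z \<in> equation_inf" "pt z = pt z0"
      obtain z1 where z1: "z1 \<in> equation_inf" "pt z1 = pt z0" "Q (T b z1) \<noteq> 0" using ex by blast
      have pt: "pt z = pt z1" using z z1 by simp
      let ?f = "\<lambda>z. P (T a z) * Q (T c z) - P (T c z) * Q (T a z)"
      show "P (T a z) * Q (T c z) = P (T c z) * Q (T a z)"
      proof (rule ccontr)
        assume "\<not> ?thesis"
        then have "?f z \<noteq> 0" by simp
        moreover have "polyfun (\<lambda>r. ?f (line z z1 r))" "polyfun (\<lambda>r. Q (T b (line z z1 r)))"
          by (intro polyfun_diff polyfun_mult transport_line_polyfun P Q pt)+
        ultimately obtain r where r: "?f (line z z1 r) * Q (T b (line z z1 r)) \<noteq> 0"
          using nonzero_product[of ?f z z1 "\<lambda>z. Q (T b z)"] z z1 by blast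
        define l where "l = line z z1 r"
        have "l \<in> equation_inf" "pt l = pt z0" using line_equation pt_line[OF pt] z by (auto simp: l_def)
        then have "P (T a l) * Q (T b l) = P (T b l) * Q (T a l)" "P (T b l) * Q (T c l) = P (T c l) * Q (T b l)"
          using * unfolding rel_def by auto
        then have "?f l * Q (T b l) = 0" by algebra
        then show False using r by (simp add: l_def)
      qed
    qed
  next
    fix s :: real
    obtain z1 where z1: "z1 \<in> equation_inf" "pt z1 = pt z0" "Q (T s z1) \<noteq> 0" using ex by blast
    have "isCont (\<lambda>s. Q (T s z1)) s"
      by (rule DERIV_isCont[OF curve_differentiableD[OF alg_curve_differentiable[OF Q] transport_derivative]])
    then obtain d where d: "d > 0" "\<And>r. dist s r < d \<Longrightarrow> Q (T r z1) \<noteq> 0"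
      using continuous_at_avoid[of s "\<lambda>s. Q (T s z1)" 0] z1(3) by auto
    show "\<exists>d>0. \<forall>a b. a \<le> s \<and> s \<le> b \<and> b - a < d \<longrightarrow> rel a b"
    proof (intro exI conjI allI impI)
      fix a b assume "a \<le> s \<and> s \<le> b \<and> b - a < d"
      then show "rel a b"
        unfolding rel_def using z1
        by (intro ballI impI transport_segment[where ?z1.0 = z1]) (auto intro!: d(2) simp: dist_real_def)
    qed (rule d(1))
  qed simp
  then show ?thesis using assms by (auto simp: rel_def transport_0)
qed

end

section \<open>Restriction to the fibre over the origin of E\<close>

definition to_origin :: "jet \<Rightarrow> jet" where
  "to_origin z = transport (- v_0 z) (- u_0 z) 1 z"

lemma pt_to_origin: "pt (to_origin z) = 0"
  by (simp add: to_origin_def pt_transport zero_prod_def)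

lemma to_origin_surj:
  assumes "z' \<in> equation_inf" "pt z' = 0"
  shows "\<exists>z\<in>equation_inf. pt z = p \<and> to_origin z = z'"
proof -
  obtain z0 where z0: "z0 \<in> equation_inf" "pt z0 = p" using exists_good by blast
  have "pt z' = pt (transport (- v_0 z0) (- u_0 z0) 1 z0)"
    using assms(2) by (simp add: pt_transport zero_prod_def)
  from transport_surj[OF assms(1) this] obtain z where
    "z \<in> equation_inf" "pt z = pt z0" "transport (- v_0 z0) (- u_0 z0) 1 z = z'" by blast
  moreover from this(2) have "u_0 z = u_0 z0" "v_0 z = v_0 z0" by (auto simp: pt_def)
  ultimately show ?thesis using z0 by (auto simp: to_origin_def)
qed

lemma alg_subst_jpoly:
  assumes "f \<in> alg" "\<And>z. pt (g z) = p" "\<And>\<alpha> \<sigma>. (\<lambda>z. g z (Jet \<alpha> \<sigma>)) \<in> jpoly"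
  shows "(\<lambda>z. f (g z)) \<in> jpoly"
  using assms(1) by (induction rule: fpoly_induct) (auto intro: jpoly_intros assms(3) simp: assms(2))

text \<open>All values lie over one point of E, so smooth coefficients become constants;
  \<open>A\<close> and \<open>B\<close> are themselves jet coordinates up to sign.\<close>

lemma to_origin_jpoly: "f \<in> alg \<Longrightarrow> (\<lambda>z. f (to_origin z)) \<in> jpoly"
  by (erule alg_subst_jpoly[OF _ pt_to_origin])
    (unfold to_origin_def, rule transport_jet_jpoly; intro jpoly_intros)

lemma to_origin_equation: "z \<in> equation_inf \<Longrightarrow> to_origin z \<in> equation_inf"
  by (simp add: to_origin_def transport_equation)

lemma invariant_to_origin:
  assumes "P \<in> alg" "Q \<in> alg" "\<And>p. \<exists>z\<in>equation_inf. pt z = p \<and> Q z \<noteq> 0"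
    "\<And>X z. X \<in> sym_alg \<Longrightarrow> z \<in> equation_inf \<Longrightarrow> Q z \<noteq> 0 \<Longrightarrow> Lie (prolong X) (\<lambda>z. P z / Q z) z = 0"
    "z \<in> equation_inf"
  shows "P z * Q (to_origin z) = P (to_origin z) * Q z"
  unfolding to_origin_def using transport_relation[of P Q z] assms by blast

text \<open>The transport to the origin and back carries a nonzero value of an invariant into any
  prescribed fibre. This bridges nonvanishing somewhere on the equation and nonvanishing on each
  fibre.\<close>

lemma invariant_nonzero_on_fibres:
  assumes P: "P \<in> jpoly" "z1 \<in> equation_inf" "P z1 \<noteq> 0"
    and inv: "\<And>X z. X \<in> sym_alg \<Longrightarrow> good z \<Longrightarrow> Lie (prolong X) (\<lambda>z. P z / (u_x z * u_xx z) ^ Suc n) z = 0"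
  shows "\<exists>z\<in>equation_inf. pt z = p \<and> P z \<noteq> 0"
proof -
  let ?Q = "\<lambda>z. (u_x z * u_xx z) ^ Suc n"
  have Q: "?Q \<in> jpoly" by (intro jpoly_intros)
  have rel: "P z * ?Q (to_origin z) = P (to_origin z) * ?Q z" if "z \<in> equation_inf" for z
  proof (rule invariant_to_origin[OF jpoly_alg[OF P(1)] jpoly_alg[OF Q] _ _ that])
    show "\<exists>z\<in>equation_inf. pt z = p \<and> ?Q z \<noteq> 0" for p
      using exists_good[of p] by fastforce
    show "Lie (prolong X) (\<lambda>z. P z / ?Q z) z = 0" if "X \<in> sym_alg" "?Q z \<noteq> 0" for X z
      by (rule inv) (use that good_iff[of z n] in blast)+
  qed
  \<comment> \<open>Boosts alter only coordinates with t-derivatives, and the shift only u and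
    v.\<close>
  have same: "?Q (to_origin z) = ?Q z" for z
    by (simp add: to_origin_def boost_def)
  obtain z2 where z2: "z2 \<in> equation_inf" "u_x z2 = 1" "u_xx z2 = 1" using exists_good by blast
  have "?Q z2 \<noteq> 0" using z2 by simp
  from nonzero_product[OF jpoly_line[OF P(1)] jpoly_line[OF Q] P(2) z2(1) P(3) this]
  obtain z3 where z3: "z3 \<in> equation_inf" "P z3 \<noteq> 0" "?Q z3 \<noteq> 0" using line_equation by force
  obtain z where z: "z \<in> equation_inf" "pt z = p" "to_origin z = to_origin z3"
    using to_origin_surj[OF to_origin_equation[OF z3(1)] pt_to_origin] by blast
  have "?Q z = ?Q z3" using same[of z] same[of z3] z(3) by simp
  then have "P z * ?Q z3 = P (to_origin z3) * ?Q z3" "P z3 * ?Q z3 = P (to_origin z3) * ?Q z3"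
    using rel[OF z(1)] rel[OF z3(1)] unfolding z(3) same[of z3] by (simp_all only:)
  then have "P z * ?Q z3 = P z3 * ?Q z3" by (simp only:)
  then show ?thesis using z z3 by auto
qed

section \<open>Rational functions on the equation\<close>

definition nonzero_poly :: "(jet \<Rightarrow> real) \<Rightarrow> bool" where
  "nonzero_poly R \<longleftrightarrow> R \<in> jpoly \<and> (\<exists>z\<in>equation_inf. R z \<noteq> 0)"

text \<open>In contrast to \<open>generically\<close>, the exceptional set may contain entire fibres over \<open>E\<close>.\<close>

definition weakly :: "(jet \<Rightarrow> bool) \<Rightarrow> bool" where
  "weakly \<Phi> \<longleftrightarrow> (\<exists>R. nonzero_poly R \<and> (\<forall>z\<in>equation_inf. R z \<noteq> 0 \<longrightarrow> \<Phi> z))"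

definition ratl :: "(jet \<Rightarrow> real) \<Rightarrow> bool" where
  "ratl f \<longleftrightarrow> (\<exists>P Q. P \<in> jpoly \<and> nonzero_poly Q \<and> (\<forall>z. Q z \<noteq> 0 \<longrightarrow> f z = P z / Q z))"

lemma nonzero_poly_mult:
  assumes "nonzero_poly P" "nonzero_poly Q"
  shows "nonzero_poly (\<lambda>z. P z * Q z)"
proof -
  obtain z0 z1 where "z0 \<in> equation_inf" "P z0 \<noteq> 0" "z1 \<in> equation_inf" "Q z1 \<noteq> 0"
    using assms unfolding nonzero_poly_def by blast
  with nonzero_product[of P z0 z1 Q, OF jpoly_line jpoly_line] assms
  obtain s where "P (line z0 z1 s) * Q (line z0 z1 s) \<noteq> 0" unfolding nonzero_poly_def by blast
  then show ?thesis
    using assms line_equation unfolding nonzero_poly_def by (blast intro: jpoly_intros)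
qed

lemma weakly_conj: "weakly \<Phi> \<Longrightarrow> weakly \<Psi> \<Longrightarrow> weakly (\<lambda>z. \<Phi> z \<and> \<Psi> z)"
  unfolding weakly_def
proof (elim exE conjE)
  fix R S assume *: "nonzero_poly R" "nonzero_poly S" "\<forall>z\<in>equation_inf. R z \<noteq> 0 \<longrightarrow> \<Phi> z"
    "\<forall>z\<in>equation_inf. S z \<noteq> 0 \<longrightarrow> \<Psi> z"
  show "\<exists>R. nonzero_poly R \<and> (\<forall>z\<in>equation_inf. R z \<noteq> 0 \<longrightarrow> \<Phi> z \<and> \<Psi> z)"
    by (rule exI[of _ "\<lambda>z. R z * S z"]) (use * nonzero_poly_mult[of R S] in auto)
qed

lemma weakly_mono: "weakly \<Phi> \<Longrightarrow> (\<And>z. z \<in> equation_inf \<Longrightarrow> \<Phi> z \<Longrightarrow> \<Psi> z) \<Longrightarrow> weakly \<Psi>"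
  unfolding weakly_def by blast

lemma weakly_all: "(\<And>z. z \<in> equation_inf \<Longrightarrow> \<Phi> z) \<Longrightarrow> weakly \<Phi>"
proof -
  obtain z where "z \<in> equation_inf" using exists_good by blast
  then have "nonzero_poly (\<lambda>_. 1)" by (auto simp: nonzero_poly_def intro!: jpoly_intros)
  then show "(\<And>z. z \<in> equation_inf \<Longrightarrow> \<Phi> z) \<Longrightarrow> weakly \<Phi>" unfolding weakly_def by blast
qed

lemma weakly_ex: "weakly \<Phi> \<Longrightarrow> \<exists>z\<in>equation_inf. \<Phi> z"
  unfolding weakly_def nonzero_poly_def by blast

lemma weakly_nonzero: "nonzero_poly Q \<Longrightarrow> weakly (\<lambda>z. Q z \<noteq> 0)"
  unfolding weakly_def by blast

lemma nonzero_poly_good: "nonzero_poly (\<lambda>z. (u_x z * u_xx z) ^ n)"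
proof -
  obtain z where z: "z \<in> equation_inf" "u_x z = 1" "u_xx z = 1" using exists_good by blast
  then have "(u_x z * u_xx z) ^ n \<noteq> 0" by simp
  moreover have "(\<lambda>z. (u_x z * u_xx z) ^ n) \<in> jpoly" by (intro jpoly_intros)
  ultimately show ?thesis unfolding nonzero_poly_def using z(1) by blast
qed

lemma weakly_good: "weakly good"
  using weakly_nonzero[OF nonzero_poly_good[of 1]] by (rule weakly_mono) (simp add: good_def)

lemma weakly_zero:
  assumes "f \<in> jpoly" "weakly (\<lambda>z. f z = 0)" "z \<in> equation_inf"
  shows "f z = 0"
proof -
  obtain R z1 where R: "R \<in> jpoly" "z1 \<in> equation_inf" "R z1 \<noteq> 0" "\<And>z. z \<in> equation_inf \<Longrightarrow> R z \<noteq> 0 \<Longrightarrow> f z = 0"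
    using assms(2) unfolding weakly_def nonzero_poly_def by blast
  show ?thesis
    by (rule jpoly_density[OF assms(1) R(1) _ R(2,3) assms(3)]) (use R(4) in auto)
qed

lemma ratlE:
  assumes "ratl f"
  obtains P Q where "P \<in> jpoly" "nonzero_poly Q" "is_frac f P Q"
proof -
  obtain P Q where PQ: "P \<in> jpoly" "nonzero_poly Q" "\<forall>z. Q z \<noteq> 0 \<longrightarrow> f z = P z / Q z"
    using assms unfolding ratl_def by blast
  then have "is_frac f P Q" unfolding is_frac_def nonzero_poly_def by (simp add: jpoly_alg)
  with PQ(1,2) show ?thesis by (rule that)
qed

lemma ratlI: "P \<in> jpoly \<Longrightarrow> nonzero_poly Q \<Longrightarrow> (\<And>z. Q z \<noteq> 0 \<Longrightarrow> f z = P z / Q z) \<Longrightarrow> ratl f"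
  unfolding ratl_def by blast

lemma ratl_jpoly: "f \<in> jpoly \<Longrightarrow> ratl f"
proof (rule ratlI)
  obtain z where "z \<in> equation_inf" using exists_good by blast
  then show "nonzero_poly (\<lambda>_. 1)" by (auto simp: nonzero_poly_def intro!: jpoly_intros)
qed auto

lemma ratl_regular:
  assumes "regular f"
  shows "ratl f"
proof -
  obtain P n where P: "P \<in> jpoly" "is_frac f P (\<lambda>z. (u_x z * u_xx z) ^ Suc n)"
    using assms by (rule regular_frac)
  show ?thesis
    by (rule ratlI[OF P(1) nonzero_poly_good]) (use P(2) in \<open>unfold is_frac_def, blast\<close>)
qed

lemma ratl_frac_at: "ratl f \<Longrightarrow> weakly (\<lambda>z. frac_at z f)"
proof (elim ratlE)
  fix P Q assume *: "nonzero_poly Q" "is_frac f P Q"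
  show "weakly (\<lambda>z. frac_at z f)"
    by (rule weakly_mono[OF weakly_nonzero[OF *(1)]]) (use *(2) in \<open>auto simp: frac_at_def\<close>)
qed

lemma
  assumes "ratl f" "ratl g"
  shows ratl_add: "ratl (\<lambda>z. f z + g z)"
    and ratl_mult: "ratl (\<lambda>z. f z * g z)"
    and ratl_divide: "\<not> weakly (\<lambda>z. g z = 0) \<Longrightarrow> ratl (\<lambda>z. f z / g z)"
proof -
  obtain P Q R S where *: "P \<in> jpoly" "nonzero_poly Q" "\<And>z. Q z \<noteq> 0 \<Longrightarrow> f z = P z / Q z"
    "R \<in> jpoly" "nonzero_poly S" "\<And>z. S z \<noteq> 0 \<Longrightarrow> g z = R z / S z"
    using assms unfolding ratl_def by blast
  then have QS: "Q \<in> jpoly" "S \<in> jpoly" by (auto simp: nonzero_poly_def)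
  note nz = nonzero_poly_mult[OF *(2,5)]
  show "ratl (\<lambda>z. f z + g z)"
  proof (rule ratlI[OF _ nz])
    show "(\<lambda>z. P z * S z + R z * Q z) \<in> jpoly" by (intro jpoly_intros * QS)
  qed (use *(3,6) in \<open>auto simp: field_simps\<close>)
  show "ratl (\<lambda>z. f z * g z)"
  proof (rule ratlI[OF _ nz])
    show "(\<lambda>z. P z * R z) \<in> jpoly" by (intro jpoly_intros *)
  qed (use *(3,6) in \<open>auto simp: field_simps\<close>)
  assume "\<not> weakly (\<lambda>z. g z = 0)"
  then have "nonzero_poly R"
    using *(4,6) weakly_mono[OF weakly_nonzero[OF *(5)], of "\<lambda>z. g z = 0"] unfolding nonzero_poly_def by fastforce
  show "ratl (\<lambda>z. f z / g z)"
  proof (rule ratlI[OF _ nonzero_poly_mult[OF nonzero_poly_mult[OF *(2) \<open>nonzero_poly R\<close>] *(5)]])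
    show "(\<lambda>z. P z * S z * S z) \<in> jpoly" by (intro jpoly_intros * QS)
    show "f z / g z = P z * S z * S z / (Q z * R z * S z)" if "Q z * R z * S z \<noteq> 0" for z
      using that *(3)[of z] *(6)[of z] by simp
  qed
qed

lemma ratl_const: "ratl (\<lambda>z. r)"
  by (intro ratl_jpoly jpoly_intros)

lemma ratl_uminus: "ratl f \<Longrightarrow> ratl (\<lambda>z. - f z)"
  using ratl_mult[OF ratl_const[of "-1"]] by simp

lemma ratl_diff: "ratl f \<Longrightarrow> ratl g \<Longrightarrow> ratl (\<lambda>z. f z - g z)"
  using ratl_add[OF _ ratl_uminus] by simp

lemma ratl_D:
  assumes "ratl f"
  shows "ratl (D i f)"
  using assms
proof (rule ratlE)
  fix P Q assume *: "P \<in> jpoly" "nonzero_poly Q" "is_frac f P Q"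
  then have Q: "Q \<in> jpoly" by (simp add: nonzero_poly_def)
  have "nonzero_poly (\<lambda>z. (Q z)\<^sup>2)" using nonzero_poly_mult[OF *(2,2)] by (simp add: power2_eq_square)
  then show ?thesis
  proof (rule ratlI[rotated])
    show "(\<lambda>z. D i P z * Q z - P z * D i Q z) \<in> jpoly" by (intro jpoly_intros D_jpoly * Q)
  qed (use Lie_frac[OF *(3)] in \<open>auto simp: D_def\<close>)
qed

lemma ratl_dichotomy: "ratl f \<Longrightarrow> \<not> weakly (\<lambda>z. f z = 0) \<Longrightarrow> weakly (\<lambda>z. f z \<noteq> 0)"
proof (elim ratlE)
  fix P Q assume *: "P \<in> jpoly" "nonzero_poly Q" "is_frac f P Q" "\<not> weakly (\<lambda>z. f z = 0)"
  have "nonzero_poly P"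
    using * weakly_mono[OF weakly_nonzero[OF *(2)], of "\<lambda>z. f z = 0"] unfolding nonzero_poly_def is_frac_def by fastforce
  from weakly_nonzero[OF nonzero_poly_mult[OF this *(2)]] show "weakly (\<lambda>z. f z \<noteq> 0)"
    by (rule weakly_mono) (use *(3) in \<open>auto simp: is_frac_def\<close>)
qed

lemma weakly_not_zero: "weakly (\<lambda>z. f z \<noteq> 0) \<Longrightarrow> \<not> weakly (\<lambda>z. f z = 0)"
  using weakly_conj[of "\<lambda>z. f z \<noteq> 0" "\<lambda>z. f z = 0"] weakly_ex by blast

lemma ratl_nonzero_at:
  assumes "regular f" "z \<in> equation_inf" "good z" "f z \<noteq> 0"
  shows "\<not> weakly (\<lambda>z. f z = 0)"
proof
  assume w: "weakly (\<lambda>z. f z = 0)"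
  obtain P n where P: "P \<in> jpoly" "is_frac f P (\<lambda>z. (u_x z * u_xx z) ^ Suc n)"
    using assms(1) by (rule regular_frac)
  then have f: "f z = P z / (u_x z * u_xx z) ^ Suc n" if "good z" for z
    using that good_iff[of z n] unfolding is_frac_def by blast
  have "weakly (\<lambda>z. P z = 0)"
  proof (rule weakly_mono[OF weakly_conj[OF w weakly_good]])
    fix z assume "f z = 0 \<and> good z"
    then show "P z = 0" using f[of z] unfolding good_iff[of z n] by (simp del: power_Suc)
  qed
  from weakly_zero[OF P(1) this assms(2)] f[OF assms(3)] assms(4) show False by simp
qed

text \<open>The numerator vanishes on the whole equation, so only zeros of the denominator need to
  be excluded; the exceptional polynomial is then the same for all tangent fields.\<close>

lemma Lie_weakly_zero:
  assumes "ratl f" "weakly (\<lambda>z. f z = 0)"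
  shows "\<exists>Q. nonzero_poly Q \<and> (\<forall>\<xi> z. z \<in> equation_inf \<longrightarrow> Q z \<noteq> 0 \<longrightarrow>
    (\<forall>g. g \<in> jpoly \<longrightarrow> (\<forall>z\<in>equation_inf. g z = 0) \<longrightarrow> Lie \<xi> g z = 0) \<longrightarrow> Lie \<xi> f z = 0)"
  using assms(1)
proof (rule ratlE)
  fix P Q assume *: "P \<in> jpoly" "nonzero_poly Q" "is_frac f P Q"
  have "weakly (\<lambda>z. P z = 0)"
    by (rule weakly_mono[OF weakly_conj[OF assms(2) weakly_nonzero[OF *(2)]]]) (use *(3) in \<open>auto simp: is_frac_def\<close>)
  then have P: "\<forall>z\<in>equation_inf. P z = 0" using weakly_zero[OF *(1)] by blast
  show ?thesis
    by (intro exI[of _ Q] conjI *(2)) (use P *(1) in \<open>auto simp: Lie_frac[OF *(3)]\<close>)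
qed

lemma D_weakly_zero:
  assumes "ratl f" "weakly (\<lambda>z. f z = 0)"
  shows "weakly (\<lambda>z. D i f z = 0)"
proof -
  obtain Q where Q: "nonzero_poly Q" "\<And>\<xi> z. z \<in> equation_inf \<Longrightarrow> Q z \<noteq> 0 \<Longrightarrow>
    (\<forall>g. g \<in> jpoly \<longrightarrow> (\<forall>z\<in>equation_inf. g z = 0) \<longrightarrow> Lie \<xi> g z = 0) \<Longrightarrow> Lie \<xi> f z = 0"
    using Lie_weakly_zero[OF assms] by blast
  show ?thesis
  proof (rule weakly_mono[OF weakly_nonzero[OF Q(1)]])
    fix z assume z: "z \<in> equation_inf" "Q z \<noteq> 0"
    show "D i f z = 0" unfolding D_def
      by (rule Q(2)[OF z]) (use D_vanish[OF jpoly_alg] z in \<open>auto simp: D_def\<close>)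
  qed
qed

lemma D_weakly_eq:
  assumes "ratl f" "ratl g" "weakly (\<lambda>z. f z = g z)"
  shows "weakly (\<lambda>z. D i f z = D i g z)"
proof -
  have "weakly (\<lambda>z. f z - g z = 0)" using weakly_mono[OF assms(3)] by simp
  from weakly_conj[OF D_weakly_zero[OF ratl_diff[OF assms(1,2)] this] weakly_conj[OF ratl_frac_at[OF assms(1)] ratl_frac_at[OF assms(2)]]]
  show ?thesis by (rule weakly_mono) (auto simp: D_def Lie_at_diff)
qed

subsection \<open>Generated fields\<close>

text \<open>Elements of the generated field are actual functions, identified only up to
  \<open>weakly\<close>. The relation \<open>B f = A\<close> avoids values of quotients at zeros of
  \<open>B\<close>, and \<open>ratl f\<close> excludes functions that agree with a quotient only
  generically without being fractions themselves.\<close>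

definition rfield :: "(jet \<Rightarrow> real) set \<Rightarrow> (jet \<Rightarrow> real) set" where
  "rfield S = {f. ratl f \<and> (\<exists>A\<in>real_algebra S. \<exists>B\<in>real_algebra S.
     \<not> weakly (\<lambda>z. B z = 0) \<and> weakly (\<lambda>z. B z * f z = A z))}"

locale generators =
  fixes S :: "(jet \<Rightarrow> real) set"
  assumes S: "\<And>f. f \<in> S \<Longrightarrow> ratl f"
begin

lemma ratl_algebra: "f \<in> real_algebra S \<Longrightarrow> ratl f"
  by (induction rule: real_algebra.induct) (auto intro: ratl_const ratl_add ratl_mult S)

lemma algebra_mult_nonzero:
  assumes "ratl A" "ratl B" "\<not> weakly (\<lambda>z. A z = 0)" "\<not> weakly (\<lambda>z. B z = 0)"
  shows "\<not> weakly (\<lambda>z. A z * B z = 0)"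
proof (rule weakly_not_zero)
  show "weakly (\<lambda>z. A z * B z \<noteq> 0)"
    by (rule weakly_mono[OF weakly_conj[OF ratl_dichotomy[OF assms(1,3)] ratl_dichotomy[OF assms(2,4)]]]) simp
qed

lemma rfieldI:
  "ratl f \<Longrightarrow> A \<in> real_algebra S \<Longrightarrow> B \<in> real_algebra S \<Longrightarrow> \<not> weakly (\<lambda>z. B z = 0) \<Longrightarrow>
    weakly (\<lambda>z. B z * f z = A z) \<Longrightarrow> f \<in> rfield S"
  unfolding rfield_def by blast

lemma rfieldE:
  assumes "f \<in> rfield S"
  obtains A B where "A \<in> real_algebra S" "B \<in> real_algebra S" "ratl A" "ratl B" "\<not> weakly (\<lambda>z. B z = 0)"
    "weakly (\<lambda>z. B z * f z = A z)"
  using assms ratl_algebra unfolding rfield_def by blast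

lemma rfield_ratl: "f \<in> rfield S \<Longrightarrow> ratl f"
  by (simp add: rfield_def)

lemma rfield_algebra: "f \<in> real_algebra S \<Longrightarrow> f \<in> rfield S"
proof (rule rfieldI[of _ f "\<lambda>_. 1"])
  show "\<not> weakly (\<lambda>z. (1 :: real) = 0)" using weakly_ex by force
qed (auto intro: ratl_algebra real_algebra.const weakly_all)

lemma rfield_gen: "f \<in> S \<Longrightarrow> f \<in> rfield S"
  by (intro rfield_algebra real_algebra.gen)

lemma rfield_const: "(\<lambda>z. r) \<in> rfield S"
  by (intro rfield_algebra real_algebra.const)

lemma rfield_cong:
  assumes "f \<in> rfield S" "ratl g" "weakly (\<lambda>z. f z = g z)"
  shows "g \<in> rfield S"
  using assms(1)
proof (rule rfieldE)
  fix A B assume *: "A \<in> real_algebra S" "B \<in> real_algebra S" "\<not> weakly (\<lambda>z. B z = 0)"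
    "weakly (\<lambda>z. B z * f z = A z)"
  show ?thesis
    by (rule rfieldI[OF assms(2) *(1-3)], rule weakly_mono[OF weakly_conj[OF *(4) assms(3)]]) auto
qed

lemma
  assumes "f \<in> rfield S" "g \<in> rfield S"
  shows rfield_add: "(\<lambda>z. f z + g z) \<in> rfield S"
    and rfield_mult: "(\<lambda>z. f z * g z) \<in> rfield S"
    and rfield_divide': "\<not> weakly (\<lambda>z. g z = 0) \<Longrightarrow> (\<lambda>z. f z / g z) \<in> rfield S"
proof -
  obtain A B where f: "A \<in> real_algebra S" "B \<in> real_algebra S" "ratl A" "ratl B" "\<not> weakly (\<lambda>z. B z = 0)"
    "weakly (\<lambda>z. B z * f z = A z)" using assms(1) by (rule rfieldE)
  obtain A' B' where g: "A' \<in> real_algebra S" "B' \<in> real_algebra S" "ratl A'" "ratl B'" "\<not> weakly (\<lambda>z. B' z = 0)"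
    "weakly (\<lambda>z. B' z * g z = A' z)" using assms(2) by (rule rfieldE)
  note r = rfield_ratl[OF assms(1)] rfield_ratl[OF assms(2)]
  have w: "weakly (\<lambda>z. A z = B z * f z \<and> A' z = B' z * g z)"
    by (rule weakly_mono[OF weakly_conj[OF f(6) g(6)]]) simp
  show "(\<lambda>z. f z + g z) \<in> rfield S"
  proof (rule rfieldI[of _ "\<lambda>z. A z * B' z + A' z * B z" "\<lambda>z. B z * B' z"])
    show "weakly (\<lambda>z. B z * B' z * (f z + g z) = A z * B' z + A' z * B z)"
      using w by (rule weakly_mono) (simp add: algebra_simps)
  qed (intro algebra_mult_nonzero ratl_add real_algebra.add real_algebra.mult f g r)+
  show "(\<lambda>z. f z * g z) \<in> rfield S"
  proof (rule rfieldI[of _ "\<lambda>z. A z * A' z" "\<lambda>z. B z * B' z"])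
    show "weakly (\<lambda>z. B z * B' z * (f z * g z) = A z * A' z)"
      using w by (rule weakly_mono) (simp add: algebra_simps)
  qed (intro algebra_mult_nonzero ratl_mult real_algebra.mult f g r)+
  assume nz: "\<not> weakly (\<lambda>z. g z = 0)"
  show "(\<lambda>z. f z / g z) \<in> rfield S"
  proof (rule rfieldI[of _ "\<lambda>z. A z * B' z" "\<lambda>z. B z * A' z"])
    have "\<not> weakly (\<lambda>z. A' z = 0)"
    proof
      assume "weakly (\<lambda>z. A' z = 0)"
      from weakly_conj[OF this weakly_conj[OF g(6) ratl_dichotomy[OF g(4,5)]]]
      have "weakly (\<lambda>z. g z = 0)" by (rule weakly_mono) auto
      then show False using nz by simp
    qed
    then show "\<not> weakly (\<lambda>z. B z * A' z = 0)" by (intro algebra_mult_nonzero f g)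
    show "weakly (\<lambda>z. B z * A' z * (f z / g z) = A z * B' z)"
      using weakly_conj[OF w ratl_dichotomy[OF r(2) nz]] by (rule weakly_mono) simp
  qed (intro ratl_divide real_algebra.mult f g r nz)+
qed

lemma rfield_divide: "f \<in> rfield S \<Longrightarrow> g \<in> rfield S \<Longrightarrow> weakly (\<lambda>z. g z \<noteq> 0) \<Longrightarrow> (\<lambda>z. f z / g z) \<in> rfield S"
  by (intro rfield_divide' weakly_not_zero)

lemma rfield_uminus: "f \<in> rfield S \<Longrightarrow> (\<lambda>z. - f z) \<in> rfield S"
  using rfield_mult[OF rfield_const[of "-1"]] by simp

lemma rfield_diff: "f \<in> rfield S \<Longrightarrow> g \<in> rfield S \<Longrightarrow> (\<lambda>z. f z - g z) \<in> rfield S"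
  using rfield_add[OF _ rfield_uminus] by simp

lemma rfield_power: "f \<in> rfield S \<Longrightarrow> (\<lambda>z. f z ^ n) \<in> rfield S"
  by (induction n) (auto intro: rfield_const rfield_mult)

text \<open>Differentiating \<open>B f = A\<close> gives \<open>D f = (D A - D B f) / B\<close>, so
  it suffices to control the derivatives of the generators.\<close>

lemma rfield_D:
  assumes D: "\<And>g. g \<in> S \<Longrightarrow> D i g \<in> rfield S" and f: "f \<in> rfield S"
  shows "D i f \<in> rfield S"
proof -
  have alg: "D i g \<in> rfield S" if "g \<in> real_algebra S" for g
    using that
  proof (induction rule: real_algebra.induct)
    case (const r)
    then show ?case by (simp add: rfield_const)
  next
    case (gen g)
    then show ?case by (rule D)
  next
    case (add f g)
    note fg = ratl_algebra[OF add.hyps(1)] ratl_algebra[OF add.hyps(2)]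
    have "weakly (\<lambda>z. D i f z + D i g z = D i (\<lambda>z. f z + g z) z)"
    proof (rule weakly_mono[OF weakly_conj[OF ratl_frac_at[OF fg(1)] ratl_frac_at[OF fg(2)]]])
      fix z assume "frac_at z f \<and> frac_at z g"
      then show "D i f z + D i g z = D i (\<lambda>z. f z + g z) z"
        unfolding D_def using Lie_at_add[of z f g] by metis
    qed
    then show ?case
      by (rule rfield_cong[OF rfield_add[OF add.IH] ratl_D[OF ratl_add[OF fg]]])
  next
    case (mult f g)
    note fg = ratl_algebra[OF mult.hyps(1)] ratl_algebra[OF mult.hyps(2)]
    have "weakly (\<lambda>z. D i f z * g z + f z * D i g z = D i (\<lambda>z. f z * g z) z)"
    proof (rule weakly_mono[OF weakly_conj[OF ratl_frac_at[OF fg(1)] ratl_frac_at[OF fg(2)]]])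
      fix z assume "frac_at z f \<and> frac_at z g"
      then show "D i f z * g z + f z * D i g z = D i (\<lambda>z. f z * g z) z"
        unfolding D_def using Lie_at_mult[of z f g "total_field i"] by simp
    qed
    note w = this
    show ?case
      by (rule rfield_cong[OF rfield_add[OF rfield_mult[OF mult.IH(1) rfield_algebra[OF mult.hyps(2)]]
              rfield_mult[OF rfield_algebra[OF mult.hyps(1)] mult.IH(2)]] ratl_D[OF ratl_mult[OF fg]] w])
  qed
  obtain A B where AB: "A \<in> real_algebra S" "B \<in> real_algebra S" "ratl A" "ratl B" "\<not> weakly (\<lambda>z. B z = 0)"
    "weakly (\<lambda>z. B z * f z = A z)" using f by (rule rfieldE)
  note r = rfield_ratl[OF f]
  have "weakly (\<lambda>z. D i (\<lambda>z. B z * f z) z = D i A z)"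
    by (intro D_weakly_eq ratl_mult AB r)
  from weakly_conj[OF this weakly_conj[OF weakly_conj[OF ratl_frac_at[OF AB(4)] ratl_frac_at[OF r]] ratl_dichotomy[OF AB(4,5)]]]
  have "weakly (\<lambda>z. (D i A z - D i B z * f z) / B z = D i f z)"
  proof (rule weakly_mono)
    fix z assume "D i (\<lambda>z. B z * f z) z = D i A z \<and> (frac_at z B \<and> frac_at z f) \<and> B z \<noteq> 0"
    then have "D i B z * f z + B z * D i f z = D i A z" "B z \<noteq> 0"
      unfolding D_def using Lie_at_mult[of z B f] by auto
    then show "(D i A z - D i B z * f z) / B z = D i f z" by (simp add: field_simps)
  qed
  then show ?thesis
    by (rule rfield_cong[OF rfield_divide'[OF rfield_diff[OF alg[OF AB(1)] rfield_mult[OF alg[OF AB(2)] f]]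
            rfield_algebra[OF AB(2)] AB(5)] ratl_D[OF r]])
qed

end

section \<open>All coordinates are rational in the invariants and the pivots\<close>

abbreviation u_xxx :: "jet \<Rightarrow> real" where "u_xxx z \<equiv> z (Jet Ud (0, 3, 0))"
abbreviation u_xxy :: "jet \<Rightarrow> real" where "u_xxy z \<equiv> z (Jet Ud (0, 2, 1))"
abbreviation u_xyy :: "jet \<Rightarrow> real" where "u_xyy z \<equiv> z (Jet Ud (0, 1, 2))"
abbreviation u_yyy :: "jet \<Rightarrow> real" where "u_yyy z \<equiv> z (Jet Ud (0, 0, 3))"

lemma D_commute_frac:
  assumes "frac_at z f"
  shows "D i (D j f) z = D j (D i f) z"
proof -
  obtain P Q where f: "is_frac f P Q" "Q z \<noteq> 0" using assms unfolding frac_at_def by blast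
  then have P: "P \<in> alg" and Q: "Q \<in> alg" by (auto simp: is_frac_def)
  have *: "D i (D j f) z = (D i (\<lambda>z. D j P z * Q z - P z * D j Q z) z * (Q z)\<^sup>2
      - (D j P z * Q z - P z * D j Q z) * D i (\<lambda>z. (Q z)\<^sup>2) z) / ((Q z)\<^sup>2)\<^sup>2" for i j
    using Lie_frac[OF frac_Lie[of f P Q "total_field j", OF f(1) total_field_alg], of z "total_field i"] f(2)
    by (simp add: D_def)
  show ?thesis
    unfolding *
    by (simp add: D_mult D_diff D_power D_alg P Q alg_intros D_commute[OF P, of i j] D_commute[OF Q, of i j])
      (simp add: algebra_simps power2_eq_square)
qed

definition ncoef :: "indep \<Rightarrow> indep \<Rightarrow> jet \<Rightarrow> real" where
  "ncoef k i = (\<lambda>z. nnum k i z / nden k i z)"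

lemma nab_ncoef: "nab k f z = (\<Sum>i\<in>{Ti, Xi, Yi}. ncoef k i z * D i f z)"
  by (simp add: nab_def ncoef_def)

lemma regular_ncoef': "regular (ncoef k i)"
  unfolding ncoef_def by (rule regular_ncoef)

lemma D_ncoef: "good z \<Longrightarrow> D i (ncoef k j) z =
    (D i (nnum k j) z * nden k j z - nnum k j z * D i (nden k j) z) / (nden k j z)\<^sup>2"
  unfolding D_def
  by (rule Lie_frac) (auto simp: is_frac_def ncoef_def nnum_alg nden_alg nden_nonzero)

definition comm_coef :: "indep \<Rightarrow> indep \<Rightarrow> indep \<Rightarrow> jet \<Rightarrow> real" where
  "comm_coef k l j z = nab k (ncoef l j) z - nab l (ncoef k j) z"

lemma nab_commutator:
  assumes z: "good z" and f: "frac_at z f"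
  shows "nab k (nab l f) z - nab l (nab k f) z = (\<Sum>j\<in>{Ti, Xi, Yi}. comm_coef k l j z * D j f z)"
proof -
  have c: "frac_at z (ncoef k i)" for k i by (rule regular_frac_at[OF regular_ncoef' z])
  have t: "frac_at z (\<lambda>z. ncoef k i z * D i f z)" for k i
    by (intro frac_at_mult c frac_at_D f)
  have e: "nab k f = (\<lambda>z. ncoef k Ti z * D Ti f z + (ncoef k Xi z * D Xi f z + ncoef k Yi z * D Yi f z))" for k
    by (simp add: nab_ncoef fun_eq_iff)
  have Dn: "D j (nab l f) z = (\<Sum>i\<in>{Ti, Xi, Yi}. D j (ncoef l i) z * D i f z + ncoef l i z * D j (D i f) z)" for j l
    unfolding e D_def Lie_at_add[OF t[unfolded D_def] frac_at_add[OF t t, unfolded D_def]] Lie_at_add[OF t t, unfolded D_def]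
      Lie_at_mult[OF c frac_at_D[OF f], unfolded D_def] by simp
  show ?thesis
    unfolding nab_ncoef[of k "nab l f"] nab_ncoef[of l "nab k f"] Dn comm_coef_def nab_ncoef
    using D_commute_frac[OF f, of Ti Xi] D_commute_frac[OF f, of Ti Yi] D_commute_frac[OF f, of Xi Yi]
    by (simp add: algebra_simps)
qed

text \<open>The structure functions in \<open>[\<nabla>\<^sub>k, \<nabla>\<^sub>3] = \<alpha>\<^sub>k \<nabla>\<^sub>1 + \<beta>\<^sub>k \<nabla>\<^sub>2 + \<gamma>\<^sub>k \<nabla>\<^sub>3\<close>.\<close>

definition gam :: "indep \<Rightarrow> jet \<Rightarrow> real" where
  "gam k z = comm_coef k Ti Ti z * (u_x z ^ 3 * (1 / u_xx z))"

text \<open>The system for the structure functions is triangular: only the third derivation contains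
  the t-derivative and only the second and third contain the y-derivative, so the coefficients are
  read off in the order t, y, x.\<close>

definition bet :: "indep \<Rightarrow> jet \<Rightarrow> real" where
  "bet k z = - u_x z * (comm_coef k Ti Yi z + - 1 * (gam k z * ncoef Ti Yi z))"

definition alp :: "indep \<Rightarrow> jet \<Rightarrow> real" where
  "alp k z = u_xx z * (1 / u_x z) * (comm_coef k Ti Xi z + - 1 * (gam k z * ncoef Ti Xi z) + - 1 * (bet k z * ncoef Yi Xi z))"

lemma nab_structure:
  assumes z: "good z" and f: "frac_at z f"
  shows "nab k (nab Ti f) z - nab Ti (nab k f) z = alp k z * nab Xi f z + bet k z * nab Yi f z + gam k z * nab Ti f z"
proof -
  have nz: "u_x z \<noteq> 0" "u_xx z \<noteq> 0" using z by (auto simp: good_def)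
  have 1: "ncoef Ti Ti z = u_xx z / u_x z ^ 3" "ncoef Xi Xi z = u_x z / u_xx z" "ncoef Yi Yi z = - 1 / u_x z"
    "ncoef Xi Ti z = 0" "ncoef Xi Yi z = 0" "ncoef Yi Ti z = 0"
    by (simp_all add: ncoef_def)
  have c1: "comm_coef k Ti Ti z = gam k z * (u_xx z / u_x z ^ 3)"
    using nz by (simp add: gam_def)
  have c2: "comm_coef k Ti Yi z = gam k z * ncoef Ti Yi z + bet k z * (- 1 / u_x z)"
    using nz by (simp add: bet_def)
  have c3: "comm_coef k Ti Xi z = gam k z * ncoef Ti Xi z + bet k z * ncoef Yi Xi z + alp k z * (u_x z / u_xx z)"
    using nz by (simp add: alp_def)
  show ?thesis
    unfolding nab_commutator[OF z f] unfolding nab_ncoef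
    by (simp add: c1 c2 c3 1 algebra_simps)
qed

lemma regular_1: "regular (\<lambda>z. 1 / u_x z)" "regular (\<lambda>z. 1 / u_xx z)"
  by (rule regularI[of "\<lambda>z. u_xx z" _ 0] regularI[of "\<lambda>z. u_x z" _ 0]; auto intro!: jpoly_intros simp: good_def)+

lemma regular_structure: "regular (comm_coef k l j)" "regular (gam k)" "regular (bet k)" "regular (alp k)"
proof -
  have neg: "regular (\<lambda>z. - 1 * f z)" if "regular f" for f
    by (intro regular_mult that regular_jpoly jpoly_intros)
  show c: "regular (comm_coef k l j)" for l j
    unfolding comm_coef_def[abs_def] diff_conv_add_uminus
    using regular_add[OF regular_nab[OF regular_ncoef'] neg[OF regular_nab[OF regular_ncoef']]] by simp
  show g: "regular (gam k)"
    unfolding gam_def[abs_def] by (rule regular_mult regular_1 c regular_jpoly jpoly_intros)+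
  show b: "regular (bet k)"
    unfolding bet_def[abs_def]
    by (rule regular_mult[OF regular_jpoly regular_add[OF c neg[OF regular_mult[OF g regular_ncoef']]]])
      (intro jpoly_intros)
  show "regular (alp k)"
    unfolding alp_def[abs_def]
    by (rule regular_mult[OF regular_mult[OF regular_jpoly[OF jpoly_jet] regular_1(1)]
          regular_add[OF regular_add[OF c neg[OF regular_mult[OF g regular_ncoef']]] neg[OF regular_mult[OF b regular_ncoef']]]])
qed

subsection \<open>Solving for the structure functions\<close>

definition inv :: "nat \<Rightarrow> jet \<Rightarrow> real" where
  "inv l = [I2, nab Xi I2, nab Yi I2] ! l"

definition det3 :: "(nat \<Rightarrow> nat \<Rightarrow> real) \<Rightarrow> real" where
  "det3 M = M 0 0 * (M 1 1 * M 2 2 - M 1 2 * M 2 1) - M 0 1 * (M 1 0 * M 2 2 - M 1 2 * M 2 0)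
     + M 0 2 * (M 1 0 * M 2 1 - M 1 1 * M 2 0)"

lemma cramer3:
  assumes "\<And>l. l < 3 \<Longrightarrow> x * M l 0 + y * M l 1 + w * M l 2 = r l"
  shows "det3 M * x = det3 (\<lambda>l j. if j = 0 then r l else M l j)"
    "det3 M * y = det3 (\<lambda>l j. if j = 1 then r l else M l j)"
    "det3 M * w = det3 (\<lambda>l j. if j = 2 then r l else M l j)"
  using assms[of 0, symmetric] assms[of 1, symmetric] assms[of 2, symmetric]
  by (simp_all add: det3_def) (simp_all add: algebra_simps)

text \<open>The columns follow the order of \<open>alp\<close>, \<open>bet\<close>,
  \<open>gam\<close>, so \<open>nab_structure\<close> for the three invariants is a linear system
  with this matrix.\<close>

definition Jac :: "jet \<Rightarrow> nat \<Rightarrow> nat \<Rightarrow> real" where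
  "Jac z l j = nab ([Xi, Yi, Ti] ! j) (inv l) z"

text \<open>\<open>m div 5\<close> counts t-derivatives. The order within a level is the one in
  which suitable choices of e, d, c, b, a move the pivots: each choice fixes the preceding
  pivots.\<close>

definition pivot :: "nat \<Rightarrow> coord" where
  "pivot m = [Jet Ud (m div 5, 1, 0), Jet Ud (m div 5, 2, 0), Jet Ud (m div 5, 1, 1), Jet Ud (m div 5, 0, 0),
     Jet Vd (m div 5, 0, 0)] ! (m mod 5)"

definition pivots :: "(jet \<Rightarrow> real) set" where
  "pivots = {\<lambda>z. z (pivot m) | m. True}"

abbreviation gens :: "(jet \<Rightarrow> real) set" where
  "gens \<equiv> iterates \<union> pivots"

abbreviation K :: "(jet \<Rightarrow> real) set" where
  "K \<equiv> rfield gens"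

lemma pivot_Jet: "\<exists>\<alpha> \<sigma>. pivot m = Jet \<alpha> \<sigma>"
proof -
  have "m mod 5 = 0 \<or> m mod 5 = 1 \<or> m mod 5 = 2 \<or> m mod 5 = 3 \<or> m mod 5 = 4" by presburger
  then show ?thesis unfolding pivot_def by (elim disjE) simp_all
qed

lemma ratl_gens: "f \<in> gens \<Longrightarrow> ratl f"
proof (elim UnE)
  assume "f \<in> pivots"
  then obtain m where "f = (\<lambda>z. z (pivot m))" by (auto simp: pivots_def)
  moreover obtain \<alpha> \<sigma> where "pivot m = Jet \<alpha> \<sigma>" using pivot_Jet by blast
  ultimately show "ratl f" by (auto intro!: ratl_jpoly jpoly_jet)
qed (intro ratl_regular regular_iterates)

lemma generators_gens: "generators gens"
  by unfold_locales (rule ratl_gens)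

lemmas K_gen = generators.rfield_gen[OF generators_gens]
lemmas K_cong = generators.rfield_cong[OF generators_gens]
lemmas K_divide = generators.rfield_divide[OF generators_gens]
lemmas K_intros = generators.rfield_const[OF generators_gens] generators.rfield_add[OF generators_gens]
  generators.rfield_mult[OF generators_gens] generators.rfield_uminus[OF generators_gens]
  generators.rfield_diff[OF generators_gens] generators.rfield_power[OF generators_gens]

lemma eqn_D:
  assumes "z \<in> equation_inf"
  shows "eqn \<alpha> z = 0" "D i (eqn \<alpha>) z = 0"
  using assms D_multi_inc[OF jpoly_alg[OF eqn_jpoly], of i "(0, 0, 0)" \<alpha>] unfolding equation_inf_eqn
  by (metis D_multi_0)+

lemma eqn_u_tx:
  "z \<in> equation_inf \<Longrightarrow> z (Jet Ud (1, 1, 0)) = u_yy z - (u_x z * u_y z + u_0 z * u_xy z + v_x z * u_x z + v_0 z * u_xx z)"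
  using eqn_D(1)[of z Ud] unfolding eqn_eq by simp

lemma eqn_v_tx:
  "z \<in> equation_inf \<Longrightarrow> z (Jet Vd (1, 1, 0)) = v_yy z + u_x z * v_y z - (v_x z * v_x z + v_0 z * v_xx z + u_0 z * v_xy z
     + 2 * u_y z * v_x z)"
  using eqn_D(1)[of z Vd] unfolding eqn_eq by simp

lemma eqn_u_txx:
  "z \<in> equation_inf \<Longrightarrow> z (Jet Ud (1, 2, 0)) = u_xyy z - (u_xx z * u_y z + 2 * u_x z * u_xy z + u_0 z * u_xxy z
     + v_xx z * u_x z + 2 * v_x z * u_xx z + v_0 z * u_xxx z)"
  using eqn_D(2)[of z Xi Ud] unfolding eqn_eq
  by (simp add: D_simps alg_intros flip: numeral_2_eq_2)

lemma eqn_u_txy: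
  "z \<in> equation_inf \<Longrightarrow> z (Jet Ud (1, 1, 1)) = u_yyy z - (2 * u_xy z * u_y z + u_x z * u_yy z + u_0 z * u_xyy z
     + v_xy z * u_x z + v_x z * u_xy z + v_y z * u_xx z + v_0 z * u_xxy z)"
  using eqn_D(2)[of z Yi Ud] unfolding eqn_eq
  by (simp add: D_simps alg_intros flip: numeral_2_eq_2) (simp add: algebra_simps)

definition I2_num :: "jet \<Rightarrow> real" where
  "I2_num = (\<lambda>z. u_x z * u_x z * u_xy z + u_x z * u_xx z * v_x z + u_xx z * u_yy z - u_xy z * u_xy z)"

lemma I2_num_alg: "I2_num \<in> alg"
  unfolding I2_num_def by (intro alg_intros)

lemma I2_frac: "is_frac I2 I2_num (\<lambda>z. u_x z ^ 4)"
  unfolding is_frac_def by (auto simp: I2_def I2_num_def power2_eq_square intro!: alg_intros)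

lemma D_I2: "u_x z \<noteq> 0 \<Longrightarrow> D i I2 z = (D i I2_num z * u_x z - 4 * I2_num z * z (Jet Ud (inc i (0, 1, 0)))) / u_x z ^ 5"
  unfolding D_def using Lie_frac[OF I2_frac, of z "total_field i"]
  by (simp add: Lie_power alg_intros) (simp add: field_simps eval_nat_numeral)

lemma D_I2_num:
  "D Xi I2_num = (\<lambda>z. 2 * u_x z * u_xx z * u_xy z + u_x z * u_x z * u_xxy z + u_xx z * u_xx z * v_x z
     + u_x z * u_xxx z * v_x z + u_x z * u_xx z * v_xx z + u_xxx z * u_yy z + u_xx z * u_xyy z - 2 * u_xy z * u_xxy z)"
  "D Yi I2_num = (\<lambda>z. 2 * u_x z * u_xy z * u_xy z + u_x z * u_x z * u_xyy z + u_xy z * u_xx z * v_x z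
     + u_x z * u_xxy z * v_x z + u_x z * u_xx z * v_xy z + u_xxy z * u_yy z + u_xx z * u_yyy z - 2 * u_xy z * u_xyy z)"
  "D Ti I2_num = (\<lambda>z. 2 * u_x z * z (Jet Ud (1, 1, 0)) * u_xy z + u_x z * u_x z * z (Jet Ud (1, 1, 1))
     + z (Jet Ud (1, 1, 0)) * u_xx z * v_x z + u_x z * z (Jet Ud (1, 2, 0)) * v_x z + u_x z * u_xx z * z (Jet Vd (1, 1, 0))
     + z (Jet Ud (1, 2, 0)) * u_yy z + u_xx z * z (Jet Ud (1, 0, 2)) - 2 * u_xy z * z (Jet Ud (1, 1, 1)))"
  unfolding I2_num_def by (simp_all add: D_simps alg_intros fun_eq_iff algebra_simps flip: numeral_2_eq_2)

subsection \<open>Three functionally independent invariants\<close>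

text \<open>\<open>u_x\<close> and \<open>u_xx\<close> make the point good. The other three entries
  enter the derivatives of \<open>I2\<close> separately: \<open>u_tyy\<close> gives its
  t-derivative, \<open>v_xxx\<close> and \<open>v_xyy\<close> give the identity as its Hessian in x
  and y, while the first derivatives in x and y vanish.\<close>

definition sample :: jet where
  "sample = solve (\<lambda>c. if c \<in> {Jet Ud (0, 1, 0), Jet Ud (0, 2, 0), Jet Ud (1, 0, 2), Jet Vd (0, 3, 0), Jet Vd (0, 1, 2)} then 1 else 0)"

lemma sample_equation: "sample \<in> equation_inf"
  by (simp add: sample_def solve_equation)

lemma sample_free: "sample (Jet \<alpha> (0, j, l)) =
    (if Jet \<alpha> (0, j, l) \<in> {Jet Ud (0, 1, 0), Jet Ud (0, 2, 0), Jet Vd (0, 3, 0), Jet Vd (0, 1, 2)} then 1 else 0)"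
  "sample (Jet Ud (1, 0, 2)) = 1"
  by (simp_all add: sample_def solve_free)

lemma sample_good: "good sample"
  by (simp add: good_def sample_free)

lemma sample_I2_num: "I2_num sample = 0"
  by (simp add: I2_num_def sample_free)

lemma sample_D_I2: "D Xi I2 sample = 0" "D Yi I2 sample = 0" "D Ti I2 sample = 1"
proof -
  show "D Xi I2 sample = 0" "D Yi I2 sample = 0"
    by (subst D_I2; simp add: D_I2_num sample_I2_num sample_free)+
  show "D Ti I2 sample = 1"
    using sample_free(2) by (subst D_I2)
      (simp_all add: D_I2_num sample_I2_num sample_free eqn_u_txy[OF sample_equation, simplified] eqn_v_tx[OF sample_equation, simplified])
qed

lemma sample_D_D_I2: "D Xi (D Xi I2) sample = 1" "D Xi (D Yi I2) sample = 0" "D Yi (D Xi I2) sample = 0"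
  "D Yi (D Yi I2) sample = 1"
proof -
  define N where "N i = (\<lambda>z. D i I2_num z * u_x z - 4 * I2_num z * z (Jet Ud (inc i (0, 1, 0))))" for i
  have N: "N i \<in> alg" for i unfolding N_def by (intro alg_intros D_alg I2_num_alg)
  have f: "is_frac (D i I2) (N i) (\<lambda>z. u_x z ^ 5)" for i
    unfolding is_frac_def using N D_I2 by (auto simp: N_def intro!: alg_intros)
  have N0: "N Xi sample = 0" "N Yi sample = 0"
    by (simp_all add: N_def D_I2_num sample_I2_num sample_free)
  \<comment> \<open>At a zero of the numerator the quotient rule leaves only the derivative of the
    numerator, and \<open>u_x\<close> is 1 here.\<close>
  have *: "D k (D i I2) sample = D k (N i) sample" if "N i sample = 0" for k i
    using Lie_frac[OF f[of i], of sample "total_field k"] that by (simp add: D_def sample_free)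
  have NX: "N Xi = (\<lambda>z. D Xi I2_num z * u_x z - 4 * I2_num z * u_xx z)"
    and NY: "N Yi = (\<lambda>z. D Yi I2_num z * u_x z - 4 * I2_num z * u_xy z)"
    by (simp_all add: N_def flip: numeral_2_eq_2)
  have D: "D k (N Xi) sample = D k (D Xi I2_num) sample - 4 * D k I2_num sample"
    "D k (N Yi) sample = D k (D Yi I2_num) sample" if "k = Xi \<or> k = Yi" for k
    unfolding NX NY using that
    by (auto simp: D_diff D_mult D_alg I2_num_alg alg_intros sample_free)
      (simp_all add: D_I2_num sample_I2_num sample_free)
  show "D Xi (D Xi I2) sample = 1" "D Xi (D Yi I2) sample = 0" "D Yi (D Xi I2) sample = 0"
    "D Yi (D Yi I2) sample = 1"
    by (simp_all add: * N0 D) (simp_all add: D_I2_num D_simps alg_intros sample_free)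
qed

lemma det3_Jac_sample: "det3 (Jac sample) \<noteq> 0"
proof -
  have q: "u_x sample = 1" "u_xx sample = 1" "u_xy sample = 0" "v_x sample = 0" "v_0 sample = 0" "u_yy sample = 0" "u_0 sample = 0"
    by (simp_all add: sample_free)
  have c: "ncoef Xi Xi sample = 1" "ncoef Xi Ti sample = 0" "ncoef Xi Yi sample = 0" "ncoef Yi Xi sample = 0"
    "ncoef Yi Ti sample = 0" "ncoef Yi Yi sample = - 1" "ncoef Ti Ti sample = 1" "ncoef Ti Xi sample = 0" "ncoef Ti Yi sample = 1"
    using q by (simp_all add: ncoef_def)
  have I: "regular I2" by (rule regular_I2)
  have fr: "frac_at sample (ncoef k i)" "frac_at sample (D i I2)" for k i
    using regular_frac_at[OF regular_ncoef' sample_good] regular_frac_at[OF regular_D[OF I] sample_good] by auto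
  have DI: "D i (nab k I2) sample = (\<Sum>j\<in>{Ti, Xi, Yi}. D i (ncoef k j) sample * D j I2 sample + ncoef k j sample * D i (D j I2) sample)"
    for i k
  proof -
    have e: "nab k I2 = (\<lambda>z. ncoef k Ti z * D Ti I2 z + (ncoef k Xi z * D Xi I2 z + ncoef k Yi z * D Yi I2 z))"
      by (simp add: nab_ncoef fun_eq_iff)
    have t: "frac_at sample (\<lambda>z. ncoef k i z * D i I2 z)" for i by (intro frac_at_mult fr)
    show ?thesis
      unfolding e D_def[of i] Lie_at_add[OF t frac_at_add[OF t t]] Lie_at_add[OF t t] Lie_at_mult[OF fr] by simp
  qed
  \<comment> \<open>The only nonzero first derivative of \<open>I2\<close> at \<open>sample\<close>
    is the one in t, whose coefficient in the first two derivations is identically zero; hence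
    derivatives of coefficients do not contribute.\<close>
  have T0: "D i (ncoef Xi Ti) = (\<lambda>z. 0)" "D i (ncoef Yi Ti) = (\<lambda>z. 0)" for i by (simp_all add: ncoef_def)
  have 0: "Jac sample 0 0 = 0" "Jac sample 0 1 = 0" "Jac sample 0 2 = 1"
    by (simp_all add: Jac_def inv_def nab_ncoef c sample_D_I2)
  have 1: "Jac sample 1 0 = 1" "Jac sample 1 1 = 0" "Jac sample 2 0 = 0" "Jac sample 2 1 = 1"
    by (simp_all add: Jac_def inv_def nab_ncoef[of _ "nab _ I2"] c DI sample_D_I2 sample_D_D_I2 T0)
  show ?thesis unfolding det3_def 0 1 by simp
qed

lemma K_iterates: "f \<in> iterates \<Longrightarrow> f \<in> K"
  by (rule K_gen) (rule UnI1)

lemma inv_iterates: "l < 3 \<Longrightarrow> inv l \<in> iterates"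
  using iterates_I2 iterates_nab[OF iterates_I2] unfolding inv_def by (auto simp: less_Suc_eq numeral_eq_Suc)

lemma Jac_K: "l < 3 \<Longrightarrow> (\<lambda>z. Jac z l j) \<in> K"
  unfolding Jac_def by (intro K_iterates iterates_nab inv_iterates)

lemma det3_K:
  assumes "\<And>l j. l < 3 \<Longrightarrow> j < 3 \<Longrightarrow> (\<lambda>z. M z l j) \<in> K"
  shows "(\<lambda>z. det3 (M z)) \<in> K"
  unfolding det3_def by (intro K_intros assms) simp_all

lemma regular_det3_Jac: "regular (\<lambda>z. det3 (Jac z))"
proof -
  have J: "regular (\<lambda>z. Jac z l j)" if "l < 3" for l j
    unfolding Jac_def by (intro regular_nab regular_iterates inv_iterates that)
  have neg: "regular (\<lambda>z. - 1 * f z)" if "regular f" for f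
    by (intro regular_mult that regular_jpoly jpoly_intros)
  have e: "det3 M = M 0 0 * (M 1 1 * M 2 2 + - 1 * (M 1 2 * M 2 1)) + - 1 * (M 0 1 * (M 1 0 * M 2 2 + - 1 * (M 1 2 * M 2 0)))
     + M 0 2 * (M 1 0 * M 2 1 + - 1 * (M 1 1 * M 2 0))" for M
    by (simp add: det3_def)
  show ?thesis unfolding e
    by (rule regular_add regular_mult J neg | simp)+
qed

lemma det3_Jac_nonzero: "weakly (\<lambda>z. det3 (Jac z) \<noteq> 0)"
  by (rule ratl_dichotomy[OF ratl_regular[OF regular_det3_Jac]])
    (rule ratl_nonzero_at[OF regular_det3_Jac sample_equation sample_good det3_Jac_sample])

lemma structure_K: "alp k \<in> K" "bet k \<in> K" "gam k \<in> K"
proof -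
  define r where "r z l = nab k (nab Ti (inv l)) z - nab Ti (nab k (inv l)) z" for z l
  have r: "(\<lambda>z. r z l) \<in> K" if "l < 3" for l
    unfolding r_def by (intro K_intros K_iterates[OF iterates_nab[OF iterates_nab[OF inv_iterates[OF that]]]])
  define N where "N i z = (\<lambda>l j :: nat. if j = i then r z l else Jac z l j)" for i :: nat and z
  have N: "(\<lambda>z. det3 (N i z)) \<in> K" for i
  proof (rule det3_K)
    show "(\<lambda>z. N i z l j) \<in> K" if "l < 3" for l j
      unfolding N_def using r[OF that] Jac_K[OF that] by (cases "j = i") simp_all
  qed
  have J: "(\<lambda>z. det3 (Jac z)) \<in> K" by (rule det3_K) (rule Jac_K)
  have sys: "alp k z * Jac z l 0 + bet k z * Jac z l 1 + gam k z * Jac z l 2 = r z l" if "good z" "l < 3" for z l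
    using nab_structure[OF that(1) regular_frac_at[OF regular_iterates[OF inv_iterates[OF that(2)]] that(1)], of k]
    by (simp add: Jac_def r_def)
  note q = K_divide[OF N J det3_Jac_nonzero]
  have e: "weakly (\<lambda>z. det3 (N 0 z) / det3 (Jac z) = alp k z \<and> det3 (N 1 z) / det3 (Jac z) = bet k z
      \<and> det3 (N 2 z) / det3 (Jac z) = gam k z)"
  proof (rule weakly_mono[OF weakly_conj[OF weakly_good det3_Jac_nonzero]])
    fix z assume "good z \<and> det3 (Jac z) \<noteq> 0"
    then show "det3 (N 0 z) / det3 (Jac z) = alp k z \<and> det3 (N 1 z) / det3 (Jac z) = bet k z
      \<and> det3 (N 2 z) / det3 (Jac z) = gam k z"
      using cramer3[of "alp k z" "Jac z" "bet k z" "gam k z" "r z", OF sys]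
      unfolding N_def by (simp add: field_simps)
  qed
  show "alp k \<in> K" by (rule K_cong[OF q[of 0] ratl_regular[OF regular_structure(4)] weakly_mono[OF e]]) simp
  show "bet k \<in> K" by (rule K_cong[OF q[of 1] ratl_regular[OF regular_structure(3)] weakly_mono[OF e]]) simp
  show "gam k \<in> K" by (rule K_cong[OF q[of 2] ratl_regular[OF regular_structure(2)] weakly_mono[OF e]]) simp
qed

subsection \<open>Coordinates of low order\<close>

lemma pivot_level:
  "pivot (5 * n) = Jet Ud (n, 1, 0)" "pivot (5 * n + 1) = Jet Ud (n, 2, 0)" "pivot (5 * n + 2) = Jet Ud (n, 1, 1)"
  "pivot (5 * n + 3) = Jet Ud (n, 0, 0)" "pivot (5 * n + 4) = Jet Vd (n, 0, 0)"
proof -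
  have *: "pivot (5 * n + k) = [Jet Ud (n, 1, 0), Jet Ud (n, 2, 0), Jet Ud (n, 1, 1), Jet Ud (n, 0, 0), Jet Vd (n, 0, 0)] ! k"
    if "k < 5" for k
    using that unfolding pivot_def by (simp add: div_mult_self4)
  show "pivot (5 * n) = Jet Ud (n, 1, 0)" "pivot (5 * n + 1) = Jet Ud (n, 2, 0)" "pivot (5 * n + 2) = Jet Ud (n, 1, 1)"
    "pivot (5 * n + 3) = Jet Ud (n, 0, 0)" "pivot (5 * n + 4) = Jet Vd (n, 0, 0)"
    using *[of 0] *[of 1] *[of 2] *[of 3] *[of 4] by simp_all
qed

lemma pivot_cases: "\<exists>n. pivot m \<in> {Jet Ud (n, 1, 0), Jet Ud (n, 2, 0), Jet Ud (n, 1, 1), Jet Ud (n, 0, 0), Jet Vd (n, 0, 0)}"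
proof -
  have "m mod 5 = 0 \<or> m mod 5 = 1 \<or> m mod 5 = 2 \<or> m mod 5 = 3 \<or> m mod 5 = 4" by presburger
  then show ?thesis unfolding pivot_def by (elim disjE) auto
qed

lemma K_pivot:
  "(\<lambda>z. z (Jet Ud (n, 1, 0))) \<in> K" "(\<lambda>z. z (Jet Ud (n, 2, 0))) \<in> K" "(\<lambda>z. z (Jet Ud (n, 1, 1))) \<in> K"
  "(\<lambda>z. z (Jet Ud (n, 0, 0))) \<in> K" "(\<lambda>z. z (Jet Vd (n, 0, 0))) \<in> K"
proof -
  have "(\<lambda>z. z (pivot m)) \<in> K" for m
    by (rule K_gen, rule UnI2) (auto simp: pivots_def)
  from this[of "5 * n"] this[of "5 * n + 1"] this[of "5 * n + 2"] this[of "5 * n + 3"] this[of "5 * n + 4"]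
  show "(\<lambda>z. z (Jet Ud (n, 1, 0))) \<in> K" "(\<lambda>z. z (Jet Ud (n, 2, 0))) \<in> K" "(\<lambda>z. z (Jet Ud (n, 1, 1))) \<in> K"
    "(\<lambda>z. z (Jet Ud (n, 0, 0))) \<in> K" "(\<lambda>z. z (Jet Vd (n, 0, 0))) \<in> K"
    unfolding pivot_level .
qed

lemma K_div: "f \<in> K \<Longrightarrow> (\<lambda>z. f z / u_x z) \<in> K" "f \<in> K \<Longrightarrow> (\<lambda>z. f z / u_xx z) \<in> K"
  by (rule K_divide[OF _ K_pivot(1)] K_divide[OF _ K_pivot(2)], assumption,
      rule weakly_mono[OF weakly_good], simp add: good_def)+

lemma K_eqI: "e \<in> K \<Longrightarrow> ratl f \<Longrightarrow> (\<And>z. z \<in> equation_inf \<Longrightarrow> good z \<Longrightarrow> e z = f z) \<Longrightarrow> f \<in> K"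
  by (rule K_cong, assumption, assumption, rule weakly_mono[OF weakly_good]) blast

lemma ratl_jet: "ratl (\<lambda>z. z (Jet \<alpha> \<sigma>))"
  by (intro ratl_jpoly jpoly_jet)

text \<open>Linear in \<open>u_xxx\<close> with coefficients in the pivots, hence determines it;
  \<open>gam_y\<close> then does the same for \<open>u_xxy\<close>.\<close>

lemma gam_x:
  assumes "good z"
  shows "gam Xi z = u_x z * u_xxx z / (u_xx z)\<^sup>2 - 3"
proof -
  have nz: "u_x z \<noteq> 0" "u_xx z \<noteq> 0" using assms by (auto simp: good_def)
  show ?thesis
    using nz by (simp add: gam_def comm_coef_def nab_ncoef D_ncoef[OF assms] D_simps alg_intros flip: numeral_2_eq_2)
      (simp add: ncoef_def field_simps eval_nat_numeral)
qed

lemma gam_y: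
  assumes "good z"
  shows "gam Yi z = (u_xy z * u_xxx z / u_xx z - u_xxy z) / (u_x z * u_xx z)"
proof -
  have nz: "u_x z \<noteq> 0" "u_xx z \<noteq> 0" using assms by (auto simp: good_def)
  show ?thesis
    using nz by (simp add: gam_def comm_coef_def nab_ncoef D_ncoef[OF assms] D_simps alg_intros flip: numeral_2_eq_2)
      (simp add: ncoef_def field_simps eval_nat_numeral)
qed

text \<open>The mixed derivative of u in t and x enters through \<open>nab Ti\<close> of
  \<open>1 / u_x\<close>; eliminating it by the equation leaves a linear relation between
  \<open>u_xyy\<close> and \<open>u_yy\<close> over known quantities.\<close>

lemma bet_y:
  assumes "good z" "z \<in> equation_inf"
  shows "u_x z * u_xyy z - u_xx z * u_yy z = - (u_x z ^ 4 / 2) * (bet Yi z - gam Yi z)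
    + (u_x z)\<^sup>2 * (u_xy z * u_xxy z / u_x z / u_xx z - gam Yi z * u_xy z) - (u_xy z)\<^sup>2"
proof -
  have nz: "u_x z \<noteq> 0" "u_xx z \<noteq> 0" using assms by (auto simp: good_def)
  have "comm_coef Yi Ti Yi z = (u_xy z / (u_x z * u_xx z)) * D Xi (ncoef Ti Yi) z - D Yi (ncoef Ti Yi) z / u_x z
      - (u_xx z / u_x z ^ 3 * z (Jet Ud (1, 1, 0)) + ncoef Ti Xi z * u_xx z + ncoef Ti Yi z * u_xy z) / (u_x z)\<^sup>2"
    by (simp add: comm_coef_def nab_ncoef[of Yi "ncoef Ti Yi"] nab_ncoef[of Ti "ncoef Yi Yi"] D_ncoef[OF assms(1), of _ Yi Yi]
        alg_intros D_uminus flip: numeral_2_eq_2) (simp add: ncoef_def add_divide_distrib)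
  then have "bet Yi z = - u_x z * ((u_xy z / (u_x z * u_xx z)) * D Xi (ncoef Ti Yi) z - D Yi (ncoef Ti Yi) z / u_x z
      - (u_xx z / u_x z ^ 3 * z (Jet Ud (1, 1, 0)) + ncoef Ti Xi z * u_xx z + ncoef Ti Yi z * u_xy z) / (u_x z)\<^sup>2
      - gam Yi z * ncoef Ti Yi z)"
    by (simp add: bet_def)
  moreover have "D Xi (ncoef Ti Yi) z = (3 * u_x z * u_xx z + u_0 z * u_xxx z - 2 * u_xxy z) / u_x z ^ 3
      - 3 * u_xx z * (u_x z * u_x z + u_0 z * u_xx z - 2 * u_xy z) / u_x z ^ 4"
    using nz by (simp add: D_ncoef[OF assms(1)] D_simps alg_intros flip: numeral_2_eq_2) (simp add: field_simps eval_nat_numeral)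
  moreover have "D Yi (ncoef Ti Yi) z = (2 * u_x z * u_xy z + u_y z * u_xx z + u_0 z * u_xxy z - 2 * u_xyy z) / u_x z ^ 3
      - 3 * u_xy z * (u_x z * u_x z + u_0 z * u_xx z - 2 * u_xy z) / u_x z ^ 4"
    using nz by (simp add: D_ncoef[OF assms(1)] D_simps alg_intros flip: numeral_2_eq_2) (simp add: field_simps eval_nat_numeral)
  ultimately show ?thesis
    using nz by (simp add: gam_y[OF assms(1)] ncoef_def eqn_u_tx[OF assms(2), simplified]) (simp add: field_simps eval_nat_numeral)
qed

lemma K_u_xxx: "u_xxx \<in> K"
proof (rule K_eqI[OF _ ratl_jet])
  show "(\<lambda>z. (gam Xi z + 3) * (u_xx z)\<^sup>2 / u_x z) \<in> K"
    by (intro K_intros K_div K_pivot structure_K)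
qed (simp add: gam_x good_def)

lemma K_u_xxy: "u_xxy \<in> K"
proof (rule K_eqI[OF _ ratl_jet])
  show "(\<lambda>z. u_xy z * u_xxx z / u_xx z - u_x z * u_xx z * gam Yi z) \<in> K"
    by (intro K_intros K_div K_pivot structure_K K_u_xxx)
qed (simp add: gam_y good_def)

lemma nab_x_I2:
  assumes "good z"
  shows "nab Xi I2 z = (D Xi I2_num z * u_x z - 4 * I2_num z * u_xx z) / (u_x z ^ 4 * u_xx z)"
  using assms by (simp add: nab_ncoef ncoef_def D_I2 good_def flip: numeral_2_eq_2) (simp add: field_simps eval_nat_numeral)

lemma I2_num_eq: "good z \<Longrightarrow> I2_num z = I2 z * u_x z ^ 4"
  using I2_frac by (simp add: is_frac_def good_def)

lemma D_x_I2_num: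
  assumes "good z"
  shows "D Xi I2_num z = nab Xi I2 z * u_x z ^ 3 * u_xx z + 4 * I2 z * u_x z ^ 3 * u_xx z"
  unfolding nab_x_I2[OF assms] I2_num_eq[OF assms]
  using assms by (simp add: good_def field_simps eval_nat_numeral)

text \<open>The unknowns \<open>u_y\<close>, \<open>v_x\<close>, \<open>u_yy\<close>,
  \<open>u_xyy\<close>, \<open>v_xx\<close> satisfy five linear equations: the first equation and
  its x-derivative, \<open>I2\<close>, its derivative along \<open>nab Xi\<close>, and
  \<open>bet_y\<close>. The t-derivatives of \<open>u_x\<close> and \<open>u_xx\<close> are pivots
  and count as known.\<close>

lemma K_low: "u_xyy \<in> K" "u_yy \<in> K" "v_x \<in> K" "u_y \<in> K"
proof -
  define e3 where "e3 = (\<lambda>z. - (u_x z ^ 4 / 2) * (bet Yi z - gam Yi z)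
    + (u_x z)\<^sup>2 * (u_xy z * u_xxy z / u_x z / u_xx z - gam Yi z * u_xy z) - (u_xy z)\<^sup>2)"
  define e1 where "e1 = (\<lambda>z. z (Jet Ud (1, 1, 0)) + u_0 z * u_xy z + v_0 z * u_xx z)"
  define e2 where "e2 = (\<lambda>z. (I2 z * u_x z ^ 4 - u_x z * u_x z * u_xy z + u_xy z * u_xy z) / u_xx z)"
  define e4 where "e4 = (\<lambda>z. z (Jet Ud (1, 2, 0)) + 2 * u_x z * u_xy z + u_0 z * u_xxy z + v_0 z * u_xxx z)"
  define e5 where "e5 = (\<lambda>z. (nab Xi I2 z * u_x z ^ 3 * u_xx z + 4 * I2 z * u_x z ^ 3 * u_xx z - 2 * u_x z * u_xx z * u_xy z
    - u_x z * u_x z * u_xxy z + 2 * u_xy z * u_xxy z - u_xxx z * e2 z) / u_xx z)"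
  have c2: "(\<lambda>z. f z / 2) \<in> K" if "f \<in> K" for f
    using K_intros(3)[OF K_intros(1)[of "1/2"] that] by simp
  note K_all = K_intros K_div c2 K_pivot structure_K K_u_xxx K_u_xxy
    K_iterates[OF iterates_I2] K_iterates[OF iterates_nab[OF iterates_I2]]
  have e: "e1 \<in> K" "e2 \<in> K" "e3 \<in> K" "e4 \<in> K"
    unfolding e1_def e2_def e3_def e4_def by (intro K_all)+
  then have e': "e5 \<in> K" unfolding e5_def by (intro K_all)
  have 1: "u_yy z - u_x z * u_y z - u_x z * v_x z = e1 z" if "z \<in> equation_inf" for z
    using eqn_u_tx[OF that] unfolding e1_def by (simp add: algebra_simps)
  have 2: "u_x z * v_x z + u_yy z = e2 z" if "good z" for z
    using I2_num_eq[OF that] that unfolding e2_def I2_num_def by (simp add: good_def field_simps)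
  have 3: "u_x z * u_xyy z - u_xx z * u_yy z = e3 z" if "good z" "z \<in> equation_inf" for z
    using bet_y[OF that] unfolding e3_def .
  have 4: "u_xyy z - u_xx z * u_y z - u_x z * v_xx z - 2 * u_xx z * v_x z = e4 z" if "z \<in> equation_inf" for z
    using eqn_u_txx[OF that] unfolding e4_def by (simp add: algebra_simps)
  have 5: "u_xx z * v_x z + u_x z * v_xx z + u_xyy z = e5 z" if "good z" for z
    using D_x_I2_num[OF that] that unfolding e5_def D_I2_num 2[OF that, symmetric]
    by (simp add: good_def field_simps)
  \<comment> \<open>In \<open>e4 + e5\<close> the unknown \<open>v_xx\<close> cancels; subtracting a
    multiple of \<open>e1\<close> removes \<open>u_y\<close> and \<open>v_x\<close>, and subtracting
    \<open>e3\<close> removes \<open>u_yy\<close>.\<close>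
  have A: "(u_x z * (e4 z + e5 z) - u_xx z * e1 z - e3 z) / u_x z = u_xyy z" if "z \<in> equation_inf" "good z" for z
    using that unfolding 1[OF that(1), symmetric] 3[OF that(2,1), symmetric] 4[OF that(1), symmetric] 5[OF that(2), symmetric]
    by (simp add: good_def field_simps)
  show xyy: "u_xyy \<in> K"
  proof (rule K_eqI[OF _ ratl_jet])
    show "(\<lambda>z. (u_x z * (e4 z + e5 z) - u_xx z * e1 z - e3 z) / u_x z) \<in> K" by (intro K_all e e')
  qed (rule A)
  show yy: "u_yy \<in> K"
  proof (rule K_eqI[OF _ ratl_jet])
    show "(\<lambda>z. (u_x z * u_xyy z - e3 z) / u_xx z) \<in> K" by (intro K_all e xyy)
    show "(u_x z * u_xyy z - e3 z) / u_xx z = u_yy z" if "z \<in> equation_inf" "good z" for z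
      using 3[OF that(2,1)] that by (simp add: good_def field_simps)
  qed
  show vx: "v_x \<in> K"
  proof (rule K_eqI[OF _ ratl_jet])
    show "(\<lambda>z. (e2 z - u_yy z) / u_x z) \<in> K" by (intro K_all e yy)
    show "(e2 z - u_yy z) / u_x z = v_x z" if "z \<in> equation_inf" "good z" for z
      using 2[OF that(2)] that by (simp add: good_def field_simps)
  qed
  show "u_y \<in> K"
  proof (rule K_eqI[OF _ ratl_jet])
    show "(\<lambda>z. (u_yy z - e1 z) / u_x z - v_x z) \<in> K" by (intro K_all e yy vx)
    show "(u_yy z - e1 z) / u_x z - v_x z = u_y z" if "z \<in> equation_inf" "good z" for z
      using 1[OF that(1)] that by (simp add: good_def field_simps)
  qed
qed

subsection \<open>Closure under total derivatives\<close>

text \<open>Inverts the triangular coefficient matrix of the three derivations.\<close>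

lemma D_nab:
  assumes "good z"
  shows "D Xi f z = u_xx z * nab Xi f z / u_x z"
    "D Yi f z = u_xy z * nab Xi f z / u_x z - u_x z * nab Yi f z"
    "D Ti f z = (u_x z ^ 3 * nab Ti f z - nnum Ti Xi z * D Xi f z - nnum Ti Yi z * D Yi f z) / u_xx z"
  using assms by (simp_all add: nab_def good_def field_simps del: nnum.simps(7,8))

lemma K_nnum: "nnum Ti Xi \<in> K" "nnum Ti Yi \<in> K"
  unfolding nnum.simps by (intro K_intros K_pivot K_low)+

lemma K_D_iterates:
  assumes "f \<in> iterates"
  shows "D i f \<in> K"
proof -
  note r = ratl_D[OF ratl_regular[OF regular_iterates[OF assms]]]
  note K_all = K_intros K_div K_pivot K_low K_nnum K_iterates[OF iterates_nab[OF assms]]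
  have x: "D Xi f \<in> K"
  proof (rule K_eqI[OF _ r])
    show "(\<lambda>z. u_xx z * nab Xi f z / u_x z) \<in> K" by (intro K_all)
  qed (rule D_nab(1)[symmetric])
  have y: "D Yi f \<in> K"
  proof (rule K_eqI[OF _ r])
    show "(\<lambda>z. u_xy z * nab Xi f z / u_x z - u_x z * nab Yi f z) \<in> K" by (intro K_all)
  qed (rule D_nab(2)[symmetric])
  have t: "D Ti f \<in> K"
  proof (rule K_eqI[OF _ r])
    show "(\<lambda>z. (u_x z ^ 3 * nab Ti f z - nnum Ti Xi z * D Xi f z - nnum Ti Yi z * D Yi f z) / u_xx z) \<in> K"
      by (intro K_all x y)
  qed (rule D_nab(3)[symmetric])
  show ?thesis using x y t by (cases i) auto
qed

text \<open>Iterates are covered by \<open>K_D_iterates\<close>, so closure under a total derivative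
  reduces to the shifted pivots.\<close>

lemma K_D:
  assumes "\<And>n. (\<lambda>z. z (Jet Ud (inc i (n, 1, 0)))) \<in> K" "\<And>n. (\<lambda>z. z (Jet Ud (inc i (n, 2, 0)))) \<in> K"
    "\<And>n. (\<lambda>z. z (Jet Ud (inc i (n, 1, 1)))) \<in> K" "\<And>n. (\<lambda>z. z (Jet Ud (inc i (n, 0, 0)))) \<in> K"
    "\<And>n. (\<lambda>z. z (Jet Vd (inc i (n, 0, 0)))) \<in> K" and f: "f \<in> K"
  shows "D i f \<in> K"
proof (rule generators.rfield_D[OF generators_gens _ f])
  fix g assume "g \<in> gens"
  then consider "g \<in> iterates" | m where "g = (\<lambda>z. z (pivot m))" by (auto simp: pivots_def)
  then show "D i g \<in> K"
  proof cases
    case 2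
    then show ?thesis using pivot_cases[of m] assms(1-5) by (auto simp del: inc.simps)
  qed (rule K_D_iterates)
qed

text \<open>The t-derivative of a pivot is the corresponding pivot of the next level.\<close>

lemma K_D_t: "f \<in> K \<Longrightarrow> D Ti f \<in> K"
  by (rule K_D) (simp_all only: inc.simps K_pivot)

lemma K_shift_t: "(\<lambda>z. z (Jet \<alpha> (0, j, l))) \<in> K \<Longrightarrow> (\<lambda>z. z (Jet \<alpha> (n, j, l))) \<in> K"
proof (induction n)
  case (Suc n)
  then show ?case using K_D_t[of "\<lambda>z. z (Jet \<alpha> (n, j, l))"] by simp
qed

lemma K_D_x: "f \<in> K \<Longrightarrow> D Xi f \<in> K"
proof (rule K_D)
  fix n
  show "(\<lambda>z. z (Jet Ud (inc Xi (n, 1, 0)))) \<in> K" using K_pivot(2)[of n] by (simp add: numeral_2_eq_2)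
  show "(\<lambda>z. z (Jet Ud (inc Xi (n, 2, 0)))) \<in> K" using K_shift_t[OF K_u_xxx, of n] by (simp add: numeral_eq_Suc)
  show "(\<lambda>z. z (Jet Ud (inc Xi (n, 1, 1)))) \<in> K" using K_shift_t[OF K_u_xxy, of n] by (simp add: numeral_eq_Suc)
  show "(\<lambda>z. z (Jet Ud (inc Xi (n, 0, 0)))) \<in> K" using K_pivot(1)[of n] by simp
  show "(\<lambda>z. z (Jet Vd (inc Xi (n, 0, 0)))) \<in> K" using K_shift_t[OF K_low(3), of n] by simp
qed

text \<open>The coordinate still missing for closure under the y-derivative. Up to known terms and
  factors, the y-derivative of \<open>F\<close> contains \<open>u_x v_xy + u_xx v_y + u_yyy\<close>
  and that of \<open>I2\<close> contains \<open>u_x v_xy + u_yyy\<close>; the difference isolates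
  \<open>v_y\<close>.\<close>

lemma K_v_y: "v_y \<in> K"
proof -
  define F where "F = nab Ti (\<lambda>z. u_x z)"
  define G where "G = (\<lambda>z. u_xx z * z (Jet Ud (1, 1, 0)) + nnum Ti Xi z * u_xx z + nnum Ti Yi z * u_xy z)"
  have regF: "regular F" unfolding F_def by (intro regular_nab regular_jpoly jpoly_jet)
  note rF = ratl_regular[OF regF]
  have G_alg: "G \<in> alg" unfolding G_def by (intro alg_intros nnum_alg)
  have FG: "is_frac F G (\<lambda>z. u_x z ^ 3)"
    unfolding is_frac_def using G_alg
    by (auto simp: F_def G_def nab_def intro!: alg_intros simp del: nnum.simps(7,8) simp flip: numeral_2_eq_2)
      (simp add: field_simps)
  have FGz: "F z * u_x z ^ 3 = G z" if "good z" for z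
    using FG that by (simp add: is_frac_def good_def)
  note K_all = K_intros K_div K_pivot K_low K_u_xxx K_u_xxy structure_K K_nnum K_iterates[OF iterates_I2] K_D_iterates[OF iterates_I2]
  have FK: "F \<in> K"
  proof (rule K_eqI[OF _ rF])
    show "(\<lambda>z. G z / u_x z / u_x z / u_x z) \<in> K" unfolding G_def by (intro K_all)
    show "G z / u_x z / u_x z / u_x z = F z" if "good z" for z
      using FGz[OF that] that by (simp add: good_def field_simps eval_nat_numeral)
  qed
  have q0: "nab Yi (\<lambda>z. u_x z) z = 0" if "good z" for z
    using that by (simp add: nab_def good_def flip: numeral_2_eq_2)
  have q1: "nab Xi (\<lambda>z. u_x z) z = u_x z" if "good z" for z
    using that by (simp add: nab_def good_def flip: numeral_2_eq_2)
  have q2: "nab Ti (nab Yi (\<lambda>z. u_x z)) z = 0" if z: "good z" for z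
  proof -
    have "is_frac (nab Yi (\<lambda>z. u_x z)) (\<lambda>z. 0) (\<lambda>z. (u_x z * u_xx z) ^ Suc 0)"
      unfolding is_frac_def using q0 good_iff[of _ 0] by (auto intro!: alg_intros)
    from Lie_frac[OF this] have "D i (nab Yi (\<lambda>z. u_x z)) z = 0" for i
      using z good_iff[of z 0] by (simp add: D_def)
    then show ?thesis by (simp add: nab_def)
  qed
  \<comment> \<open>\<open>nab Yi\<close> annihilates \<open>u_x\<close> and \<open>nab Xi\<close>
    reproduces it, so the commutator with \<open>nab Ti\<close> expresses \<open>nab Yi F\<close>
    through structure functions. Expanding it directly would only bring back the unknowns
    \<open>v_xy\<close>, \<open>v_y\<close> and \<open>u_yyy\<close>.\<close>
  have Y: "nab Yi F z = alp Yi z * u_x z + gam Yi z * F z" if "good z" for z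
    using nab_structure[OF that frac_at_alg[OF alg_jet], of Yi Ud "(0, 1, 0)"] q0[OF that] q1[OF that] q2[OF that]
    by (simp add: F_def)
  have DyF: "D Yi F \<in> K"
  proof (rule K_eqI[OF _ ratl_D[OF rF]])
    show "(\<lambda>z. u_xy z * D Xi F z / u_xx z - u_x z * (alp Yi z * u_x z + gam Yi z * F z)) \<in> K"
      by (intro K_all K_D_x FK)
    show "u_xy z * D Xi F z / u_xx z - u_x z * (alp Yi z * u_x z + gam Yi z * F z) = D Yi F z" if "good z" for z
      using that unfolding D_nab(2)[OF that] D_nab(1)[OF that] Y[OF that] by (simp add: good_def field_simps)
  qed
  have DyG: "D Yi G z = u_xxy z * z (Jet Ud (1, 1, 0)) + u_xx z * z (Jet Ud (1, 1, 1))
      + (v_xy z * u_x z + v_x z * u_xy z + v_y z * u_xx z + v_0 z * u_xxy z + u_yyy z) * u_xx z + nnum Ti Xi z * u_xxy z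
      + (2 * u_x z * u_xy z + u_y z * u_xx z + u_0 z * u_xxy z - 2 * u_xyy z) * u_xy z + nnum Ti Yi z * u_xyy z" for z
    unfolding G_def nnum.simps by (simp add: D_simps alg_intros flip: numeral_2_eq_2) (simp add: algebra_simps)
  have DyFG: "D Yi G z = D Yi F z * u_x z ^ 3 + 3 * F z * (u_x z)\<^sup>2 * u_xy z" if "good z" for z
  proof -
    have "D Yi F z = (D Yi G z * u_x z ^ 3 - G z * (3 * (u_x z)\<^sup>2 * u_xy z)) / (u_x z ^ 3)\<^sup>2"
      using Lie_frac[OF FG, of z "total_field Yi"] that by (simp add: D_def good_def Lie_power alg_intros)
    also have "\<dots> = u_x z ^ 3 * (D Yi G z - 3 * F z * (u_x z)\<^sup>2 * u_xy z) / (u_x z ^ 3 * u_x z ^ 3)"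
      unfolding FGz[OF that, symmetric] by (simp add: algebra_simps power2_eq_square)
    also have "\<dots> = (D Yi G z - 3 * F z * (u_x z)\<^sup>2 * u_xy z) / u_x z ^ 3"
      by (rule nonzero_mult_divide_mult_cancel_left) (use that in \<open>simp add: good_def\<close>)
    finally show ?thesis using that by (simp add: good_def field_simps)
  qed
  have DyI: "D Yi I2_num z = D Yi I2 z * u_x z ^ 4 + 4 * I2 z * u_x z ^ 3 * u_xy z" if "good z" for z
  proof -
    have "D Yi I2 z = u_x z * (D Yi I2_num z - 4 * I2 z * u_x z ^ 3 * u_xy z) / (u_x z * u_x z ^ 4)"
      using that D_I2[of z Yi] unfolding I2_num_eq[OF that] by (simp add: good_def algebra_simps eval_nat_numeral)
    also have "\<dots> = (D Yi I2_num z - 4 * I2 z * u_x z ^ 3 * u_xy z) / u_x z ^ 4"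
      by (rule nonzero_mult_divide_mult_cancel_left) (use that in \<open>simp add: good_def\<close>)
    finally show ?thesis using that by (simp add: good_def field_simps)
  qed
  define e6 where "e6 = (\<lambda>z. (D Yi F z * u_x z ^ 3 + 3 * F z * (u_x z)\<^sup>2 * u_xy z - u_xxy z * z (Jet Ud (1, 1, 0))
      - u_xx z * z (Jet Ud (1, 1, 1)) - nnum Ti Xi z * u_xxy z
      - (2 * u_x z * u_xy z + u_y z * u_xx z + u_0 z * u_xxy z - 2 * u_xyy z) * u_xy z - nnum Ti Yi z * u_xyy z) / u_xx z
      - v_x z * u_xy z - v_0 z * u_xxy z)"
  define e8 where "e8 = (\<lambda>z. (D Yi I2 z * u_x z ^ 4 + 4 * I2 z * u_x z ^ 3 * u_xy z - 2 * u_x z * u_xy z * u_xy z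
      - u_x z * u_x z * u_xyy z - u_xy z * u_xx z * v_x z - u_x z * u_xxy z * v_x z - u_xxy z * u_yy z
      + 2 * u_xy z * u_xyy z) / u_xx z)"
  have 6: "v_xy z * u_x z + v_y z * u_xx z + u_yyy z = e6 z" if "good z" for z
    using that unfolding e6_def DyFG[OF that, symmetric] DyG by (simp add: good_def field_simps del: nnum.simps(7,8))
  have 8: "u_x z * v_xy z + u_yyy z = e8 z" if "good z" for z
    using that unfolding e8_def DyI[OF that, symmetric] D_I2_num by (simp add: good_def field_simps)
  show ?thesis
  proof (rule K_eqI[OF _ ratl_jet])
    have "e6 \<in> K" "e8 \<in> K" unfolding e6_def e8_def by (intro K_all DyF FK)+
    then show "(\<lambda>z. (e6 z - e8 z) / u_xx z) \<in> K" by (intro K_all)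
    show "(e6 z - e8 z) / u_xx z = v_y z" if "good z" for z
      using that unfolding 6[OF that, symmetric] 8[OF that, symmetric] by (simp add: good_def field_simps)
  qed
qed

lemma K_D_y: "f \<in> K \<Longrightarrow> D Yi f \<in> K"
proof (rule K_D)
  fix n
  show "(\<lambda>z. z (Jet Ud (inc Yi (n, 1, 0)))) \<in> K" using K_pivot(3)[of n] by simp
  show "(\<lambda>z. z (Jet Ud (inc Yi (n, 2, 0)))) \<in> K" using K_shift_t[OF K_u_xxy, of n] by simp
  show "(\<lambda>z. z (Jet Ud (inc Yi (n, 1, 1)))) \<in> K" using K_shift_t[OF K_low(1), of n] by (simp flip: numeral_2_eq_2)
  show "(\<lambda>z. z (Jet Ud (inc Yi (n, 0, 0)))) \<in> K" using K_shift_t[OF K_low(4), of n] by simp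
  show "(\<lambda>z. z (Jet Vd (inc Yi (n, 0, 0)))) \<in> K" using K_shift_t[OF K_v_y, of n] by simp
qed

lemma K_jet: "(\<lambda>z. z (Jet \<alpha> \<sigma>)) \<in> K"
proof (induction \<sigma> rule: mindex_induct)
  case zero
  show ?case using K_pivot(4,5)[of 0] by (cases \<alpha>) auto
next
  case (inc i \<sigma>)
  have "D i (\<lambda>z. z (Jet \<alpha> \<sigma>)) \<in> K"
    using K_D_t[OF inc] K_D_x[OF inc] K_D_y[OF inc] by (cases i) blast+
  then show ?case by simp
qed

lemma jpoly_K: "f \<in> jpoly \<Longrightarrow> f \<in> K"
  by (induction rule: cpoly_induct) (auto intro: K_intros K_jet)

section \<open>Symmetries that move a single pivot\<close>

text \<open>Vanishing to order \<open>n\<close> along the t-derivative at one point. These functions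
  form an ideal of \<open>alg\<close>, so flat coefficients make entire terms of a prolongation
  negligible.\<close>

definition flat :: "nat \<Rightarrow> jet \<Rightarrow> (jet \<Rightarrow> real) set" where
  "flat n z = {f \<in> alg. \<forall>k<n. (D Ti ^^ k) f z = 0}"

lemma flat_0: "flat 0 z = alg"
  by (simp add: flat_def)

lemma flat_Suc: "f \<in> flat (Suc n) z \<longleftrightarrow> f \<in> alg \<and> f z = 0 \<and> D Ti f \<in> flat n z"
  by (auto simp: flat_def D_alg less_Suc_eq_0_disj funpow_swap1)

lemma flat_alg: "f \<in> flat n z \<Longrightarrow> f \<in> alg"
  by (simp add: flat_def)

lemma flat_mono: "m \<le> n \<Longrightarrow> f \<in> flat n z \<Longrightarrow> f \<in> flat m z"
  by (auto simp: flat_def)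

lemma flat_zero: "(\<lambda>z. 0) \<in> flat n z"
  by (induction n) (auto simp: flat_Suc flat_0 intro: alg_intros)

lemma flat_add: "f \<in> flat n z \<Longrightarrow> g \<in> flat n z \<Longrightarrow> (\<lambda>z. f z + g z) \<in> flat n z"
  by (induction n arbitrary: f g) (auto simp: flat_Suc flat_0 D_add intro: alg_intros)

lemma flat_mult: "f \<in> flat n z \<Longrightarrow> g \<in> alg \<Longrightarrow> (\<lambda>z. f z * g z) \<in> flat n z"
proof (induction n arbitrary: f g)
  case (Suc n)
  then have "f \<in> flat n z" using flat_mono[of n "Suc n"] by auto
  with Suc show ?case
    by (auto simp: flat_Suc D_mult D_alg intro!: alg_intros flat_add)
qed (auto simp: flat_0 intro: alg_intros)

lemma D_funpow_add: "f \<in> alg \<Longrightarrow> g \<in> alg \<Longrightarrow> (D i ^^ n) (\<lambda>z. f z + g z) = (\<lambda>z. (D i ^^ n) f z + (D i ^^ n) g z)"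
  by (induction n) (simp_all add: D_add D_funpow_alg)

text \<open>In the Leibniz expansion every term except the leading one contains a lower derivative
  of \<open>f\<close>, which vanishes at \<open>z\<close>.\<close>

lemma flat_top_mult:
  assumes "f \<in> flat n z" "g \<in> alg"
  shows "(D Ti ^^ n) (\<lambda>z. f z * g z) z = (D Ti ^^ n) f z * g z"
  using assms
proof (induction n arbitrary: f g)
  case (Suc n)
  then have f: "f \<in> alg" "D Ti f \<in> flat n z" "f \<in> flat n z" using flat_mono[of n "Suc n"] by (auto simp: flat_Suc)
  have "(D Ti ^^ n) f z = 0" using Suc.prems(1) by (simp add: flat_def)
  then show ?case
    using Suc.IH[OF f(2) Suc.prems(2)] Suc.IH[OF f(3) D_alg[OF Suc.prems(2)]] Suc.prems(2) f(1)
    by (simp add: funpow_swap1 D_mult D_funpow_add D_alg alg_intros del: funpow.simps(2) flip: funpow_swap1)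
      (simp add: funpow_swap1 D_mult D_funpow_add D_alg alg_intros)
qed simp

text \<open>The commutator with the t-derivative has the coefficients \<open>D Ti\<close> of the
  base components. If these are flat, t-derivatives can be pulled out of the prolongation up to
  order \<open>n\<close>.\<close>

lemma prolong_flat:
  assumes X: "smooth_field X" and f: "f \<in> alg"
    and \<xi>: "\<And>j. D Ti (\<lambda>z. base_comp j (X (pt z))) \<in> flat n z"
    and i: "i \<le> n"
  shows "Lie (prolong X) ((D Ti ^^ i) f) z = (D Ti ^^ i) (Lie (prolong X) f) z"
proof -
  have Xf: "Lie (prolong X) f \<in> alg" by (rule Lie_alg[OF f prolong_alg[OF X]])
  \<comment> \<open>Strengthened for the induction: the difference itself is flat, each further
    t-derivative costs one order, and the new commutator terms are flat to order
    \<open>n\<close>.\<close>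
  have "(\<lambda>z. Lie (prolong X) ((D Ti ^^ i) f) z - (D Ti ^^ i) (Lie (prolong X) f) z) \<in> flat (Suc n - i) z"
    using i
  proof (induction i)
    case 0
    then show ?case by (simp add: flat_zero)
  next
    case (Suc i)
    define g where "g = (D Ti ^^ i) f"
    have g: "g \<in> alg" unfolding g_def by (rule D_funpow_alg[OF f])
    have Xg: "Lie (prolong X) g \<in> alg" by (rule Lie_alg[OF g prolong_alg[OF X]])
    have h: "(D Ti ^^ i) (Lie (prolong X) f) \<in> alg" by (rule D_funpow_alg[OF Xf])
    have "(\<lambda>z. Lie (prolong X) g z - (D Ti ^^ i) (Lie (prolong X) f) z) \<in> flat (Suc (n - i)) z"
      using Suc by (simp add: g_def Suc_diff_le)
    then have 1: "(\<lambda>z. D Ti (Lie (prolong X) g) z - D Ti ((D Ti ^^ i) (Lie (prolong X) f)) z) \<in> flat (n - i) z"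
      by (simp add: flat_Suc D_diff Xg h)
    have t: "(\<lambda>z. D Ti (\<lambda>z. base_comp j (X (pt z))) z * (- D j g z)) \<in> flat (n - i) z" for j
      by (intro flat_mult flat_mono[OF _ \<xi>] alg_intros D_alg g) simp
    have e: "(\<lambda>z. Lie (prolong X) (D Ti g) z - D Ti ((D Ti ^^ i) (Lie (prolong X) f)) z) = (\<lambda>z.
      (D Ti (Lie (prolong X) g) z - D Ti ((D Ti ^^ i) (Lie (prolong X) f)) z)
      + (D Ti (\<lambda>z. base_comp Ti (X (pt z))) z * (- D Ti g z) + (D Ti (\<lambda>z. base_comp Xi (X (pt z))) z * (- D Xi g z)
        + D Ti (\<lambda>z. base_comp Yi (X (pt z))) z * (- D Yi g z))))"
      by (simp add: fun_eq_iff prolong_D[OF X g])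
    have "(\<lambda>z. Lie (prolong X) (D Ti g) z - D Ti ((D Ti ^^ i) (Lie (prolong X) f)) z) \<in> flat (n - i) z"
      unfolding e by (rule flat_add[OF 1 flat_add[OF t flat_add[OF t t]]])
    then show ?case by (simp only: funpow.simps comp_def g_def diff_Suc_Suc)
  qed
  then show ?thesis using i by (simp add: Suc_diff_le flat_Suc)
qed

definition origin :: "jet \<Rightarrow> bool" where
  "origin z \<longleftrightarrow> (\<forall>i. z (Base i) = 0)"

text \<open>x and y vanish at the origin and their t-derivatives are identically zero, so they are
  flat to every order.\<close>

lemma flat_base: "origin z \<Longrightarrow> (\<lambda>z. z (Base Xi)) \<in> flat n z" "origin z \<Longrightarrow> (\<lambda>z. z (Base Yi)) \<in> flat n z"
  by (cases n; simp add: flat_Suc flat_0 origin_def flat_zero alg_intros)+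

lemma D_funpow_jet: "(D Ti ^^ n) (\<lambda>z. z (Jet \<alpha> (i, j, l))) = (\<lambda>z. z (Jet \<alpha> (n + i, j, l)))"
  by (induction n) simp_all

lemma D_funpow_base: "origin z \<Longrightarrow> (D Ti ^^ n) (\<lambda>z. z (Base Xi)) z = 0" "origin z \<Longrightarrow> (D Ti ^^ n) (\<lambda>z. z (Base Yi)) z = 0"
  using flat_base[of z "Suc n"] by (auto simp: flat_def)

section \<open>Leading components of prolonged symmetries over the origin\<close>

context symmetry
begin

context
  fixes n z
  assumes z: "origin z"
    and flat: "tm (deriv a) \<in> flat n z" "tm (deriv b) \<in> flat n z" "tm c \<in> flat n z" "tm (deriv d) \<in> flat n z" "tm e \<in> flat n z"
begin

lemma flat_terms:
  "(\<lambda>z. tm (deriv a) z * r) \<in> flat n z" "(\<lambda>z. tm (deriv b) z * r) \<in> flat n z"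
  "g \<in> alg \<Longrightarrow> (\<lambda>z. tm c z * g z) \<in> flat n z" "g \<in> alg \<Longrightarrow> (\<lambda>z. tm (deriv d) z * g z) \<in> flat n z"
  "g \<in> alg \<Longrightarrow> (\<lambda>z. tm e z * g z) \<in> flat n z"
  "g \<in> alg \<Longrightarrow> (\<lambda>z. z (Base Xi) * g z) \<in> flat n z" "g \<in> alg \<Longrightarrow> (\<lambda>z. z (Base Yi) * g z) \<in> flat n z"
  by (intro flat_mult flat flat_base z alg_intros; assumption)+

lemma top_terms:
  "(D Ti ^^ n) (\<lambda>z. tm (deriv a) z * r) z = (D Ti ^^ n) (tm (deriv a)) z * r"
  "(D Ti ^^ n) (\<lambda>z. tm (deriv b) z * r) z = (D Ti ^^ n) (tm (deriv b)) z * r"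
  "g \<in> alg \<Longrightarrow> (D Ti ^^ n) (\<lambda>z. tm c z * g z) z = (D Ti ^^ n) (tm c) z * g z"
  "g \<in> alg \<Longrightarrow> (D Ti ^^ n) (\<lambda>z. tm (deriv d) z * g z) z = (D Ti ^^ n) (tm (deriv d)) z * g z"
  "g \<in> alg \<Longrightarrow> (D Ti ^^ n) (\<lambda>z. tm e z * g z) z = (D Ti ^^ n) (tm e) z * g z"
  "g \<in> alg \<Longrightarrow> (D Ti ^^ n) (\<lambda>z. z (Base Xi) * g z) z = 0"
  "g \<in> alg \<Longrightarrow> (D Ti ^^ n) (\<lambda>z. z (Base Yi) * g z) z = 0"
  by (simp_all add: flat_top_mult flat flat_base z alg_intros D_funpow_base)

lemma flat_D_base_comp: "D Ti (\<lambda>z. base_comp j (X (pt z))) \<in> flat n z"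
proof (cases j)
  case Ti
  then show ?thesis by (simp add: D_base_comp flat)
next
  case Xi
  have "D Ti (\<lambda>z. base_comp Xi (X (pt z))) = (\<lambda>z. tm (deriv a) z * 1 + (z (Base Yi) * (tm (deriv c) z
      + z (Base Yi) * tm (deriv (deriv e)) z) + z (Base Xi) * (2 * tm (deriv e) z)))"
    unfolding D_base_comp by (simp add: fun_eq_iff algebra_simps power2_eq_square)
  also have "\<dots> \<in> flat n z" by (intro flat_add flat_terms alg_intros tm_rules)
  finally show ?thesis using Xi by simp
next
  case Yi
  have "D Ti (\<lambda>z. base_comp Yi (X (pt z))) = (\<lambda>z. tm (deriv b) z * 1 + z (Base Yi) * (1/2 * tm (deriv (deriv d)) z
      + tm (deriv e) z))"
    unfolding D_base_comp by (simp add: fun_eq_iff algebra_simps)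
  also have "\<dots> \<in> flat n z" by (intro flat_add flat_terms alg_intros tm_rules)
  finally show ?thesis using Yi by simp
qed

lemma prolong_level:
  assumes "i \<le> n"
  shows "prolong X z (Jet \<alpha> (i, j, l)) = (D Ti ^^ i) (\<lambda>z. prolong X z (Jet \<alpha> (0, j, l))) z"
  using prolong_flat[OF smooth_field alg_jet flat_D_base_comp assms, of \<alpha> "(0, j, l)"]
  by (simp add: D_funpow_jet)

text \<open>Each summand is written with a flat first factor: a', b', c, d', e, or a base
  coordinate. Derivatives of higher order such as c', d'', e' occur only together with x or
  y.\<close>

lemma phi:
  "(\<lambda>z. prolong X z (Jet Ud (0, 1, 0))) = (\<lambda>z. tm (deriv d) z * (- 1/2 * u_x z) + tm e z * (- u_x z))"
  "(\<lambda>z. prolong X z (Jet Ud (0, 2, 0))) = (\<lambda>z. tm (deriv d) z * (- 1/2 * u_xx z) + tm e z * (- 3 * u_xx z))"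
  "(\<lambda>z. prolong X z (Jet Ud (0, 1, 1))) = (\<lambda>z. tm (deriv d) z * (- u_xy z) + (tm e z * (- 2 * u_xy z) + (tm c z * (- u_xx z)
     + z (Base Yi) * (- 2 * tm (deriv e) z * u_xx z))))"
  "(\<lambda>z. prolong X z (Jet Ud (0, 0, 0))) = (\<lambda>z. tm (deriv b) z * 1 + (tm c z * (- 2) + (tm (deriv d) z * (- 1/2 * u_0 z)
     + (tm e z * u_0 z + z (Base Yi) * (1/2 * tm (deriv (deriv d)) z - 3 * tm (deriv e) z)))))"
  "(\<lambda>z. prolong X z (Jet Vd (0, 0, 0))) = (\<lambda>z. tm (deriv a) z * 1 + (tm c z * u_0 z + (tm (deriv d) z * (- v_0 z)
     + (tm e z * (2 * v_0 z) + (z (Base Yi) * (tm (deriv c) z + z (Base Yi) * tm (deriv (deriv e)) z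
       + 2 * u_0 z * tm (deriv e) z) + z (Base Xi) * (2 * tm (deriv e) z))))))"
  unfolding prolong_u_x prolong_u_xx prolong_u_xy prolong_0 fibre_comp_field
  by (simp_all add: fun_eq_iff algebra_simps power2_eq_square)

lemma phi_flat:
  "(\<lambda>z. prolong X z (Jet Ud (0, 1, 0))) \<in> flat n z" "(\<lambda>z. prolong X z (Jet Ud (0, 2, 0))) \<in> flat n z"
  "(\<lambda>z. prolong X z (Jet Ud (0, 1, 1))) \<in> flat n z" "(\<lambda>z. prolong X z (Jet Ud (0, 0, 0))) \<in> flat n z"
  "(\<lambda>z. prolong X z (Jet Vd (0, 0, 0))) \<in> flat n z"
  unfolding phi by (intro flat_add flat_terms alg_intros tm_rules)+

lemma prolong_below:
  assumes "i < n"
  shows "prolong X z (Jet Ud (i, 1, 0)) = 0" "prolong X z (Jet Ud (i, 2, 0)) = 0" "prolong X z (Jet Ud (i, 1, 1)) = 0"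
    "prolong X z (Jet Ud (i, 0, 0)) = 0" "prolong X z (Jet Vd (i, 0, 0)) = 0"
  unfolding prolong_level[OF less_imp_le[OF assms]] using phi_flat assms by (simp_all add: flat_def)

lemma prolong_top:
  "prolong X z (Jet Ud (n, 1, 0)) = - (1/2 * (D Ti ^^ n) (tm (deriv d)) z + (D Ti ^^ n) (tm e) z) * u_x z"
  "prolong X z (Jet Ud (n, 2, 0)) = - (1/2 * (D Ti ^^ n) (tm (deriv d)) z + 3 * (D Ti ^^ n) (tm e) z) * u_xx z"
  "prolong X z (Jet Ud (n, 1, 1)) = - ((D Ti ^^ n) (tm (deriv d)) z + 2 * (D Ti ^^ n) (tm e) z) * u_xy z - (D Ti ^^ n) (tm c) z * u_xx z"
  "prolong X z (Jet Ud (n, 0, 0)) = (D Ti ^^ n) (tm (deriv b)) z - 2 * (D Ti ^^ n) (tm c) z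
     + ((D Ti ^^ n) (tm e) z - 1/2 * (D Ti ^^ n) (tm (deriv d)) z) * u_0 z"
  "prolong X z (Jet Vd (n, 0, 0)) = (D Ti ^^ n) (tm (deriv a)) z + (D Ti ^^ n) (tm c) z * u_0 z
     + (2 * (D Ti ^^ n) (tm e) z - (D Ti ^^ n) (tm (deriv d)) z) * v_0 z"
proof -
  note fa = flat_terms[THEN flat_alg]
  note rules = top_terms D_funpow_add fa fpoly_intros(2)[where C = UNIV] alg_intros tm_rules
  show "prolong X z (Jet Ud (n, 1, 0)) = - (1/2 * (D Ti ^^ n) (tm (deriv d)) z + (D Ti ^^ n) (tm e) z) * u_x z"
    "prolong X z (Jet Ud (n, 2, 0)) = - (1/2 * (D Ti ^^ n) (tm (deriv d)) z + 3 * (D Ti ^^ n) (tm e) z) * u_xx z"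
    "prolong X z (Jet Ud (n, 1, 1)) = - ((D Ti ^^ n) (tm (deriv d)) z + 2 * (D Ti ^^ n) (tm e) z) * u_xy z - (D Ti ^^ n) (tm c) z * u_xx z"
    "prolong X z (Jet Ud (n, 0, 0)) = (D Ti ^^ n) (tm (deriv b)) z - 2 * (D Ti ^^ n) (tm c) z
       + ((D Ti ^^ n) (tm e) z - 1/2 * (D Ti ^^ n) (tm (deriv d)) z) * u_0 z"
    "prolong X z (Jet Vd (n, 0, 0)) = (D Ti ^^ n) (tm (deriv a)) z + (D Ti ^^ n) (tm c) z * u_0 z
       + (2 * (D Ti ^^ n) (tm e) z - (D Ti ^^ n) (tm (deriv d)) z) * v_0 z"
    unfolding prolong_level[OF order_refl] phi
    by (simp only: D_funpow_add top_terms fa rules, simp add: algebra_simps)+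
qed

end

end

text \<open>The divided power: differentiation lowers the index, so the function is flat to order
  \<open>n\<close> at time 0 and its n-th derivative is 1.\<close>

definition tpow :: "nat \<Rightarrow> real \<Rightarrow> real" where
  "tpow n t = t ^ n / fact n"

lemma smooth_tpow: "smooth (tpow n)"
  unfolding tpow_def[abs_def] divide_inverse by (intro smooth_mult smooth_power smooth_ident smooth_const)

lemma DERIV_tpow: "(tpow (Suc n) has_real_derivative tpow n t) (at t)"
proof -
  have "real (Suc n) * t ^ n / fact (Suc n) = t ^ n / fact n"
    unfolding fact_Suc of_nat_mult of_nat_fact by (rule nonzero_mult_divide_mult_cancel_left) simp
  then show ?thesis
    unfolding tpow_def[abs_def] using DERIV_cdivide[OF DERIV_pow[of "Suc n" t UNIV], of "fact (Suc n)"] by simp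
qed

lemma deriv_tpow: "deriv (tpow (Suc n)) = tpow n"
  by (rule ext, rule DERIV_imp_deriv, rule DERIV_tpow)

lemma deriv_tpow_scaled: "deriv (\<lambda>t. r * tpow (Suc n) t) = (\<lambda>t. r * tpow n t)"
  by (rule ext, rule DERIV_imp_deriv, rule DERIV_cmult, rule DERIV_tpow)

lemma D_tm_tpow: "D Ti (tm (tpow (Suc n))) = tm (tpow n)"
  by (simp add: D_tm smooth_tpow deriv_tpow)

lemma tm_tpow_flat: "origin z \<Longrightarrow> tm (tpow n) \<in> flat n z"
proof (induction n)
  case (Suc n)
  then show ?case by (simp add: flat_Suc D_tm_tpow tm_alg smooth_tpow) (simp add: tm_def tpow_def origin_def)
qed (simp add: flat_0 tm_alg smooth_tpow)

lemma tm_tpow_top: "(D Ti ^^ n) (tm (tpow n)) z = 1"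
proof (induction n)
  case (Suc n)
  then show ?case by (simp only: funpow_Suc_right comp_def D_tm_tpow)
qed (simp add: tm_def tpow_def)

lemma tm_zero: "tm (\<lambda>t. 0) = (\<lambda>z. 0)"
  by (simp add: tm_def fun_eq_iff)

lemma tm_zero_top: "(D Ti ^^ n) (tm (\<lambda>t. 0)) z = 0"
  using flat_zero[of "Suc n" z] by (simp add: tm_zero flat_def)

lemma tm_scaled: "tm (\<lambda>t. r * a t) = (\<lambda>z. tm a z * r)"
  by (simp add: tm_def fun_eq_iff)

section \<open>Choice of a symmetry for each pivot\<close>

lemma nat_lt_5: "s < 5 \<Longrightarrow> s = 0 \<or> s = 1 \<or> s = 2 \<or> s = 3 \<or> s = (4 :: nat)"
  by auto

lemma pivot_index:
  fixes j n r :: nat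
  shows "j < 5 * n + r \<Longrightarrow> r < 5 \<Longrightarrow> (\<exists>i s. i < n \<and> s < 5 \<and> j = 5 * i + s) \<or> (\<exists>s<r. j = 5 * n + s)"
proof (cases "j < 5 * n")
  case True
  then have "j div 5 < n" "j mod 5 < 5" "j = 5 * (j div 5) + j mod 5" by auto
  then show ?thesis by blast
next
  case False
  moreover assume "j < 5 * n + r"
  ultimately have "j = 5 * n + (j - 5 * n)" "j - 5 * n < r" by auto
  then show ?thesis by blast
qed

context symmetry
begin

text \<open>Flatness of the coefficients annihilates all pivots with fewer than \<open>n\<close>
  t-derivatives, so only the five pivots of level \<open>n\<close> have to be examined.\<close>

lemma pivot_criterion:
  assumes flat: "\<And>z. origin z \<Longrightarrow> tm (deriv a) \<in> flat n z" "\<And>z. origin z \<Longrightarrow> tm (deriv b) \<in> flat n z"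
      "\<And>z. origin z \<Longrightarrow> tm c \<in> flat n z" "\<And>z. origin z \<Longrightarrow> tm (deriv d) \<in> flat n z" "\<And>z. origin z \<Longrightarrow> tm e \<in> flat n z"
    and r: "r < 5"
    and zero: "\<And>z s. origin z \<Longrightarrow> s < r \<Longrightarrow> prolong X z (pivot (5 * n + s)) = 0"
    and nonzero: "\<And>z. origin z \<Longrightarrow> good z \<Longrightarrow> prolong X z (pivot (5 * n + r)) \<noteq> 0"
  shows "\<exists>X\<in>sym_alg. \<forall>z. origin z \<longrightarrow> (\<forall>j<5 * n + r. prolong X z (pivot j) = 0) \<and>
    (good z \<longrightarrow> prolong X z (pivot (5 * n + r)) \<noteq> 0)"
proof (intro bexI[of _ X] allI impI conjI)
  show "X \<in> sym_alg" by (intro field_sym_alg smooth)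
  fix z assume z: "origin z"
  show "prolong X z (pivot j) = 0" if "j < 5 * n + r" for j
    using pivot_index[OF that r]
  proof (elim disjE exE conjE)
    fix i s assume i: "i < n" "s < 5" "j = 5 * i + s"
    note below = prolong_below[OF z flat(1)[OF z] flat(2)[OF z] flat(3)[OF z] flat(4)[OF z] flat(5)[OF z] i(1)]
    have "pivot j \<in> {Jet Ud (i, 1, 0), Jet Ud (i, 2, 0), Jet Ud (i, 1, 1), Jet Ud (i, 0, 0), Jet Vd (i, 0, 0)}"
      using nat_lt_5[OF i(2)] pivot_level[of i] unfolding i(3) by fastforce
    then show ?thesis using below by (elim insertE) (simp_all only: empty_iff)
  next
    fix s assume "s < r" "j = 5 * n + s"
    then show ?thesis using zero[OF z] by simp
  qed
qed (rule nonzero)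

end

text \<open>On level \<open>n\<close> only the n-th derivatives of a', b', c, d', e act. The five
  cases use e, a combination of d and e, then c, b and a; here c moves \<open>u_xy\<close> through
  the term with \<open>u_xx\<close>, while b and a translate u and v.\<close>

lemma pivot_field_level:
  assumes "r < 5"
  shows "\<exists>X\<in>sym_alg. \<forall>z. origin z \<longrightarrow> (\<forall>j<5 * n + r. prolong X z (pivot j) = 0) \<and>
    (good z \<longrightarrow> prolong X z (pivot (5 * n + r)) \<noteq> 0)"
proof -
  note sm = smooth_tpow smooth_const smooth_mult[OF smooth_const smooth_tpow]
  have flat_scaled: "(\<lambda>z. tm (tpow n) z * k) \<in> flat n z" if "origin z" for k z
    by (intro flat_mult tm_tpow_flat that fpoly_intros)
  have top_scaled: "(D Ti ^^ n) (\<lambda>z. tm (tpow n) z * k) z = k" if "origin z" for k z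
    using flat_top_mult[OF tm_tpow_flat[OF that] fpoly_intros(1)] by (simp add: tm_tpow_top)
  note rewr = deriv_const deriv_tpow deriv_tpow_scaled tm_scaled tm_zero
  note flats = flat_zero tm_tpow_flat flat_scaled
  note tops = tm_tpow_top tm_zero_top[unfolded tm_zero]
  consider "r = 0" | "r = 1" | "r = 2" | "r = 3" | "r = 4" using nat_lt_5[OF assms] by blast
  then show ?thesis
  proof cases
    case 1
    interpret symmetry "\<lambda>t. 0" "\<lambda>t. 0" "\<lambda>t. 0" "\<lambda>t. 0" "tpow n" by unfold_locales (intro sm)+
    have fl: "tm (deriv (\<lambda>t. 0)) \<in> flat n z" "tm (deriv (\<lambda>t. 0)) \<in> flat n z" "tm (\<lambda>t. 0) \<in> flat n z"
      "tm (deriv (\<lambda>t. 0)) \<in> flat n z" "tm (tpow n) \<in> flat n z" if "origin z" for z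
      unfolding rewr by (intro flats that)+
    show ?thesis
    proof (rule pivot_criterion[OF fl assms])
      fix z assume z: "origin z"
      note top = prolong_top[OF z fl[OF z], unfolded rewr tops top_scaled[OF z]]
      show "prolong X z (pivot (5 * n + s)) = 0" if "s < r" for s using that 1 by simp
      have "prolong X z (pivot (5 * n)) \<noteq> 0" if "good z"
        using that unfolding pivot_level top by (simp add: good_def)
      then show "prolong X z (pivot (5 * n + r)) \<noteq> 0" if "good z"
        using that unfolding 1 add_0_right by blast
    qed
  next
    case 2
    \<comment> \<open>The factor -2 makes \<open>d' / 2 + e\<close> vanish, which fixes the pivot
      with \<open>u_x\<close>, whereas \<open>d' / 2 + 3 e\<close>, the factor at
      \<open>u_xx\<close>, does not vanish.\<close>
    interpret symmetry "\<lambda>t. 0" "\<lambda>t. 0" "\<lambda>t. 0" "\<lambda>t. - 2 * tpow (Suc n) t" "tpow n" by unfold_locales (intro sm)+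
    have fl: "tm (deriv (\<lambda>t. 0)) \<in> flat n z" "tm (deriv (\<lambda>t. 0)) \<in> flat n z" "tm (\<lambda>t. 0) \<in> flat n z"
      "tm (deriv (\<lambda>t. - 2 * tpow (Suc n) t)) \<in> flat n z" "tm (tpow n) \<in> flat n z" if "origin z" for z
      unfolding rewr by (intro flats that)+
    show ?thesis
    proof (rule pivot_criterion[OF fl assms])
      fix z assume z: "origin z"
      note top = prolong_top[OF z fl[OF z], unfolded rewr tops top_scaled[OF z]]
      have below: "prolong X z (pivot (5 * n)) = 0"
        unfolding pivot_level top by simp_all
      show "prolong X z (pivot (5 * n + s)) = 0" if "s < r" for s
      proof -
        have "s = 0" using that 2 by auto
        then show ?thesis using below by simp
      qed
      have "prolong X z (pivot (5 * n + 1)) \<noteq> 0" if "good z"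
        using that unfolding pivot_level top by (simp add: good_def)
      then show "prolong X z (pivot (5 * n + r)) \<noteq> 0" if "good z"
        using that unfolding 2 add_0_right by blast
    qed
  next
    case 3
    interpret symmetry "\<lambda>t. 0" "\<lambda>t. 0" "tpow n" "\<lambda>t. 0" "\<lambda>t. 0" by unfold_locales (intro sm)+
    have fl: "tm (deriv (\<lambda>t. 0)) \<in> flat n z" "tm (deriv (\<lambda>t. 0)) \<in> flat n z" "tm (tpow n) \<in> flat n z"
      "tm (deriv (\<lambda>t. 0)) \<in> flat n z" "tm (\<lambda>t. 0) \<in> flat n z" if "origin z" for z
      unfolding rewr by (intro flats that)+
    show ?thesis
    proof (rule pivot_criterion[OF fl assms])
      fix z assume z: "origin z"
      note top = prolong_top[OF z fl[OF z], unfolded rewr tops top_scaled[OF z]]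
      have below: "prolong X z (pivot (5 * n)) = 0" "prolong X z (pivot (5 * n + 1)) = 0"
        unfolding pivot_level top by simp_all
      show "prolong X z (pivot (5 * n + s)) = 0" if "s < r" for s
      proof -
        have "s = 0 \<or> s = 1" using that 3 by auto
        then show ?thesis using below by (elim disjE) (simp_all only: add_0_right)
      qed
      have "prolong X z (pivot (5 * n + 2)) \<noteq> 0" if "good z"
        using that unfolding pivot_level top by (simp add: good_def)
      then show "prolong X z (pivot (5 * n + r)) \<noteq> 0" if "good z"
        using that unfolding 3 add_0_right by blast
    qed
  next
    case 4
    interpret symmetry "\<lambda>t. 0" "tpow (Suc n)" "\<lambda>t. 0" "\<lambda>t. 0" "\<lambda>t. 0" by unfold_locales (intro sm)+
    have fl: "tm (deriv (\<lambda>t. 0)) \<in> flat n z" "tm (deriv (tpow (Suc n))) \<in> flat n z" "tm (\<lambda>t. 0) \<in> flat n z"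
      "tm (deriv (\<lambda>t. 0)) \<in> flat n z" "tm (\<lambda>t. 0) \<in> flat n z" if "origin z" for z
      unfolding rewr by (intro flats that)+
    show ?thesis
    proof (rule pivot_criterion[OF fl assms])
      fix z assume z: "origin z"
      note top = prolong_top[OF z fl[OF z], unfolded rewr tops top_scaled[OF z]]
      have below: "prolong X z (pivot (5 * n)) = 0" "prolong X z (pivot (5 * n + 1)) = 0" "prolong X z (pivot (5 * n + 2)) = 0"
        unfolding pivot_level top by simp_all
      show "prolong X z (pivot (5 * n + s)) = 0" if "s < r" for s
      proof -
        have "s = 0 \<or> s = 1 \<or> s = 2" using that 4 by auto
        then show ?thesis using below by (elim disjE) (simp_all only: add_0_right)
      qed
      have "prolong X z (pivot (5 * n + 3)) \<noteq> 0" if "good z"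
        using that unfolding pivot_level top by (simp add: good_def)
      then show "prolong X z (pivot (5 * n + r)) \<noteq> 0" if "good z"
        using that unfolding 4 add_0_right by blast
    qed
  next
    case 5
    interpret symmetry "tpow (Suc n)" "\<lambda>t. 0" "\<lambda>t. 0" "\<lambda>t. 0" "\<lambda>t. 0" by unfold_locales (intro sm)+
    have fl: "tm (deriv (tpow (Suc n))) \<in> flat n z" "tm (deriv (\<lambda>t. 0)) \<in> flat n z" "tm (\<lambda>t. 0) \<in> flat n z"
      "tm (deriv (\<lambda>t. 0)) \<in> flat n z" "tm (\<lambda>t. 0) \<in> flat n z" if "origin z" for z
      unfolding rewr by (intro flats that)+
    show ?thesis
    proof (rule pivot_criterion[OF fl assms])
      fix z assume z: "origin z"
      note top = prolong_top[OF z fl[OF z], unfolded rewr tops top_scaled[OF z]]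
      have below: "prolong X z (pivot (5 * n)) = 0" "prolong X z (pivot (5 * n + 1)) = 0" "prolong X z (pivot (5 * n + 2)) = 0" "prolong X z (pivot (5 * n + 3)) = 0"
        unfolding pivot_level top by simp_all
      show "prolong X z (pivot (5 * n + s)) = 0" if "s < r" for s
      proof -
        have "s = 0 \<or> s = 1 \<or> s = 2 \<or> s = 3" using that 5 by auto
        then show ?thesis using below by (elim disjE) (simp_all only: add_0_right)
      qed
      have "prolong X z (pivot (5 * n + 4)) \<noteq> 0" if "good z"
        using that unfolding pivot_level top by (simp add: good_def)
      then show "prolong X z (pivot (5 * n + r)) \<noteq> 0" if "good z"
        using that unfolding 5 add_0_right by blast
    qed
  qed
qed

lemma pivot_field: "\<exists>X\<in>sym_alg. \<forall>z. origin z \<longrightarrow> (\<forall>j<m. prolong X z (pivot j) = 0) \<and>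
    (good z \<longrightarrow> prolong X z (pivot m) \<noteq> 0)"
  using pivot_field_level[of "m mod 5" "m div 5"] by simp

section \<open>Elimination of the pivots\<close>

definition level_algebra :: "nat \<Rightarrow> (jet \<Rightarrow> real) set" where
  "level_algebra m = real_algebra (iterates \<union> {\<lambda>z. z (pivot j) | j. j < m})"

lemma level_algebra_mono: "m \<le> n \<Longrightarrow> level_algebra m \<subseteq> level_algebra n"
  unfolding level_algebra_def by (rule real_algebra_mono) fastforce

lemma level_algebra_0: "level_algebra 0 = real_algebra iterates"
  by (simp add: level_algebra_def)

lemma level_algebra_gens: "f \<in> real_algebra gens \<Longrightarrow> \<exists>m. f \<in> level_algebra m"
proof (induction rule: real_algebra.induct)
  case (const r)
  then show ?case by (auto simp: level_algebra_def intro: real_algebra.const)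
next
  case (gen f)
  then consider "f \<in> iterates" | j where "f = (\<lambda>z. z (pivot j))" by (auto simp: pivots_def)
  then show ?case
  proof cases
    case 1
    then have "f \<in> level_algebra 0" unfolding level_algebra_def by (intro real_algebra.gen UnI1)
    then show ?thesis ..
  next
    case 2
    then have "f \<in> level_algebra (Suc j)" unfolding level_algebra_def by (intro real_algebra.gen UnI2) auto
    then show ?thesis ..
  qed
next
  case (add f g)
  then obtain m n where "f \<in> level_algebra m" "g \<in> level_algebra n" by blast
  then have "f \<in> level_algebra (max m n)" "g \<in> level_algebra (max m n)"
    using level_algebra_mono[of m "max m n"] level_algebra_mono[of n "max m n"] by auto
  then have "(\<lambda>z. f z + g z) \<in> level_algebra (max m n)" unfolding level_algebra_def by (rule real_algebra.add)
  then show ?case ..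
next
  case (mult f g)
  then obtain m n where "f \<in> level_algebra m" "g \<in> level_algebra n" by blast
  then have "f \<in> level_algebra (max m n)" "g \<in> level_algebra (max m n)"
    using level_algebra_mono[of m "max m n"] level_algebra_mono[of n "max m n"] by auto
  then have "(\<lambda>z. f z * g z) \<in> level_algebra (max m n)" unfolding level_algebra_def by (rule real_algebra.mult)
  then show ?case ..
qed

lemma level_algebra_expansion:
  assumes "f \<in> level_algebra (Suc m)"
  shows "\<exists>n a. (\<forall>i. a i \<in> level_algebra m) \<and> (\<forall>i>n. a i = (\<lambda>z. 0)) \<and> f = (\<lambda>z. \<Sum>i\<le>n. a i z * z (pivot m) ^ i)"
proof -
  let ?E = "\<lambda>f n a. (\<forall>i. a i \<in> level_algebra m) \<and> (\<forall>i>n. a i = (\<lambda>z. 0)) \<and> f = (\<lambda>z. \<Sum>i\<le>n. a i z * z (pivot m) ^ i)"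
  have embed: "\<exists>n a. ?E f n a" if "f \<in> level_algebra m" for f
    by (rule exI[of _ 0], rule exI[of _ "\<lambda>i. if i = 0 then f else (\<lambda>z. 0)"])
      (use that in \<open>auto simp: level_algebra_def intro: real_algebra.const\<close>)
  \<comment> \<open>Coefficients beyond the degree are zero functions, so expansions of different
    lengths can be added, and the Cauchy product formula applies to products.\<close>
  have pad: "(\<Sum>i\<le>n. a i z * x ^ i) = (\<Sum>i\<le>n + k. a i z * x ^ i)" if "\<forall>i>n. a i = (\<lambda>z :: jet. 0 :: real)" for n k a z and x :: real
    by (rule sum.mono_neutral_left) (use that in auto)
  show ?thesis
    using assms unfolding level_algebra_def[of "Suc m"]
  proof (induction rule: real_algebra.induct)
    case (const r)
    show ?case by (rule embed) (auto simp: level_algebra_def intro: real_algebra.const)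
  next
    case (gen f)
    then consider "f \<in> iterates" | j where "j < m" "f = (\<lambda>z. z (pivot j))" | "f = (\<lambda>z. z (pivot m))"
      by (auto simp: less_Suc_eq)
    then show ?case
    proof cases
      case 1
      then show ?thesis by - (rule embed, auto simp: level_algebra_def intro: real_algebra.gen)
    next
      case 2
      then show ?thesis by - (rule embed, auto simp: level_algebra_def intro: real_algebra.gen)
    next
      case 3
      have "(\<lambda>z. r) \<in> level_algebra m" for r unfolding level_algebra_def by (rule real_algebra.const)
      then have "?E f 1 (\<lambda>i. if i = 1 then (\<lambda>z. 1) else (\<lambda>z. 0))" using 3 by auto
      then show ?thesis by (intro exI)
    qed
  next
    case (add f g)
    obtain n a k b where E: "?E f n a" "?E g k b" using add.IH by blast
    have "?E (\<lambda>z. f z + g z) (n + k) (\<lambda>i z. a i z + b i z)"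
    proof (intro conjI allI impI)
      show "(\<lambda>z. a i z + b i z) \<in> level_algebra m" for i
        using E unfolding level_algebra_def by (blast intro: real_algebra.add)
      have "f z + g z = (\<Sum>i\<le>n + k. a i z * z (pivot m) ^ i) + (\<Sum>i\<le>n + k. b i z * z (pivot m) ^ i)" for z
        using E pad[of n a z "z (pivot m)" k] pad[of k b z "z (pivot m)" n] by (simp add: add.commute)
      then show "(\<lambda>z. f z + g z) = (\<lambda>z. \<Sum>i\<le>n + k. (a i z + b i z) * z (pivot m) ^ i)"
        by (simp add: sum.distrib distrib_right)
    qed (use E in auto)
    then show ?case by (intro exI)
  next
    case (mult f g)
    obtain n a k b where E: "?E f n a" "?E g k b" using mult.IH by blast
    have "?E (\<lambda>z. f z * g z) (n + k) (\<lambda>i z. \<Sum>l\<le>i. a l z * b (i - l) z)"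
    proof (intro conjI allI impI)
      show "(\<lambda>z. \<Sum>l\<le>i. a l z * b (i - l) z) \<in> level_algebra m" for i
        using E unfolding level_algebra_def by (intro algebra_intros) auto
      show "(\<lambda>z. \<Sum>l\<le>i. a l z * b (i - l) z) = (\<lambda>z. 0)" if "n + k < i" for i
      proof
        fix z
        have "a l z * b (i - l) z = 0" for l
          using E that by (cases "l \<le> n") auto
        then show "(\<Sum>l\<le>i. a l z * b (i - l) z) = 0" by (intro sum.neutral) blast
      qed
      show "(\<lambda>z. f z * g z) = (\<lambda>z. \<Sum>i\<le>n + k. (\<Sum>l\<le>i. a l z * b (i - l) z) * z (pivot m) ^ i)"
      proof
        fix z
        show "f z * g z = (\<Sum>i\<le>n + k. (\<Sum>l\<le>i. a l z * b (i - l) z) * z (pivot m) ^ i)"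
          using E polynomial_product[of n "\<lambda>i. a i z" k "\<lambda>i. b i z" "z (pivot m)"] by auto
      qed
    qed
    then show ?case by (intro exI)
  qed
qed

text \<open>Numerators and denominators in \<open>jpoly\<close> ignore the base coordinates, and
  \<open>rebase\<close> brings any point of the equation over the origin.\<close>

lemma weakly_origin:
  assumes "ratl f" "weakly (\<lambda>z. origin z \<longrightarrow> f z = 0)"
  shows "weakly (\<lambda>z. f z = 0)"
proof -
  obtain P Q where f: "P \<in> jpoly" "nonzero_poly Q" "is_frac f P Q" using assms(1) by (rule ratlE)
  obtain R where R: "nonzero_poly R" "\<forall>z\<in>equation_inf. R z \<noteq> 0 \<longrightarrow> origin z \<longrightarrow> f z = 0"
    using assms(2) unfolding weakly_def by blast
  show ?thesis
  proof (rule weakly_mono[OF weakly_conj[OF weakly_nonzero[OF R(1)] weakly_nonzero[OF f(2)]]])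
    fix z assume z: "z \<in> equation_inf" "R z \<noteq> 0 \<and> Q z \<noteq> 0"
    let ?z = "rebase 0 z"
    have same: "R ?z = R z" "Q ?z = Q z" "P ?z = P z"
      using R(1) f(1,2) by (simp_all add: jpoly_rebase nonzero_poly_def)
    have "base_comp i 0 = 0" for i by (cases i) (simp_all add: zero_prod_def)
    then have "origin ?z" by (simp add: origin_def)
    then have "f ?z = 0" using R(2) rebase_equation[OF z(1)] same z(2) by simp
    then show "f z = 0" using f(3) same z(2) by (simp add: is_frac_def)
  qed
qed

text \<open>Restricted to points over the origin because the symmetries chosen for the pivots are
  controlled only there.\<close>

definition annihilated :: "(point \<Rightarrow> point) \<Rightarrow> (jet \<Rightarrow> real) \<Rightarrow> bool" where
  "annihilated X f \<longleftrightarrow> ratl f \<and> weakly (\<lambda>z. origin z \<longrightarrow> Lie (prolong X) f z = 0)"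

lemma
  assumes "annihilated X f" "annihilated X g"
  shows annihilated_add: "annihilated X (\<lambda>z. f z + g z)"
    and annihilated_mult: "annihilated X (\<lambda>z. f z * g z)"
proof -
  have r: "ratl f" "ratl g" using assms by (auto simp: annihilated_def)
  have w: "weakly (\<lambda>z. ((origin z \<longrightarrow> Lie (prolong X) f z = 0) \<and> (origin z \<longrightarrow> Lie (prolong X) g z = 0))
      \<and> (frac_at z f \<and> frac_at z g))"
    using assms by (intro weakly_conj ratl_frac_at r) (auto simp: annihilated_def)
  have "weakly (\<lambda>z. origin z \<longrightarrow> Lie (prolong X) (\<lambda>z. f z + g z) z = 0)"
    by (rule weakly_mono[OF w]) (simp add: Lie_at_add)
  then show "annihilated X (\<lambda>z. f z + g z)" using r by (simp add: annihilated_def ratl_add)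
  have "weakly (\<lambda>z. origin z \<longrightarrow> Lie (prolong X) (\<lambda>z. f z * g z) z = 0)"
  proof (rule weakly_mono[OF w], intro impI)
    fix z assume "((origin z \<longrightarrow> Lie (prolong X) f z = 0) \<and> (origin z \<longrightarrow> Lie (prolong X) g z = 0))
      \<and> (frac_at z f \<and> frac_at z g)" "origin z"
    then show "Lie (prolong X) (\<lambda>z. f z * g z) z = 0" using Lie_at_mult[of z f g] by simp
  qed
  then show "annihilated X (\<lambda>z. f z * g z)" using r by (simp add: annihilated_def ratl_mult)
qed

lemma annihilated_const: "annihilated X (\<lambda>z. r)"
  by (simp add: annihilated_def ratl_const weakly_all)

lemma Lie_power_sum:
  assumes "\<And>i. i \<le> n \<Longrightarrow> frac_at z (\<kappa> i)" "\<And>i. i \<le> n \<Longrightarrow> Lie \<xi> (\<kappa> i) z = 0"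
  shows "frac_at z (\<lambda>z. \<Sum>i\<le>n. \<kappa> i z * z c ^ i) \<and>
    Lie \<xi> (\<lambda>z. \<Sum>i\<le>n. \<kappa> i z * z c ^ i) z = (\<Sum>i\<le>n. real i * \<kappa> i z * z c ^ (i - 1)) * \<xi> z c"
  using assms
proof (induction n)
  case 0
  then show ?case by simp
next
  case (Suc n)
  have "(\<lambda>z. z c) \<in> alg" by (cases c) (auto intro: alg_intros)
  then have p: "(\<lambda>z. z c ^ i) \<in> alg" for i by (intro alg_intros)
  have "Lie \<xi> (\<lambda>z. z c ^ Suc n) z = real (Suc n) * z c ^ n * \<xi> z c"
    using Lie_power[OF \<open>(\<lambda>z. z c) \<in> alg\<close>, of \<xi> "Suc n"] by simp
  moreover have "Lie \<xi> (\<lambda>z. \<kappa> (Suc n) z * z c ^ Suc n) z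
      = Lie \<xi> (\<kappa> (Suc n)) z * z c ^ Suc n + \<kappa> (Suc n) z * Lie \<xi> (\<lambda>z. z c ^ Suc n) z"
    by (rule Lie_at_mult[OF Suc.prems(1)[OF order_refl] frac_at_alg[OF p]])
  moreover have f: "frac_at z (\<lambda>z. \<kappa> (Suc n) z * z c ^ Suc n)"
    by (rule frac_at_mult[OF Suc.prems(1)[OF order_refl] frac_at_alg[OF p]])
  moreover have IH: "frac_at z (\<lambda>z. \<Sum>i\<le>n. \<kappa> i z * z c ^ i)"
    "Lie \<xi> (\<lambda>z. \<Sum>i\<le>n. \<kappa> i z * z c ^ i) z = (\<Sum>i\<le>n. real i * \<kappa> i z * z c ^ (i - 1)) * \<xi> z c"
    using Suc.IH Suc.prems by auto
  moreover have "Lie \<xi> (\<lambda>z. (\<Sum>i\<le>n. \<kappa> i z * z c ^ i) + \<kappa> (Suc n) z * z c ^ Suc n) z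
      = Lie \<xi> (\<lambda>z. \<Sum>i\<le>n. \<kappa> i z * z c ^ i) z + Lie \<xi> (\<lambda>z. \<kappa> (Suc n) z * z c ^ Suc n) z"
    by (rule Lie_at_add[OF IH(1) f])
  ultimately show ?case
    using frac_at_add[OF IH(1) f] Suc.prems(2)[of "Suc n"] by (simp add: algebra_simps)
qed

lemma sum_atMost_derivative:
  "(\<Sum>i\<le>Suc n. real i * k i * (x::real) ^ (i - 1)) = (\<Sum>i\<le>n. real (Suc i) * k (Suc i) * x ^ i)"
  by (subst sum.atMost_Suc_shift) simp

lemma weakly_finite: "finite A \<Longrightarrow> (\<And>i. i \<in> A \<Longrightarrow> weakly (\<Phi> i)) \<Longrightarrow> weakly (\<lambda>z. \<forall>i\<in>A. \<Phi> i z)"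
proof (induction A rule: finite_induct)
  case (insert i A)
  from weakly_conj[OF insert.prems[of i] insert.IH[OF insert.prems]] show ?case
    by (rule weakly_mono) auto
qed (simp add: weakly_all)

text \<open>A polynomial in a pivot that vanishes has vanishing coefficients: otherwise one could lower
  its degree by applying a symmetry that annihilates the coefficients but not the pivot.\<close>

lemma coefficients_vanish:
  assumes X: "X \<in> sym_alg" "\<And>z. origin z \<Longrightarrow> good z \<Longrightarrow> prolong X z (pivot m) \<noteq> 0"
    and \<kappa>: "\<And>i. annihilated X (\<kappa> i)" and zero: "weakly (\<lambda>z. (\<Sum>i\<le>n. \<kappa> i z * z (pivot m) ^ i) = 0)"
  shows "\<forall>i\<le>n. weakly (\<lambda>z. \<kappa> i z = 0)"
  using \<kappa> zero
proof (induction n arbitrary: \<kappa>)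
  case 0
  then show ?case by simp
next
  case (Suc n)
  let ?f = "\<lambda>z. \<Sum>i\<le>Suc n. \<kappa> i z * z (pivot m) ^ i"
  let ?g = "\<lambda>z. \<Sum>i\<le>n. (real (Suc i) * \<kappa> (Suc i) z) * z (pivot m) ^ i"
  have r: "ratl (\<kappa> i)" for i using Suc.prems(1) by (simp add: annihilated_def)
  have w: "ratl (\<lambda>z. z (pivot m) ^ i)" for i
    using pivot_Jet[of m] by (auto intro!: ratl_jpoly jpoly_intros)
  have rsum: "ratl (\<lambda>z. \<Sum>i\<le>n. h i z * z (pivot m) ^ i)" if "\<And>i. ratl (h i)" for h n
  proof (induction n)
    case 0
    show ?case using that by simp
  next
    case (Suc n)
    show ?case unfolding sum.atMost_Suc by (rule ratl_add[OF Suc ratl_mult[OF that w]])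
  qed
  \<comment> \<open>Off the zeros of \<open>Q\<close> the vanishing sum may be differentiated along
    any field tangent to the equation.\<close>
  obtain Q where Q: "nonzero_poly Q" "\<And>\<xi> z. z \<in> equation_inf \<Longrightarrow> Q z \<noteq> 0 \<Longrightarrow>
    (\<forall>g. g \<in> jpoly \<longrightarrow> (\<forall>z\<in>equation_inf. g z = 0) \<longrightarrow> Lie \<xi> g z = 0) \<Longrightarrow> Lie \<xi> ?f z = 0"
    using Lie_weakly_zero[OF rsum[OF r] Suc.prems(2)] by blast
  have tangent: "Lie (prolong X) g z = 0" if "g \<in> jpoly" "\<forall>z\<in>equation_inf. g z = 0" "z \<in> equation_inf" for g z
    using X(1)
  proof (rule sym_alg_symmetry)
    fix a b c d e assume "symmetry a b c d e" "X = field a b c d e"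
    then show ?thesis using symmetry.vanish[of a b c d e g z] jpoly_alg that by auto
  qed
  have "weakly (\<lambda>z. \<forall>i\<in>{..Suc n}. (origin z \<longrightarrow> Lie (prolong X) (\<kappa> i) z = 0) \<and> frac_at z (\<kappa> i))"
    by (rule weakly_finite) (use Suc.prems(1) ratl_frac_at[OF r] in \<open>auto simp: annihilated_def intro!: weakly_conj\<close>)
  from weakly_conj[OF this weakly_conj[OF weakly_good weakly_nonzero[OF Q(1)]]]
  have "weakly (\<lambda>z. origin z \<longrightarrow> ?g z = 0)"
  proof (rule weakly_mono, intro impI)
    fix z assume z: "z \<in> equation_inf" "origin z"
      and *: "(\<forall>i\<in>{..Suc n}. (origin z \<longrightarrow> Lie (prolong X) (\<kappa> i) z = 0) \<and> frac_at z (\<kappa> i)) \<and> good z \<and> Q z \<noteq> 0"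
    have "Lie (prolong X) ?f z = 0" by (rule Q(2)) (use z * tangent in auto)
    moreover have "Lie (prolong X) ?f z = (\<Sum>i\<le>Suc n. real i * \<kappa> i z * z (pivot m) ^ (i - 1)) * prolong X z (pivot m)"
      by (rule conjunct2[OF Lie_power_sum]) (use z * in auto)
    moreover have "prolong X z (pivot m) \<noteq> 0" by (rule X(2)) (use z * in auto)
    ultimately show "?g z = 0" unfolding sum_atMost_derivative by simp
  qed
  \<comment> \<open>The relation of lower degree has been derived over the origin only; it has to
    hold generically before the induction hypothesis applies.\<close>
  then have g0: "weakly (\<lambda>z. ?g z = 0)"
    by (rule weakly_origin[rotated]) (intro rsum ratl_mult ratl_const r)
  have "annihilated X (\<lambda>z. real (Suc i) * \<kappa> (Suc i) z)" for i
    by (intro annihilated_mult annihilated_const Suc.prems(1))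
  from Suc.IH[OF this g0] have high: "weakly (\<lambda>z. \<kappa> (Suc i) z = 0)" if "i \<le> n" for i
    using that by simp
  have "weakly (\<lambda>z. (\<forall>i\<in>{..n}. \<kappa> (Suc i) z = 0) \<and> ?f z = 0)"
    by (intro weakly_conj weakly_finite Suc.prems(2)) (auto intro: high)
  then have "weakly (\<lambda>z. \<kappa> 0 z = 0)"
  proof (rule weakly_mono)
    fix z assume *: "(\<forall>i\<in>{..n}. \<kappa> (Suc i) z = 0) \<and> ?f z = 0"
    then have "(\<Sum>i\<le>n. \<kappa> (Suc i) z * z (pivot m) ^ Suc i) = 0" by (intro sum.neutral) auto
    with * show "\<kappa> 0 z = 0" unfolding sum.atMost_Suc_shift by (simp del: power_Suc)
  qed
  with high show ?case by (metis Suc_le_mono not0_implies_Suc)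
qed

lemma annihilated_level_algebra:
  assumes X: "X \<in> sym_alg" "\<And>z j. origin z \<Longrightarrow> j < m \<Longrightarrow> prolong X z (pivot j) = 0" and f: "f \<in> level_algebra m"
  shows "annihilated X f"
  using f unfolding level_algebra_def
proof (induction rule: real_algebra.induct)
  case (gen f)
  then consider "f \<in> iterates" | j where "j < m" "f = (\<lambda>z. z (pivot j))" by auto
  then show ?case
  proof cases
    case 1
    have "weakly (\<lambda>z. origin z \<longrightarrow> Lie (prolong X) f z = 0)"
      by (rule weakly_mono[OF weakly_good]) (simp add: invariant_iterates[OF 1 X(1)])
    then show ?thesis using 1 by (simp add: annihilated_def ratl_regular regular_iterates)
  next
    case 2
    obtain \<alpha> \<sigma> where "pivot j = Jet \<alpha> \<sigma>" using pivot_Jet by blast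
    then have "ratl f" unfolding 2(2) by (auto intro: ratl_jet)
    then show ?thesis unfolding annihilated_def 2(2) using X(2) 2(1) by (simp add: weakly_all)
  qed
qed (auto intro: annihilated_const annihilated_add annihilated_mult)

text \<open>\<open>B J - A\<close> is a polynomial in the top pivot whose coefficients are
  annihilated by a symmetry that moves this pivot. Hence \<open>b i * J = a i\<close> for every
  \<open>i\<close>, and any nonzero \<open>b i\<close> serves as the new denominator.\<close>

lemma eliminate_pivot:
  assumes J: "\<And>X. X \<in> sym_alg \<Longrightarrow> annihilated X J"
    and AB: "A \<in> level_algebra (Suc m)" "B \<in> level_algebra (Suc m)" "\<not> weakly (\<lambda>z. B z = 0)" "weakly (\<lambda>z. B z * J z = A z)"
  shows "\<exists>A\<in>level_algebra m. \<exists>B\<in>level_algebra m. \<not> weakly (\<lambda>z. B z = 0) \<and> weakly (\<lambda>z. B z * J z = A z)"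
proof -
  obtain n a where a: "\<And>i. a i \<in> level_algebra m" "\<forall>i>n. a i = (\<lambda>z. 0)" "A = (\<lambda>z. \<Sum>i\<le>n. a i z * z (pivot m) ^ i)"
    using level_algebra_expansion[OF AB(1)] by blast
  obtain k b where b: "\<And>i. b i \<in> level_algebra m" "\<forall>i>k. b i = (\<lambda>z. 0)" "B = (\<lambda>z. \<Sum>i\<le>k. b i z * z (pivot m) ^ i)"
    using level_algebra_expansion[OF AB(2)] by blast
  have A: "A z = (\<Sum>i\<le>n + k. a i z * z (pivot m) ^ i)" for z
    unfolding a(3) by (rule sum.mono_neutral_left) (use a(2) in auto)
  have B: "B z = (\<Sum>i\<le>n + k. b i z * z (pivot m) ^ i)" for z
    unfolding b(3) by (rule sum.mono_neutral_left) (use b(2) in auto)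
  obtain X where X: "X \<in> sym_alg" "\<And>z j. origin z \<Longrightarrow> j < m \<Longrightarrow> prolong X z (pivot j) = 0"
    "\<And>z. origin z \<Longrightarrow> good z \<Longrightarrow> prolong X z (pivot m) \<noteq> 0"
    using pivot_field[of m] by blast
  have ann: "annihilated X (\<lambda>z. b i z * J z + - 1 * a i z)" for i
    by (rule annihilated_add[OF annihilated_mult[OF annihilated_level_algebra[OF X(1,2) b(1)] J[OF X(1)]]
          annihilated_mult[OF annihilated_const annihilated_level_algebra[OF X(1,2) a(1)]]])
  have "weakly (\<lambda>z. (\<Sum>i\<le>n + k. (b i z * J z + - 1 * a i z) * z (pivot m) ^ i) = 0)"
  proof (rule weakly_mono[OF AB(4)])
    fix z assume "B z * J z = A z"
    then show "(\<Sum>i\<le>n + k. (b i z * J z + - 1 * a i z) * z (pivot m) ^ i) = 0"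
      unfolding A B by (simp add: sum_distrib_right left_diff_distrib sum_subtractf mult.assoc mult.commute[of "J z"])
  qed
  from coefficients_vanish[OF X(1,3) ann this]
  have c: "weakly (\<lambda>z. b i z * J z + - 1 * a i z = 0)" if "i \<le> n + k" for i using that by blast
  \<comment> \<open>If all coefficients of \<open>B\<close> vanished generically, so would
    \<open>B\<close>.\<close>
  have "\<exists>i\<le>n + k. \<not> weakly (\<lambda>z. b i z = 0)"
  proof (rule ccontr)
    assume "\<not> ?thesis"
    then have "weakly (\<lambda>z. \<forall>i\<in>{..n + k}. b i z = 0)" by (intro weakly_finite) auto
    then have "weakly (\<lambda>z. B z = 0)" by (rule weakly_mono) (simp add: B)
    then show False using AB(3) by simp
  qed
  then obtain i where i: "i \<le> n + k" "\<not> weakly (\<lambda>z. b i z = 0)" by blast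
  have "weakly (\<lambda>z. b i z * J z = a i z)" by (rule weakly_mono[OF c[OF i(1)]]) simp
  then show ?thesis using a(1) b(1) i(2) by blast
qed

lemma invariant_field:
  assumes J: "\<And>X. X \<in> sym_alg \<Longrightarrow> annihilated X J" and K: "J \<in> K"
  shows "\<exists>A\<in>real_algebra iterates. \<exists>B\<in>real_algebra iterates. \<not> weakly (\<lambda>z. B z = 0) \<and> weakly (\<lambda>z. B z * J z = A z)"
proof -
  obtain A B where AB: "A \<in> real_algebra gens" "B \<in> real_algebra gens" "\<not> weakly (\<lambda>z. B z = 0)" "weakly (\<lambda>z. B z * J z = A z)"
    using K unfolding rfield_def by blast
  obtain m n where "A \<in> level_algebra m" "B \<in> level_algebra n"
    using level_algebra_gens AB(1,2) by blast
  then have "A \<in> level_algebra (max m n)" "B \<in> level_algebra (max m n)"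
    using level_algebra_mono[of m "max m n"] level_algebra_mono[of n "max m n"] by auto
  moreover have "\<exists>A\<in>level_algebra 0. \<exists>B\<in>level_algebra 0. \<not> weakly (\<lambda>z. B z = 0) \<and> weakly (\<lambda>z. B z * J z = A z)"
    if "A \<in> level_algebra l" "B \<in> level_algebra l" "\<not> weakly (\<lambda>z. B z = 0)" "weakly (\<lambda>z. B z * J z = A z)" for l A B
    using that
  proof (induction l arbitrary: A B)
    case (Suc l)
    then show ?case using eliminate_pivot[OF J Suc.prems] by blast
  qed blast
  ultimately show ?thesis using AB(3,4) unfolding level_algebra_0 by blast
qed

section \<open>Generation of the invariants\<close>

lemma regular_algebra: "f \<in> real_algebra iterates \<Longrightarrow> regular f"
  by (induction rule: real_algebra.induct)
    (auto intro: regular_iterates regular_add regular_mult regular_jpoly jpoly_intros)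

lemma invariant_algebra: "f \<in> real_algebra iterates \<Longrightarrow> X \<in> sym_alg \<Longrightarrow> good z \<Longrightarrow> Lie (prolong X) f z = 0"
proof (induction rule: real_algebra.induct)
  case (add f g)
  then show ?case using Lie_at_add[OF regular_frac_at[OF regular_algebra] regular_frac_at[OF regular_algebra]] by simp
next
  case (mult f g)
  then show ?case
    using Lie_at_mult[OF regular_frac_at[OF regular_algebra[OF mult.hyps(1)]] regular_frac_at[OF regular_algebra[OF mult.hyps(2)]], of z]
    by simp
qed (auto intro: invariant_iterates)

lemma fibrewise_nonzero_mult:
  assumes "P \<in> alg" "Q \<in> alg" "\<exists>z\<in>equation_inf. pt z = p \<and> P z \<noteq> 0" "\<exists>z\<in>equation_inf. pt z = p \<and> Q z \<noteq> 0"
  shows "\<exists>z\<in>equation_inf. pt z = p \<and> P z * Q z \<noteq> 0"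
proof -
  obtain z0 z1 where z: "z0 \<in> equation_inf" "pt z0 = p" "P z0 \<noteq> 0" "z1 \<in> equation_inf" "pt z1 = p" "Q z1 \<noteq> 0"
    using assms(3,4) by blast
  then have pt: "pt z0 = pt z1" by simp
  obtain s where "P (line z0 z1 s) * Q (line z0 z1 s) \<noteq> 0"
    using nonzero_product[of P z0 z1 Q, OF alg_line[OF assms(1) pt] alg_line[OF assms(2) pt]] z by blast
  then show ?thesis using line_equation[of z0 z1 s] pt_line[OF pt, of s] z(2) by blast
qed

text \<open>Denominators produced by the elimination are themselves invariant, so
  \<open>invariant_nonzero_on_fibres\<close> upgrades their generic nonvanishing to every fibre over
  E.\<close>

lemma algebra_nonzero_on_fibres:
  assumes B: "B \<in> real_algebra iterates" "\<not> weakly (\<lambda>z. B z = 0)"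
    and B': "B' \<in> jpoly" "is_frac B B' (\<lambda>z. (u_x z * u_xx z) ^ Suc k)"
  shows "\<exists>z\<in>equation_inf. pt z = p \<and> B' z \<noteq> 0"
proof -
  let ?Q = "\<lambda>z. (u_x z * u_xx z) ^ Suc k"
  have "\<exists>z1\<in>equation_inf. B' z1 \<noteq> 0"
  proof (rule ccontr)
    assume "\<not> ?thesis"
    then have 0: "B' z = 0" if "z \<in> equation_inf" for z using that by blast
    have "weakly (\<lambda>z. B z = 0)"
    proof (rule weakly_mono[OF weakly_good])
      fix z assume "z \<in> equation_inf" "good z"
      moreover from this have "B z = B' z / ?Q z" using B'(2) good_iff[of z k] unfolding is_frac_def by blast
      ultimately show "B z = 0" using 0 by simp
    qed
    with B(2) show False by simp
  qed
  then obtain z1 where z1: "z1 \<in> equation_inf" "B' z1 \<noteq> 0" by blast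
  show ?thesis
  proof (rule invariant_nonzero_on_fibres[OF B'(1) z1])
    fix X z assume X: "X \<in> sym_alg" "good z"
    then have nz: "?Q z \<noteq> 0" using good_iff[of z k] by blast
    have f: "is_frac (\<lambda>z. B' z / ?Q z) B' ?Q"
      using B'(2) unfolding is_frac_def by blast
    show "Lie (prolong X) (\<lambda>z. B' z / ?Q z) z = 0"
      using Lie_frac[OF f nz, of "prolong X"] Lie_frac[OF B'(2) nz, of "prolong X"] invariant_algebra[OF B(1) X]
      by (simp only:)
  qed
qed

lemma generate_I2: "generate_invariants {nabla1, nabla2, nabla3} I2"
  unfolding generate_invariants_def
proof (intro allI impI)
  fix k J assume "diff_invariant k J"
  then obtain P Q where PQ: "P \<in> fibre_poly k" "Q \<in> fibre_poly k" "nonzero_on_fibres k Q" "J = (\<lambda>z. P z / Q z)"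
    and inv: "\<And>X z. X \<in> sym_alg \<Longrightarrow> z \<in> equation_inf \<Longrightarrow> Q z \<noteq> 0 \<Longrightarrow> Lie (prolong X) (\<lambda>z. P z / Q z) z = 0"
    unfolding diff_invariant_def using equation_inf_sub by blast
  have P: "P \<in> alg" and Q: "Q \<in> alg" using PQ(1,2) fibre_poly_alg by auto
  have Qnz: "\<exists>z\<in>equation_inf. pt z = p \<and> Q z \<noteq> 0" for p
    using PQ(3) nonzero_on_fibres_iff[OF PQ(2)] by blast
  \<comment> \<open>Only values over the origin of E enter, so the smooth coefficients become
    constants and the quotient lies in \<open>K\<close>.\<close>
  define P0 where "P0 = (\<lambda>z. P (to_origin z))"
  define Q0 where "Q0 = (\<lambda>z. Q (to_origin z))"
  have PQ0: "P0 \<in> jpoly" "Q0 \<in> jpoly" unfolding P0_def Q0_def by (intro to_origin_jpoly P Q)+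
  note PQ0_alg = PQ0[THEN jpoly_alg]
  have rel: "P z * Q0 z = P0 z * Q z" if "z \<in> equation_inf" for z
    unfolding P0_def Q0_def by (rule invariant_to_origin[OF P Q Qnz inv that])
  have Q0nz: "\<exists>z\<in>equation_inf. pt z = p \<and> Q0 z \<noteq> 0" for p
  proof -
    obtain z' where "z' \<in> equation_inf" "pt z' = 0" "Q z' \<noteq> 0" using Qnz by blast
    with to_origin_surj[of z' p] show ?thesis unfolding Q0_def by blast
  qed
  \<comment> \<open>Differentiating \<open>rel\<close> along the field, which is tangent to the
    equation, transfers the invariance from \<open>P / Q\<close> to \<open>P0 / Q0\<close>. The
    remaining factor \<open>Q\<close> is cancelled by density within a fibre.\<close>
  have inv0: "Lie (prolong X) P0 z * Q0 z - P0 z * Lie (prolong X) Q0 z = 0" if X: "X \<in> sym_alg" and z: "z \<in> equation_inf" for X z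
  proof -
    obtain a b c d e where S: "symmetry a b c d e" "X = field a b c d e" using X by (rule sym_alg_symmetry)
    note smooth = symmetry.smooth_field[OF S(1), folded S(2)]
    let ?L = "Lie (prolong X)"
    have L: "?L f \<in> alg" if "f \<in> alg" for f by (rule Lie_alg[OF that prolong_alg[OF smooth]])
    have "(\<lambda>z. P z * Q0 z - P0 z * Q z) \<in> alg" by (intro alg_intros P Q PQ0_alg)
    then have van: "?L (\<lambda>z. P z * Q0 z - P0 z * Q z) z = 0" if "z \<in> equation_inf" for z
      unfolding S(2) by (rule symmetry.vanish[OF S(1) _ _ that]) (simp add: rel)
    have van': "?L P z * Q0 z + P z * ?L Q0 z - (?L P0 z * Q z + P0 z * ?L Q z) = 0" if "z \<in> equation_inf" for z
      using van[OF that] by (simp add: Lie_diff Lie_mult P Q PQ0_alg alg_intros)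
    have "(?L P0 z * Q0 z - P0 z * ?L Q0 z) * Q z = 0" if z: "z \<in> equation_inf" for z
    proof (cases "Q z = 0")
      case False
      have "is_frac (\<lambda>z. P z / Q z) P Q" by (simp add: is_frac_def P Q)
      from Lie_frac[OF this False, of "prolong X"] inv[OF X z False] False
      have "?L P z * Q z - P z * ?L Q z = 0" by simp
      with van'[OF z] rel[OF z] have "(?L P0 z * Q0 z - P0 z * ?L Q0 z) * Q z * Q z = 0" by algebra
      then show ?thesis using False by simp
    qed simp
    moreover have "(\<lambda>z. ?L P0 z * Q0 z - P0 z * ?L Q0 z) \<in> alg" by (intro alg_intros L PQ0_alg)
    moreover obtain z1 where "z1 \<in> equation_inf" "pt z1 = pt z" "Q z1 \<noteq> 0" using Qnz by blast
    ultimately show ?thesis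
      using fibre_density[of "\<lambda>z. ?L P0 z * Q0 z - P0 z * ?L Q0 z" Q "pt z" z1 z] Q z by blast
  qed
  define J0 where "J0 = (\<lambda>z. P0 z / Q0 z)"
  have nz0: "nonzero_poly Q0" unfolding nonzero_poly_def using PQ0(2) Q0nz by blast
  have J0: "ratl J0" unfolding J0_def by (rule ratlI[OF PQ0(1) nz0]) simp
  have frac0: "is_frac J0 P0 Q0" by (simp add: is_frac_def J0_def PQ0_alg)
  have ann: "annihilated X J0" if "X \<in> sym_alg" for X
    unfolding annihilated_def
    by (intro conjI J0, rule weakly_mono[OF weakly_nonzero[OF nz0]]) (simp add: Lie_frac[OF frac0] inv0[OF that])
  have "J0 \<in> K" unfolding J0_def
    by (rule K_divide[OF jpoly_K[OF PQ0(1)] jpoly_K[OF PQ0(2)] weakly_nonzero[OF nz0]])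
  from invariant_field[OF ann this] obtain A B where
    AB: "A \<in> real_algebra iterates" "B \<in> real_algebra iterates" "\<not> weakly (\<lambda>z. B z = 0)" "weakly (\<lambda>z. B z * J0 z = A z)"
    by blast
  obtain A' n where A': "A' \<in> jpoly" "is_frac A A' (\<lambda>z. (u_x z * u_xx z) ^ Suc n)"
    using regular_algebra[OF AB(1)] by (rule regular_frac)
  obtain B' l where B': "B' \<in> jpoly" "is_frac B B' (\<lambda>z. (u_x z * u_xx z) ^ Suc l)"
    using regular_algebra[OF AB(2)] by (rule regular_frac)
  have A'eq: "A z = A' z / (u_x z * u_xx z) ^ Suc n" and B'eq: "B z = B' z / (u_x z * u_xx z) ^ Suc l" if "good z" for z
    using that A'(2) B'(2) good_iff[of z n] good_iff[of z l] unfolding is_frac_def by blast+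
  let ?D = "\<lambda>z. u_x z * u_xx z"
  \<comment> \<open>Clearing denominators turns the generic identity into one between polynomials,
    which then extends to the entire equation and hence to all base points.\<close>
  let ?h = "\<lambda>z. B' z * ?D z ^ Suc n * P0 z - A' z * ?D z ^ Suc l * Q0 z"
  have h: "?h \<in> jpoly" by (intro jpoly_intros A' B' PQ0)
  have "weakly (\<lambda>z. ?h z = 0)"
  proof (rule weakly_mono[OF weakly_conj[OF AB(4) weakly_conj[OF weakly_good weakly_nonzero[OF nz0]]]])
    fix z assume z: "B z * J0 z = A z \<and> good z \<and> Q0 z \<noteq> 0"
    define x y where "x = ?D z ^ Suc n" and "y = ?D z ^ Suc l"
    have "x \<noteq> 0" "y \<noteq> 0" using z good_iff[of z n] good_iff[of z l] unfolding x_def y_def by blast+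
    moreover have "B' z / y * (P0 z / Q0 z) = A' z / x"
      using z A'eq[of z] B'eq[of z] unfolding x_def y_def J0_def by (simp only:)
    ultimately have "B' z * x * P0 z - A' z * y * Q0 z = 0" using z by (simp add: field_simps)
    then show "?h z = 0" by (simp only: x_def y_def)
  qed
  then have h0: "?h z = 0" if "z \<in> equation_inf" for z using weakly_zero[OF h _ that] by blast
  \<comment> \<open>Excludes the zeros of all denominators involved. Each factor is nonzero
    somewhere on every fibre, and therefore so is the product.\<close>
  define R where "R = (\<lambda>z. B' z * ?D z * (Q z * Q0 z))"
  have D: "?D \<in> alg" by (intro alg_intros)
  have R: "R \<in> alg" unfolding R_def by (intro alg_intros jpoly_alg[OF B'(1)] Q PQ0_alg)
  have Rnz: "\<exists>z\<in>equation_inf. pt z = p \<and> R z \<noteq> 0" for p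
    unfolding R_def
  proof (intro fibrewise_nonzero_mult alg_intros jpoly_alg[OF B'(1)] Q PQ0_alg Qnz Q0nz algebra_nonzero_on_fibres[OF AB(2,3) B'])
    show "\<exists>z\<in>equation_inf. pt z = p \<and> u_x z \<noteq> 0" "\<exists>z\<in>equation_inf. pt z = p \<and> u_xx z \<noteq> 0"
      using exists_good[of p] by (metis zero_neq_one)+
  qed
  show "\<exists>A\<in>real_algebra iterates. \<exists>B\<in>real_algebra iterates. generically (\<lambda>z. B z \<noteq> 0 \<and> J z = A z / B z)"
  proof (rule bexI[OF bexI[OF _ AB(2)] AB(1)])
    obtain m where m: "R \<in> fibre_poly m" using alg_fibre_poly[OF R] by blast
    show "generically (\<lambda>z. B z \<noteq> 0 \<and> J z = A z / B z)"
      unfolding generically_def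
    proof (intro exI[of _ m] bexI[OF _ m] conjI ballI impI)
      show "nonzero_on_fibres m R" unfolding nonzero_on_fibres_iff[OF m] using Rnz by blast
    next
      fix z assume z: "z \<in> equation_inf" "R z \<noteq> 0"
      then have nz: "B' z \<noteq> 0" "good z" "Q z \<noteq> 0" "Q0 z \<noteq> 0" by (auto simp: R_def good_def)
      define x y where "x = ?D z ^ Suc n" and "y = ?D z ^ Suc l"
      have xy: "x \<noteq> 0" "y \<noteq> 0" using nz good_iff[of z n] good_iff[of z l] unfolding x_def y_def by blast+
      have e: "A z = A' z / x" "B z = B' z / y" using A'eq[OF nz(2)] B'eq[OF nz(2)] by (simp_all only: x_def y_def)
      show "B z \<noteq> 0" using e nz xy by simp
      have "P z / Q z = P0 z / Q0 z" using rel[OF z(1)] nz by (simp add: field_simps)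
      moreover have "B' z * x * P0 z - A' z * y * Q0 z = 0" using h0[OF z(1)] by (simp only: x_def y_def)
      then have "P0 z / Q0 z = (A' z / x) / (B' z / y)" using nz xy by (simp add: field_simps)
      ultimately show "J z = A z / B z" unfolding PQ(4) e by simp
    qed
  qed
qed

theorem theorem4:
  shows "diff_invariant 2 I2
    \<and> invariant_derivation nabla1 \<and> invariant_derivation nabla2 \<and> invariant_derivation nabla3
    \<and> generate_invariants {nabla1, nabla2, nabla3} I2"
  using diff_invariant_I2 invariant_derivation_nab[of Xi] invariant_derivation_nab[of Yi] invariant_derivation_nab[of Ti]
    generate_I2 by (simp add: nab_eq)

end
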